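(* Let $T>0$ and let $M_t$ be a smooth solution on the time interval $[0,T]$ of the flow $\frac{dF}{dt}=-(H-\langle\overline{\nabla}\omega,\nu\rangle)\nu$ of hypersurfaces in $\mathbb{R}^{n+1}$. If $\overline{\nabla}^3\omega\equiv 0$ and $M_0$ is convex, then $M_t$ is convex for all $t\in[0,T]$.
   Context: $M$ is a compact oriented $n$-dimensional manifold, $\omega:\mathbb{R}^{n+1}\to\mathbb{R}$ is a given smooth function, $\overline{\nabla}$ is the standard derivative in $\mathbb{R}^{n+1}$ (so $\overline{\nabla}\omega$ is the gradient and $\overline{\nabla}^3\omega$ the tensor of third derivatives). In the flow, $F_t=F(\cdot,t):M\to\mathbb{R}^{n+1}$ is a family of smooth immersions, $M_t=F_t(M)$, $\nu$ is the outer unit normal of $M_t$, $g_{ij}=\langle\partial_iF,\partial_jF\rangle$ is the induced metric, $h_{ij}=-\langle\nu,\nabla_i\nabla_jF\rangle$ is the second fundamental form (positive definite on round spheres), and $H=g^{ij}h_{ij}$. A hypersurface is convex if its second fundamental form $(h_{ij})$ is positive semidefinite everywhere. *)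

theory Defs
  imports "HOL-Analysis.Analysis"
begin

section \<open>Smooth maps\<close>

text \<open>
  The sets \<open>S\<close> used below are open sets and products of an open set with a nondegenerate compact
  interval. On these the derivative within \<open>S\<close> is unique: it is the ordinary derivative at interior
  points and the one-sided one at the end points of the interval.
\<close>

primrec Ck_on :: "nat \<Rightarrow> 'a::real_normed_vector set \<Rightarrow> ('a \<Rightarrow> 'b::real_normed_vector) \<Rightarrow> bool" where
  "Ck_on 0 S f \<longleftrightarrow> continuous_on S f"
| "Ck_on (Suc k) S f \<longleftrightarrow>
     f differentiable_on S \<and> (\<forall>v. Ck_on k S (\<lambda>x. frechet_derivative f (at x within S) v))"

definition smooth_on :: "'a::real_normed_vector set \<Rightarrow> ('a \<Rightarrow> 'b::real_normed_vector) \<Rightarrow> bool" where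
  "smooth_on S f \<longleftrightarrow> (\<forall>k. Ck_on k S f)"

definition partial :: "'n::finite \<Rightarrow> (real ^ 'n \<Rightarrow> 'b::real_normed_vector) \<Rightarrow> real ^ 'n \<Rightarrow> 'b" where
  "partial i f x = frechet_derivative f (at x) (axis i 1)"

definition grad :: "(real ^ 'n::finite \<Rightarrow> real) \<Rightarrow> real ^ 'n \<Rightarrow> real ^ 'n" where
  "grad f x = (\<chi> i. partial i f x)"


section \<open>Compact oriented manifolds\<close>

type_synonym ('p, 'n) chart = "'p set \<times> ('p \<Rightarrow> real ^ 'n)"

definition is_chart :: "'p topology \<Rightarrow> ('p, 'n::finite) chart \<Rightarrow> bool" where
  "is_chart M = (\<lambda>(U, \<phi>). openin M U \<and> open (\<phi> ` U) \<and>
     homeomorphic_map (subtopology M U) (top_of_set (\<phi> ` U)) \<phi>)"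

text \<open>The expression of a map \<open>f\<close> on the manifold in a chart; it is relevant on \<open>\<phi> ` U\<close> only.\<close>

definition in_chart :: "('p, 'n::finite) chart \<Rightarrow> ('p \<Rightarrow> 'b) \<Rightarrow> real ^ 'n \<Rightarrow> 'b" where
  "in_chart = (\<lambda>(U, \<phi>) f. f \<circ> inv_into U \<phi>)"

definition oriented_atlas :: "'p topology \<Rightarrow> ('p, 'n::finite) chart set \<Rightarrow> bool" where
  "oriented_atlas M A \<longleftrightarrow>
     (\<forall>c\<in>A. is_chart M c) \<and> topspace M = (\<Union>(U, \<phi>)\<in>A. U) \<and>
     (\<forall>(U, \<phi>)\<in>A. \<forall>(V, \<psi>)\<in>A.
        smooth_on (\<phi> ` (U \<inter> V)) (in_chart (U, \<phi>) \<psi>) \<and>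
        (\<forall>x\<in>\<phi> ` (U \<inter> V). det (matrix (frechet_derivative (in_chart (U, \<phi>) \<psi>) (at x))) > 0))"

definition compact_oriented_manifold :: "'p topology \<Rightarrow> ('p, 'n::finite) chart set \<Rightarrow> bool" where
  "compact_oriented_manifold M A \<longleftrightarrow>
     compact_space M \<and> Hausdorff_space M \<and> second_countable M \<and> oriented_atlas M A"


section \<open>Geometry of hypersurfaces in local coordinates\<close>

text \<open>
  Here \<open>f\<close> is an immersion of an open subset of \<open>real ^ 'n\<close> (a hypersurface expressed in a chart).
  The ambient space of dimension \<open>n + 1\<close> is \<open>real ^ ('n option)\<close>.
\<close>

definition metric :: "(real ^ 'n::finite \<Rightarrow> real ^ ('n option)) \<Rightarrow> real ^ 'n \<Rightarrow> real ^ 'n ^ 'n" where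
  "metric f x = (\<chi> i j. partial i f x \<bullet> partial j f x)"

definition christoffel ::
    "(real ^ 'n::finite \<Rightarrow> real ^ ('n option)) \<Rightarrow> 'n \<Rightarrow> 'n \<Rightarrow> 'n \<Rightarrow> real ^ 'n \<Rightarrow> real" where
  "christoffel f k i j x = (1/2) * (\<Sum>l\<in>UNIV. matrix_inv (metric f x) $ k $ l *
     (partial i (\<lambda>y. metric f y $ j $ l) x + partial j (\<lambda>y. metric f y $ i $ l) x
      - partial l (\<lambda>y. metric f y $ i $ j) x))"

text \<open>\<open>\<nabla>\<^sub>i \<nabla>\<^sub>j f\<close>, the Hessian of the vector-valued function \<open>f\<close> for the Levi-Civita connection
  of its induced metric.\<close>

definition cov_hessian ::
    "(real ^ 'n::finite \<Rightarrow> real ^ ('n option)) \<Rightarrow> 'n \<Rightarrow> 'n \<Rightarrow> real ^ 'n \<Rightarrow> real ^ ('n option)" where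
  "cov_hessian f i j x =
     partial i (partial j f) x - (\<Sum>k\<in>UNIV. christoffel f k i j x *\<^sub>R partial k f x)"

definition second_ff ::
    "(real ^ 'n::finite \<Rightarrow> real ^ ('n option)) \<Rightarrow> real ^ ('n option) \<Rightarrow> real ^ 'n \<Rightarrow> real ^ 'n ^ 'n" where
  "second_ff f \<nu> x = (\<chi> i j. - (\<nu> \<bullet> cov_hessian f i j x))"

definition mean_curvature ::
    "(real ^ 'n::finite \<Rightarrow> real ^ ('n option)) \<Rightarrow> real ^ ('n option) \<Rightarrow> real ^ 'n \<Rightarrow> real" where
  "mean_curvature f \<nu> x =
     (\<Sum>i\<in>UNIV. \<Sum>j\<in>UNIV. matrix_inv (metric f x) $ i $ j * second_ff f \<nu> x $ i $ j)"


section \<open>Immersed hypersurfaces and the flow\<close>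

definition smooth_immersion ::
    "('p, 'n::finite) chart set \<Rightarrow> ('p \<Rightarrow> real ^ ('n option)) \<Rightarrow> bool" where
  "smooth_immersion A f \<longleftrightarrow> (\<forall>(U, \<phi>)\<in>A.
     smooth_on (\<phi> ` U) (in_chart (U, \<phi>) f) \<and>
     (\<forall>x\<in>\<phi> ` U. inj (frechet_derivative (in_chart (U, \<phi>) f) (at x))))"

text \<open>
  For an immersion, the side to which the normal points is determined by the orientation of the
  manifold, with the usual ``outward normal first'' convention: the frame consisting of \<open>\<nu>\<close> followed
  by the image of an oriented frame is positively oriented (index \<open>None\<close> comes first). If the image
  bounds a domain and carries the boundary orientation, then \<open>\<nu>\<close> points out of the domain.
\<close>

definition outer_unit_normal ::
    "('p, 'n::finite) chart set \<Rightarrow> ('p \<Rightarrow> real ^ ('n option)) \<Rightarrow> ('p \<Rightarrow> real ^ ('n option)) \<Rightarrow> bool" where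
  "outer_unit_normal A f \<nu> \<longleftrightarrow> (\<forall>(U, \<phi>)\<in>A. \<forall>p\<in>U.
     norm (\<nu> p) = 1 \<and>
     (\<forall>i. \<nu> p \<bullet> partial i (in_chart (U, \<phi>) f) (\<phi> p) = 0) \<and>
     det (\<chi> r c. (case c of None \<Rightarrow> \<nu> p | Some i \<Rightarrow> partial i (in_chart (U, \<phi>) f) (\<phi> p)) $ r) > 0)"

definition convex_hypersurface ::
    "('p, 'n::finite) chart set \<Rightarrow> ('p \<Rightarrow> real ^ ('n option)) \<Rightarrow> ('p \<Rightarrow> real ^ ('n option)) \<Rightarrow> bool" where
  "convex_hypersurface A f \<nu> \<longleftrightarrow> (\<forall>(U, \<phi>)\<in>A. \<forall>p\<in>U. \<forall>v.
     v \<bullet> (second_ff (in_chart (U, \<phi>) f) (\<nu> p) (\<phi> p) *v v) \<ge> 0)"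

definition smooth_family ::
    "('p, 'n::finite) chart set \<Rightarrow> real \<Rightarrow> (real \<Rightarrow> 'p \<Rightarrow> real ^ ('n option)) \<Rightarrow> bool" where
  "smooth_family A T F \<longleftrightarrow> (\<forall>(U, \<phi>)\<in>A.
     smooth_on (\<phi> ` U \<times> {0..T}) (\<lambda>(x, t). in_chart (U, \<phi>) (F t) x))"

definition smooth_flow_solution ::
    "('p, 'n::finite) chart set \<Rightarrow> (real ^ ('n option) \<Rightarrow> real) \<Rightarrow> real \<Rightarrow>
     (real \<Rightarrow> 'p \<Rightarrow> real ^ ('n option)) \<Rightarrow> (real \<Rightarrow> 'p \<Rightarrow> real ^ ('n option)) \<Rightarrow> bool" where
  "smooth_flow_solution A \<omega> T F \<nu> \<longleftrightarrow>
     smooth_family A T F \<and>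
     (\<forall>t\<in>{0..T}. smooth_immersion A (F t) \<and> outer_unit_normal A (F t) (\<nu> t)) \<and>
     (\<forall>(U, \<phi>)\<in>A. \<forall>p\<in>U. \<forall>t\<in>{0..T}.
        ((\<lambda>s. F s p) has_vector_derivative
           - (mean_curvature (in_chart (U, \<phi>) (F t)) (\<nu> t p) (\<phi> p)
              - grad \<omega> (F t p) \<bullet> \<nu> t p) *\<^sub>R \<nu> t p) (at t within {0..T}))"

end

theory Submission
  imports Defs
begin

text \<open>
  The proof is Hamilton's tensor maximum principle, carried out in graph coordinates. For
  \<open>K\<close> large and every \<open>\<epsilon> > 0\<close> the form \<open>h + \<epsilon> exp(K t) g\<close> stays positive definite. Otherwise there is a
  first time \<open>t0\<close> at which it has a null vector \<open>v\<close>, at some point. Near that point write the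
  hypersurfaces as graphs \<open>z \<mapsto> z + u(z, t) N\<close> over the tangent space, where \<open>N = - \<nu>\<close> at that point; then
  \<open>\<nu> = (D u - N) / W\<close> and \<open>h = D\<^sup>2 u / W\<close> with \<open>W\<^sup>2 = 1 + |D u|\<^sup>2\<close>, and \<open>u\<close> solves the scalar equation
  \<open>u\<^sub>t = \<Delta> u - D\<^sup>2 u(D u, D u) / W\<^sup>2 - \<langle>\<nabla>\<omega>, D u - N\<rangle>\<close>. Differentiating it twice in the direction \<open>v\<close> at the point, where
  \<open>D u = 0\<close>, and using that \<open>\<nabla>\<omega>\<close> is affine, shows that all reaction terms are bounded by \<open>\<epsilon> exp(K t0)\<close> times a
  constant independent of \<open>K\<close> and \<open>\<epsilon>\<close>, which contradicts the choice of \<open>K\<close>.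
\<close>

section \<open>Calculus of smooth maps on open sets\<close>

text \<open>Evolving \<open>h\<close> itself would bring in the Simons identity, the Codazzi
  equations and commutators of covariant derivatives. For one scalar function \<open>u\<close> all
  of this shrinks to commuting partial derivatives, and the null vector extends as a constant
  coordinate field. The affine gradient is essential in one place: two derivatives of the drift
  along \<open>v\<close> would otherwise leave the third derivative of the potential in the
  directions \<open>v, v, N\<close>, a term without a factor \<open>\<epsilon>\<close>. The other
  drift terms get such a factor because a null vector of a semidefinite form lies in its kernel, so
  that \<open>D (D u) v\<close> is a multiple of \<open>v\<close> of size
  \<open>\<epsilon> exp (K t0)\<close>. The perturbation by the metric makes the weak inequality at
  time 0 strict, hence the first degenerate time is positive. Graph coordinates come from inverting
  a map of space and time together, which requires interior times; the argument therefore runs on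
  \<open>{0..<T}\<close>, and time \<open>T\<close> is reached by continuity.\<close>

lemma frechet_derivative_cong:
  assumes "\<And>y. y \<in> S \<Longrightarrow> f y = g y" "x \<in> S"
  shows "frechet_derivative f (at x within S) = frechet_derivative g (at x within S)"
proof -
  have "(f has_derivative D) (at x within S) \<longleftrightarrow> (g has_derivative D) (at x within S)" for D
    using assms by (metis has_derivative_transform)
  then show ?thesis
    by (simp add: frechet_derivative_def)
qed

lemma Ck_on_cong:
  assumes "\<And>x. x \<in> S \<Longrightarrow> f x = g x"
  shows "Ck_on k S f \<longleftrightarrow> Ck_on k S g"
  using assms
proof (induction k arbitrary: f g)
  case 0
  then show ?case by (auto cong: continuous_on_cong)
next
  case (Suc k)
  have "f differentiable_on S \<longleftrightarrow> g differentiable_on S"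
    using Suc.prems unfolding differentiable_on_def differentiable_def
    by (metis has_derivative_transform)
  moreover have "Ck_on k S (\<lambda>x. frechet_derivative f (at x within S) v) \<longleftrightarrow>
      Ck_on k S (\<lambda>x. frechet_derivative g (at x within S) v)" for v
    by (rule Suc.IH) (metis Suc.prems frechet_derivative_cong)
  ultimately show ?case by simp
qed

lemma Ck_on_SucI:
  assumes "open S" "\<And>x. x \<in> S \<Longrightarrow> (f has_derivative f' x) (at x)"
    and "\<And>v. Ck_on k S (\<lambda>x. f' x v)"
  shows "Ck_on (Suc k) S f"
proof -
  have "frechet_derivative f (at x within S) = f' x" if "x \<in> S" for x
    using frechet_derivative_at[OF assms(2)[OF that]] at_within_open[OF that assms(1)] by simp
  then have "Ck_on k S (\<lambda>x. frechet_derivative f (at x within S) v)" for v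
    using assms(3)[of v] by (subst Ck_on_cong) auto
  moreover have "f differentiable_on S"
    using assms(2) by (meson differentiableI differentiable_at_withinI differentiable_on_def)
  ultimately show ?thesis by simp
qed

text \<open>With the direction fixed, the derivative has the same type as the function, so that
  operators such as \<open>dirder v (dirder w f)\<close> can be iterated and commuted.\<close>

definition dirder :: "'a::real_normed_vector \<Rightarrow> ('a \<Rightarrow> 'b::real_normed_vector) \<Rightarrow> 'a \<Rightarrow> 'b" where
  "dirder v f x = frechet_derivative f (at x) v"

lemma Ck_on_SucD:
  assumes "open S" "Ck_on (Suc k) S f"
  shows "\<And>x. x \<in> S \<Longrightarrow> (f has_derivative (\<lambda>v. dirder v f x)) (at x)"
    and "\<And>v. Ck_on k S (dirder v f)"
proof -
  show "(f has_derivative (\<lambda>v. dirder v f x)) (at x)" if "x \<in> S" for x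
  proof -
    have "f differentiable (at x)"
      using assms(2) that unfolding Ck_on.simps differentiable_on_def
      by (metis assms(1) at_within_open)
    then show ?thesis
      unfolding dirder_def by (rule iffD1[OF frechet_derivative_works])
  qed
  fix v
  have "Ck_on k S (\<lambda>x. frechet_derivative f (at x within S) v)"
    using assms by simp
  then show "Ck_on k S (dirder v f)"
    by (subst Ck_on_cong[where g="\<lambda>x. frechet_derivative f (at x within S) v"])
      (auto simp: dirder_def at_within_open_NO_MATCH assms)
qed

lemma Ck_on_SucD_within:
  assumes "Ck_on (Suc k) S f"
  shows "Ck_on k S f"
  using assms
proof (induction k arbitrary: f)
  case 0
  then show ?case by (simp add: differentiable_imp_continuous_on)
next
  case (Suc k)
  then show ?case by (metis Ck_on.simps(2))
qed

lemma Ck_on_le: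
  assumes "Ck_on m S f" "k \<le> m"
  shows "Ck_on k S f"
proof (rule inc_induct[OF assms(2), where P="\<lambda>i. Ck_on i S f"])
  show "Ck_on m S f" by fact
  show "Ck_on i S f" if "Ck_on (Suc i) S f" for i
    using that by (rule Ck_on_SucD_within)
qed

lemma Ck_on_imp_continuous_on: "Ck_on k S f \<Longrightarrow> continuous_on S f"
  using Ck_on_le[of k S f 0] by simp

text \<open>Only the smaller set is open: this is the passage from a closed time interval to its
  interior, where the one-sided derivatives become two-sided.\<close>

lemma Ck_on_open_subset:
  assumes "Ck_on k S f" "S' \<subseteq> S" "open S'"
  shows "Ck_on k S' f"
  using assms
proof (induction k arbitrary: f)
  case 0
  then show ?case by (auto intro: continuous_on_subset)
next
  case (Suc k)
  have eq: "at x within S = at x within S'" if "x \<in> S'" for x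
    using Suc.prems(2,3) that
    by (metis at_within_open at_within_open_subset)
  have "Ck_on k S' (\<lambda>x. frechet_derivative f (at x within S) v)" for v
    using Suc by simp
  then have "Ck_on k S' (\<lambda>x. frechet_derivative f (at x within S') v)" for v
    by (subst Ck_on_cong[where g="\<lambda>x. frechet_derivative f (at x within S) v"]) (auto simp: eq)
  moreover have "f differentiable_on S'"
    using Suc.prems by (auto intro: differentiable_on_subset)
  ultimately show ?case by simp
qed

lemma Ck_on_const: "open S \<Longrightarrow> Ck_on k S (\<lambda>x. c)"
proof (induction k arbitrary: c)
  case (Suc k)
  then show ?case by (intro Ck_on_SucI[where f'="\<lambda>x v. 0"]) auto
qed simp

lemma Ck_on_bounded_linear:
  assumes "bounded_linear f" "open S"
  shows "Ck_on k S f"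
proof (cases k)
  case 0
  then show ?thesis using assms by (simp add: linear_continuous_on)
next
  case (Suc m)
  show ?thesis unfolding Suc
    by (rule Ck_on_SucI[where f'="\<lambda>x. f"]) (use assms in \<open>auto intro: bounded_linear_imp_has_derivative Ck_on_const\<close>)
qed

lemma Ck_on_add:
  assumes "open S" "Ck_on k S f" "Ck_on k S g"
  shows "Ck_on k S (\<lambda>x. f x + g x)"
  using assms(2,3)
proof (induction k arbitrary: f g)
  case 0
  then show ?case by (auto intro: continuous_on_add)
next
  case (Suc k)
  show ?case
  proof (rule Ck_on_SucI[OF assms(1)])
    show "((\<lambda>x. f x + g x) has_derivative (\<lambda>v. dirder v f x + dirder v g x)) (at x)" if "x \<in> S" for x
      by (intro has_derivative_add Ck_on_SucD(1)[OF assms(1) Suc.prems(1)] Ck_on_SucD(1)[OF assms(1) Suc.prems(2)] that)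
    show "Ck_on k S (\<lambda>x. dirder v f x + dirder v g x)" for v
      by (intro Suc.IH Ck_on_SucD(2)[OF assms(1)] Suc.prems)
  qed
qed

lemma (in bounded_bilinear) Ck_on:
  assumes "open S" "Ck_on k S f" "Ck_on k S g"
  shows "Ck_on k S (\<lambda>x. prod (f x) (g x))"
  using assms(2,3)
proof (induction k arbitrary: f g)
  case 0
  then show ?case by (auto intro: continuous_on)
next
  case (Suc k)
  show ?case
  proof (rule Ck_on_SucI[OF assms(1)])
    show "((\<lambda>x. prod (f x) (g x)) has_derivative
        (\<lambda>v. prod (f x) (dirder v g x) + prod (dirder v f x) (g x))) (at x)" if "x \<in> S" for x
      by (intro FDERIV Ck_on_SucD(1)[OF assms(1) Suc.prems(1)] Ck_on_SucD(1)[OF assms(1) Suc.prems(2)] that)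
    show "Ck_on k S (\<lambda>x. prod (f x) (dirder v g x) + prod (dirder v f x) (g x))" for v
      by (intro Ck_on_add[OF assms(1)] Suc.IH Ck_on_SucD(2)[OF assms(1)]
          Ck_on_SucD_within[OF Suc.prems(1)] Ck_on_SucD_within[OF Suc.prems(2)] Suc.prems)
  qed
qed

lemmas Ck_on_scaleR = bounded_bilinear.Ck_on[OF bounded_bilinear_scaleR]
lemmas Ck_on_inner = bounded_bilinear.Ck_on[OF bounded_bilinear_inner]
lemmas Ck_on_mult = bounded_bilinear.Ck_on[OF bounded_bilinear_mult]

lemma Ck_on_linear_compose:
  assumes "open S" "bounded_linear L" "Ck_on k S f"
  shows "Ck_on k S (\<lambda>x. L (f x))"
  using assms(3)
proof (induction k arbitrary: f)
  case 0
  then show ?case using assms by (auto intro: bounded_linear.continuous_on)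
next
  case (Suc k)
  show ?case
  proof (rule Ck_on_SucI[OF assms(1)])
    show "((\<lambda>x. L (f x)) has_derivative (\<lambda>v. L (dirder v f x))) (at x)" if "x \<in> S" for x
      by (intro bounded_linear.has_derivative[OF assms(2)] Ck_on_SucD(1)[OF assms(1) Suc.prems] that)
    show "Ck_on k S (\<lambda>x. L (dirder v f x))" for v
      by (intro Suc.IH Ck_on_SucD(2)[OF assms(1)] Suc.prems)
  qed
qed

lemma Ck_on_minus: "open S \<Longrightarrow> Ck_on k S f \<Longrightarrow> Ck_on k S (\<lambda>x. - f x)"
  by (rule Ck_on_linear_compose) (auto intro: bounded_linear_minus bounded_linear_ident)

lemma Ck_on_sum:
  assumes "open S" "\<And>i. i \<in> I \<Longrightarrow> Ck_on k S (f i)"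
  shows "Ck_on k S (\<lambda>x. \<Sum>i\<in>I. f i x)"
  using assms(2) by (induction I rule: infinite_finite_induct) (auto intro: Ck_on_add[OF assms(1)] Ck_on_const[OF assms(1)])

lemma Ck_on_Pair:
  assumes "open S" "Ck_on k S f" "Ck_on k S g"
  shows "Ck_on k S (\<lambda>x. (f x, g x))"
proof -
  have "bounded_linear (\<lambda>a::'b. (a, 0::'c))" "bounded_linear (\<lambda>b::'c. (0::'b, b))"
    by (auto intro: bounded_linear_Pair bounded_linear_ident bounded_linear_zero)
  then have "Ck_on k S (\<lambda>x. (f x, 0) + (0, g x))"
    using assms by (intro Ck_on_add Ck_on_linear_compose[of S "\<lambda>a. (a,0)"] Ck_on_linear_compose[of S "\<lambda>b. (0,b)"])
  then show ?thesis by simp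
qed

lemma linear_eq_sum_Basis:
  assumes "linear f"
  shows "f v = (\<Sum>b\<in>Basis. (v \<bullet> b) *\<^sub>R f b)"
proof -
  have "f v = f (\<Sum>b\<in>Basis. (v \<bullet> b) *\<^sub>R b)" by (simp add: euclidean_representation)
  then show ?thesis using assms by (simp add: linear_sum linear_scale)
qed

text \<open>The chain rule differentiates \<open>f\<close> in a direction that moves with the point,
  which the induction hypothesis cannot treat. Expanding that direction over \<open>Basis\<close>
  leaves derivatives in fixed directions with scalar coefficients.\<close>

lemma Ck_on_compose:
  fixes g :: "'a::real_normed_vector \<Rightarrow> 'b::euclidean_space" and f :: "'b \<Rightarrow> 'c::real_normed_vector"
  assumes "open S" "open U" "Ck_on k S g" "Ck_on k U f" "g ` S \<subseteq> U"
  shows "Ck_on k S (\<lambda>x. f (g x))"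
  using assms(3,4)
proof (induction k arbitrary: f)
  case 0
  then show ?case using assms(5) by (auto intro: continuous_on_compose2)
next
  case (Suc k)
  have df: "(f has_derivative (\<lambda>w. dirder w f y)) (at y)" if "y \<in> U" for y
    using Ck_on_SucD(1)[OF assms(2) Suc.prems(2) that] .
  have dg: "(g has_derivative (\<lambda>w. dirder w g x)) (at x)" if "x \<in> S" for x
    using Ck_on_SucD(1)[OF assms(1) Suc.prems(1) that] .
  show ?case
  proof (rule Ck_on_SucI[OF assms(1)])
    fix x assume x: "x \<in> S"
    then have gx: "g x \<in> U" using assms(5) by auto
    have "((\<lambda>x. f (g x)) has_derivative (\<lambda>v. dirder (dirder v g x) f (g x))) (at x)"
      using diff_chain_at[OF dg[OF x] df[OF gx]] by (simp add: o_def)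
    then show "((\<lambda>x. f (g x)) has_derivative
        (\<lambda>v. \<Sum>b\<in>Basis. (dirder v g x \<bullet> b) *\<^sub>R dirder b f (g x))) (at x)"
      unfolding linear_eq_sum_Basis[OF has_derivative_linear[OF df[OF gx]], of "dirder _ g x"] .
  next
    fix v
    show "Ck_on k S (\<lambda>x. \<Sum>b\<in>Basis. (dirder v g x \<bullet> b) *\<^sub>R dirder b f (g x))"
      by (intro Ck_on_sum Ck_on_scaleR Ck_on_inner assms(1) Ck_on_const[OF assms(1)] Suc.IH
          Ck_on_SucD[OF assms(1) Suc.prems(1)] Ck_on_SucD[OF assms(2) Suc.prems(2)]
          Ck_on_SucD_within[OF Suc.prems(1)])
  qed
qed

lemma dirder_eqI: "(f has_derivative f') (at x) \<Longrightarrow> dirder v f x = f' v"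
  unfolding dirder_def using frechet_derivative_at by metis

lemma smooth_on_dirder: "open S \<Longrightarrow> smooth_on S f \<Longrightarrow> smooth_on S (dirder v f)"
  unfolding smooth_on_def using Ck_on_SucD(2) by blast

lemma smooth_on_has_derivative:
  "open S \<Longrightarrow> smooth_on S f \<Longrightarrow> x \<in> S \<Longrightarrow> (f has_derivative (\<lambda>v. dirder v f x)) (at x)"
  unfolding smooth_on_def using Ck_on_SucD(1) by blast

lemma smooth_on_continuous_on: "smooth_on S f \<Longrightarrow> continuous_on S f"
  unfolding smooth_on_def using Ck_on.simps(1) by blast

lemma smooth_on_compose:
  fixes g :: "'a::real_normed_vector \<Rightarrow> 'b::euclidean_space"
  assumes "open S" "open U" "smooth_on S g" "smooth_on U f" "g ` S \<subseteq> U"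
  shows "smooth_on S (\<lambda>x. f (g x))"
  using assms Ck_on_compose unfolding smooth_on_def by blast

lemma smooth_on_open_subset: "smooth_on S f \<Longrightarrow> S' \<subseteq> S \<Longrightarrow> open S' \<Longrightarrow> smooth_on S' f"
  unfolding smooth_on_def using Ck_on_open_subset by blast

lemma smooth_on_linear_compose:
  "open S \<Longrightarrow> bounded_linear L \<Longrightarrow> smooth_on S f \<Longrightarrow> smooth_on S (\<lambda>x. L (f x))"
  unfolding smooth_on_def using Ck_on_linear_compose by blast

lemma smooth_on_Pair:
  "open S \<Longrightarrow> smooth_on S f \<Longrightarrow> smooth_on S g \<Longrightarrow> smooth_on S (\<lambda>x. (f x, g x))"
  unfolding smooth_on_def using Ck_on_Pair by blast

lemma smooth_on_bounded_linear: "open S \<Longrightarrow> bounded_linear f \<Longrightarrow> smooth_on S f"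
  unfolding smooth_on_def using Ck_on_bounded_linear by blast

lemma has_vector_derivative_line:
  assumes "(f has_derivative (\<lambda>v. dirder v f (x + s *\<^sub>R v0))) (at (x + s *\<^sub>R v0))"
  shows "((\<lambda>s. f (x + s *\<^sub>R v0)) has_vector_derivative dirder v0 f (x + s *\<^sub>R v0)) (at s)"
proof -
  have "((\<lambda>s. x + s *\<^sub>R v0) has_derivative (\<lambda>h. h *\<^sub>R v0)) (at s)"
    by (auto intro!: derivative_eq_intros)
  from diff_chain_at[OF this assms]
  have "((\<lambda>s. f (x + s *\<^sub>R v0)) has_derivative (\<lambda>h. dirder (h *\<^sub>R v0) f (x + s *\<^sub>R v0))) (at s)"
    by (simp add: o_def)
  then show ?thesis
    unfolding has_vector_derivative_def
    using linear_scale[OF has_derivative_linear[OF assms]] by simp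
qed

text \<open>The second difference of \<open>f\<close> over a small parallelogram is symmetric in
  \<open>v\<close> and \<open>w\<close>. Applying the mean value theorem twice, in either order,
  turns it into a value of either mixed derivative. Were these different at \<open>x\<close>,
  continuity would keep them apart near \<open>x\<close>.\<close>

lemma dirder_commute:
  fixes f :: "'a::real_normed_vector \<Rightarrow> real"
  assumes "open S" "Ck_on 2 S f" "x \<in> S"
  shows "dirder v (dirder w f) x = dirder w (dirder v f) x"
proof (rule ccontr)
  assume ne: "dirder v (dirder w f) x \<noteq> dirder w (dirder v f) x"
  define e where "e = \<bar>dirder v (dirder w f) x - dirder w (dirder v f) x\<bar> / 2"
  have "e > 0" using ne by (simp add: e_def)
  have C2: "Ck_on (Suc (Suc 0)) S f" using assms(2) by (simp add: numeral_2_eq_2)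
  have C1: "Ck_on (Suc 0) S (dirder a f)" for a
    using Ck_on_SucD(2)[OF assms(1) C2] .
  have cont: "continuous_on S (dirder a (dirder b f))" for a b
    using Ck_on_SucD(2)[OF assms(1) C1] Ck_on_imp_continuous_on by blast
  have ev: "\<forall>\<^sub>F y in nhds x. y \<in> S \<and> \<bar>dirder a (dirder b f) y - dirder a (dirder b f) x\<bar> < e" for a b
  proof -
    have "(dirder a (dirder b f) \<longlongrightarrow> dirder a (dirder b f) x) (nhds x)"
      using cont[of a b] assms(1,3) by (simp add: continuous_on_eq_continuous_at isCont_def tendsto_at_iff_tendsto_nhds)
    from tendstoD[OF this \<open>e > 0\<close>] show ?thesis
      using eventually_nhds_in_open[OF assms(1,3)] by eventually_elim (simp add: dist_real_def)
  qed
  obtain d where "d > 0" and d: "\<And>y. dist y x < d \<Longrightarrow> y \<in> S \<and>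
      \<bar>dirder v (dirder w f) y - dirder v (dirder w f) x\<bar> < e \<and>
      \<bar>dirder w (dirder v f) y - dirder w (dirder v f) x\<bar> < e"
    using eventually_conj[OF ev[of v w] ev[of w v]] unfolding eventually_nhds_metric by blast
  \<comment> \<open>The parallelogram with sides \<open>h *\<^sub>R v\<close> and
    \<open>h *\<^sub>R w\<close> then stays within \<open>d / 2\<close> of \<open>x\<close>; the
    summand 1 keeps the denominator positive when both vectors vanish.\<close>
  define h where "h = d / (2 * (norm v + norm w + 1))"
  have pos: "norm v + norm w + 1 > 0" by (smt (verit) norm_ge_zero)
  have "h > 0" using \<open>d > 0\<close> pos by (simp add: h_def)
  have inball: "dist (x + s *\<^sub>R v + r *\<^sub>R w) x < d" if "0 \<le> s" "s \<le> h" "0 \<le> r" "r \<le> h" for s r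
  proof -
    have "norm (s *\<^sub>R v + r *\<^sub>R w) \<le> s * norm v + r * norm w"
      using norm_triangle_ineq[of "s *\<^sub>R v" "r *\<^sub>R w"] that by simp
    also have "\<dots> \<le> h * norm v + h * norm w"
      using that by (intro add_mono mult_right_mono) auto
    also have "\<dots> < h * (norm v + norm w + 1)"
      using \<open>h > 0\<close> by (simp add: algebra_simps)
    also have "\<dots> = d / 2" using pos by (simp add: h_def field_simps)
    finally show ?thesis using \<open>d > 0\<close> by (simp add: dist_norm add.assoc)
  qed
  have inS: "x + s *\<^sub>R v + r *\<^sub>R w \<in> S" if "0 \<le> s" "s \<le> h" "0 \<le> r" "r \<le> h" for s r
    using d[OF inball[OF that]] by simp
  define \<Delta> where "\<Delta> = f (x + h *\<^sub>R v + h *\<^sub>R w) - f (x + h *\<^sub>R v) - f (x + h *\<^sub>R w) + f x"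
  have mv: "\<exists>s r. 0 < s \<and> s < h \<and> 0 < r \<and> r < h \<and>
      f (x + h *\<^sub>R a + h *\<^sub>R b) - f (x + h *\<^sub>R a) - f (x + h *\<^sub>R b) + f x
        = h * h * dirder b (dirder a f) (x + s *\<^sub>R a + r *\<^sub>R b)"
    if inS: "\<And>s r. 0 \<le> s \<Longrightarrow> s \<le> h \<Longrightarrow> 0 \<le> r \<Longrightarrow> r \<le> h \<Longrightarrow> x + s *\<^sub>R a + r *\<^sub>R b \<in> S" for a b
  proof -
    define p where "p s = f ((x + h *\<^sub>R b) + s *\<^sub>R a) - f (x + s *\<^sub>R a)" for s
    have dp: "(p has_real_derivative
        dirder a f ((x + h *\<^sub>R b) + s *\<^sub>R a) - dirder a f (x + s *\<^sub>R a)) (at s)"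
      if "0 \<le> s" "s \<le> h" for s
      unfolding p_def has_real_derivative_iff_has_vector_derivative
      using inS[OF that, of h] inS[OF that, of 0] \<open>h > 0\<close>
      by (intro has_vector_derivative_diff has_vector_derivative_line Ck_on_SucD(1)[OF assms(1) C2])
         (simp_all add: add.assoc add.commute[of "h *\<^sub>R b"])
    obtain s where s: "0 < s" "s < h" "p h - p 0 =
        (h - 0) * (dirder a f ((x + h *\<^sub>R b) + s *\<^sub>R a) - dirder a f (x + s *\<^sub>R a))"
      using MVT2[OF \<open>h > 0\<close> dp] by auto
    define q where "q r = dirder a f ((x + s *\<^sub>R a) + r *\<^sub>R b)" for r
    have dq: "(q has_real_derivative dirder b (dirder a f) ((x + s *\<^sub>R a) + r *\<^sub>R b)) (at r)"
      if "0 \<le> r" "r \<le> h" for r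
      unfolding q_def has_real_derivative_iff_has_vector_derivative
      using inS[of s r] s that
      by (intro has_vector_derivative_line Ck_on_SucD(1)[OF assms(1) C1]) auto
    obtain r where r: "0 < r" "r < h" "q h - q 0 = (h - 0) * dirder b (dirder a f) ((x + s *\<^sub>R a) + r *\<^sub>R b)"
      using MVT2[OF \<open>h > 0\<close> dq] by auto
    have "f (x + h *\<^sub>R a + h *\<^sub>R b) - f (x + h *\<^sub>R a) - f (x + h *\<^sub>R b) + f x = p h - p 0"
      by (simp add: p_def ac_simps)
    also have "\<dots> = h * (q h - q 0)" using s by (simp add: q_def ac_simps)
    also have "\<dots> = h * h * dirder b (dirder a f) (x + s *\<^sub>R a + r *\<^sub>R b)" using r by simp
    finally show ?thesis using s(1,2) r(1,2) by blast
  qed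
  obtain s r where 1: "0 < s" "s < h" "0 < r" "r < h"
      "\<Delta> = h * h * dirder w (dirder v f) (x + s *\<^sub>R v + r *\<^sub>R w)"
    using mv[of v w] inS unfolding \<Delta>_def by blast
  obtain s' r' where 2: "0 < s'" "s' < h" "0 < r'" "r' < h"
      "\<Delta> = h * h * dirder v (dirder w f) (x + s' *\<^sub>R w + r' *\<^sub>R v)"
  proof -
    have "x + s *\<^sub>R w + r *\<^sub>R v \<in> S" if "0 \<le> s" "s \<le> h" "0 \<le> r" "r \<le> h" for s r
      using inS[of r s] that by (simp add: ac_simps)
    then obtain s r where "0 < s" "s < h" "0 < r" "r < h"
      "f (x + h *\<^sub>R w + h *\<^sub>R v) - f (x + h *\<^sub>R w) - f (x + h *\<^sub>R v) + f x
        = h * h * dirder v (dirder w f) (x + s *\<^sub>R w + r *\<^sub>R v)"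
      using mv[of w v] by blast
    then show ?thesis
      by (intro that[of s r]) (simp_all add: \<Delta>_def add.assoc add.commute[of "h *\<^sub>R w"])
  qed
  have "dirder w (dirder v f) (x + s *\<^sub>R v + r *\<^sub>R w) = dirder v (dirder w f) (x + r' *\<^sub>R v + s' *\<^sub>R w)"
    using 1 2 \<open>h > 0\<close> by (simp add: ac_simps)
  moreover have "\<bar>dirder w (dirder v f) (x + s *\<^sub>R v + r *\<^sub>R w) - dirder w (dirder v f) x\<bar> < e"
    "\<bar>dirder v (dirder w f) (x + r' *\<^sub>R v + s' *\<^sub>R w) - dirder v (dirder w f) x\<bar> < e"
    using d[OF inball, of s r] d[OF inball, of r' s'] 1 2 by auto
  ultimately show False
    by (smt (verit) e_def field_sum_of_halves)
qed

section \<open>Smoothness of local inverses\<close>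

text \<open>Since \<open>p\<close> vanishes to first order at \<open>y0\<close>, the variation of
  \<open>q\<close> enters only as a product of two small factors. This allows differentiating an
  inverse that is so far known only to be continuous.\<close>

lemma has_derivative_scaleR_at_zero:
  fixes p :: "'a::real_normed_vector \<Rightarrow> real"
  assumes p: "(p has_derivative p') (at y0)" "p y0 = 0" and q: "isCont q y0"
  shows "((\<lambda>y. p y *\<^sub>R q y) has_derivative (\<lambda>v. p' v *\<^sub>R q y0)) (at y0)"
proof -
  have bl: "bounded_linear p'" using p(1) has_derivative_bounded_linear by blast
  then obtain K where K: "K > 0" "\<And>v. norm (p' v) \<le> norm v * K"
    using bounded_linear.pos_bounded by blast
  have "((\<lambda>y. p y *\<^sub>R (q y - q y0)) has_derivative (\<lambda>v. 0)) (at y0)"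
    unfolding has_derivative_at_alt
  proof (intro conjI allI impI)
    fix e :: real assume "0 < e"
    then have "e / (K + 1) > 0" using K by simp
    then obtain d1 where d1: "d1 > 0" "\<And>y. norm (y - y0) < d1 \<Longrightarrow> norm (q y - q y0) < e / (K + 1)"
      using q unfolding continuous_at_eps_delta dist_norm by meson
    obtain d2 where d2: "d2 > 0" "\<And>y. norm (y - y0) < d2 \<Longrightarrow>
        norm (p y - p y0 - p' (y - y0)) \<le> 1 * norm (y - y0)"
      using p(1) unfolding has_derivative_at_alt by (metis zero_less_one)
    have "norm (p y *\<^sub>R (q y - q y0) - p y0 *\<^sub>R (q y0 - q y0) - 0) \<le> e * norm (y - y0)"
      if "norm (y - y0) < min d1 d2" for y
    proof -
      have "norm (p y) \<le> (K + 1) * norm (y - y0)"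
        using d2(2)[of y] K(2)[of "y - y0"] that p(2) by (auto simp: algebra_simps)
      moreover have "norm (q y - q y0) \<le> e / (K + 1)" using d1(2)[of y] that by simp
      ultimately have "norm (p y) * norm (q y - q y0) \<le> ((K + 1) * norm (y - y0)) * (e / (K + 1))"
        using K by (intro mult_mono) auto
      then show ?thesis using K(1) by (simp add: mult.commute)
    qed
    then show "\<exists>d>0. \<forall>y. norm (y - y0) < d \<longrightarrow>
        norm (p y *\<^sub>R (q y - q y0) - p y0 *\<^sub>R (q y0 - q y0) - 0) \<le> e * norm (y - y0)"
      using d1(1) d2(1) by (intro exI[of _ "min d1 d2"]) auto
  qed simp
  moreover have "((\<lambda>y. p y *\<^sub>R q y0) has_derivative (\<lambda>v. p' v *\<^sub>R q y0)) (at y0)"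
    by (rule has_derivative_scaleR_left[OF p(1)])
  ultimately have "((\<lambda>y. p y *\<^sub>R (q y - q y0) + p y *\<^sub>R q y0) has_derivative (\<lambda>v. 0 + p' v *\<^sub>R q y0)) (at y0)"
    by (rule has_derivative_add)
  then show ?thesis by (simp add: algebra_simps)
qed

text \<open>The lower bound \<open>m\<close> for \<open>A y0\<close> persists as
  \<open>m / 2\<close> for nearby \<open>A y\<close>, and \<open>A y\<close> maps
  \<open>B y w - B y0 w\<close> to \<open>w - A y (B y0 w)\<close>, which tends to zero.\<close>

lemma continuous_on_linear_inverse:
  fixes A B :: "'a::real_normed_vector \<Rightarrow> 'b::euclidean_space \<Rightarrow> 'b"
  assumes "open S" and lin: "\<And>y. y \<in> S \<Longrightarrow> linear (A y)"
    and inv: "\<And>y w. y \<in> S \<Longrightarrow> B y (A y w) = w" "\<And>y w. y \<in> S \<Longrightarrow> A y (B y w) = w"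
    and cont: "\<And>w. continuous_on S (\<lambda>y. A y w)"
  shows "continuous_on S (\<lambda>y. B y w)"
proof (subst continuous_on_eq_continuous_at[OF assms(1)], intro ballI)
  fix y0 assume y0: "y0 \<in> S"
  have contA: "((\<lambda>y. A y v) \<longlongrightarrow> A y0 v) (nhds y0)" for v
    using cont[of v] y0 assms(1) tendsto_at_iff_tendsto_nhds[of "\<lambda>y. A y v" y0]
    by (simp add: continuous_on_eq_continuous_at isCont_def)
  have "inj (A y0)" using inv(1)[OF y0] by (metis injI)
  then obtain m where m: "m > 0" "\<And>z. m * norm z \<le> norm (A y0 z)"
    using linear_inj_bounded_below_pos[OF lin[OF y0]] by blast
  have "((\<lambda>y. \<Sum>b\<in>Basis. norm (A y b - A y0 b)) \<longlongrightarrow> (\<Sum>b\<in>(Basis::'b set). 0)) (nhds y0)"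
    by (intro tendsto_sum tendsto_norm_zero LIM_zero contA)
  then have ev1: "\<forall>\<^sub>F y in nhds y0. (\<Sum>b\<in>Basis. norm (A y b - A y0 b)) < m / 2"
    using m(1) by (intro order_tendstoD(2)) auto
  have ev: "\<forall>\<^sub>F y in nhds y0. norm (B y w - B y0 w) \<le> (2 / m) * norm (A y (B y0 w) - w)"
    using ev1 eventually_nhds_in_open[OF assms(1) y0]
  proof eventually_elim
    case (elim y)
    have low: "m / 2 * norm z \<le> norm (A y z)" for z
    proof -
      have "A y z - A y0 z = (\<Sum>b\<in>Basis. (z \<bullet> b) *\<^sub>R (A y b - A y0 b))"
        by (simp add: linear_eq_sum_Basis[OF lin[OF elim(2)], of z]
            linear_eq_sum_Basis[OF lin[OF y0], of z] scaleR_diff_right sum_subtractf)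
      also have "norm \<dots> \<le> (\<Sum>b\<in>Basis. norm ((z \<bullet> b) *\<^sub>R (A y b - A y0 b)))"
        by (rule norm_sum)
      also have "\<dots> \<le> (\<Sum>b\<in>Basis. norm z * norm (A y b - A y0 b))"
        by (intro sum_mono) (auto intro!: mult_right_mono Basis_le_norm)
      also have "\<dots> \<le> norm z * (m / 2)"
        unfolding sum_distrib_left[symmetric] using elim(1) by (intro mult_left_mono) auto
      finally have "norm (A y z - A y0 z) \<le> norm z * (m / 2)" .
      moreover have "norm (A y0 z) \<le> norm (A y z) + norm (A y z - A y0 z)"
        by (metis norm_minus_commute norm_triangle_sub)
      ultimately show ?thesis using m(2)[of z] by (simp add: field_simps)
    qed
    have "A y (B y w - B y0 w) = w - A y (B y0 w)"
      using inv(2)[OF elim(2)] linear_diff[OF lin[OF elim(2)]] by metis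
    then have "m / 2 * norm (B y w - B y0 w) \<le> norm (A y (B y0 w) - w)"
      using low[of "B y w - B y0 w"] by (simp add: norm_minus_commute)
    then show ?case using m(1) by (simp add: field_simps)
  qed
  have "((\<lambda>y. (2 / m) * norm (A y (B y0 w) - w)) \<longlongrightarrow> (2 / m) * 0) (nhds y0)"
  proof (intro tendsto_mult tendsto_const tendsto_norm_zero LIM_zero)
    show "((\<lambda>y. A y (B y0 w)) \<longlongrightarrow> w) (nhds y0)"
      using contA[of "B y0 w"] inv(2)[OF y0] by simp
  qed
  then have "((\<lambda>y. B y w - B y0 w) \<longlongrightarrow> 0) (nhds y0)"
    using ev by (intro Lim_null_comparison[OF ev]) simp
  then have "((\<lambda>y. B y w) \<longlongrightarrow> B y0 w) (nhds y0)" by (rule LIM_zero_cancel)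
  then show "isCont (\<lambda>y. B y w) y0"
    using tendsto_at_iff_tendsto_nhds[of "\<lambda>y. B y w" y0] by (simp add: isCont_def)
qed

text \<open>The derivative of an inverse is minus \<open>B\<close> composed with the derivative of
  \<open>A\<close> and again with \<open>B\<close>. It is thus of class \<open>k\<close> as soon as
  \<open>B\<close> is, and each step of the induction gains one order.\<close>

lemma Ck_on_linear_inverse:
  fixes A B :: "'a::real_normed_vector \<Rightarrow> 'b::euclidean_space \<Rightarrow> 'b"
  assumes "open S" and lin: "\<And>y. y \<in> S \<Longrightarrow> linear (A y)"
    and inv: "\<And>y w. y \<in> S \<Longrightarrow> B y (A y w) = w" "\<And>y w. y \<in> S \<Longrightarrow> A y (B y w) = w"
    and "\<And>w. Ck_on k S (\<lambda>y. A y w)"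
  shows "Ck_on k S (\<lambda>y. B y w)"
  using assms(5)
proof (induction k arbitrary: w)
  case 0
  then show ?case using continuous_on_linear_inverse[OF assms(1) lin inv] by simp
next
  case (Suc k)
  have linB: "linear (B y)" if "y \<in> S" for y
  proof (rule linearI)
    fix a b c
    have "A y (B y a + B y b) = a + b" "A y (c *\<^sub>R B y a) = c *\<^sub>R a"
      using that by (simp_all add: linear_add[OF lin] linear_scale[OF lin] inv)
    from this[THEN arg_cong, of "B y"]
    show "B y (a + b) = B y a + B y b" "B y (c *\<^sub>R a) = c *\<^sub>R B y a"
      by (simp_all only: inv(1)[OF that])
  qed
  have contB: "continuous_on S (\<lambda>y. B y w)" for w
    by (intro continuous_on_linear_inverse[OF assms(1) lin inv] Ck_on_imp_continuous_on[OF Suc.prems])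
  have CB: "Ck_on k S (\<lambda>y. B y w)" for w
    by (intro Suc.IH Ck_on_SucD_within[OF Suc.prems])
  define A' where "A' b v y = dirder v (\<lambda>y. A y b) y" for b v y
  have dA: "((\<lambda>y. A y b) has_derivative (\<lambda>v. A' b v y)) (at y)" if "y \<in> S" for y b
    unfolding A'_def using Ck_on_SucD(1)[OF assms(1) Suc.prems that] .
  have CA': "Ck_on k S (A' b v)" for b v
    unfolding A'_def using Ck_on_SucD(2)[OF assms(1) Suc.prems] .
  show ?case
  proof (rule Ck_on_SucI[OF assms(1)])
    fix y0 assume y0: "y0 \<in> S"
    \<comment> \<open>These are the coordinates of the residual \<open>w - A y (B y0 w)\<close>.
      They vanish at \<open>y0\<close>, and \<open>B y w - B y0 w\<close> is the combination of the
      continuous \<open>B y c\<close> with these coefficients.\<close>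
    define p where "p c y = (w - A y (B y0 w)) \<bullet> c" for c y
    have dp: "(p c has_derivative (\<lambda>v. - (A' (B y0 w) v y0 \<bullet> c))) (at y0)" for c
      unfolding p_def by (auto intro!: derivative_eq_intros dA y0)
    \<comment> \<open>The vector \<open>B y0 w\<close> moves with the base point. Written over
      \<open>Basis\<close>, the derivative contains only derivatives of \<open>A\<close> at fixed
      vectors, whose regularity is known.\<close>
    have A'lin: "A' (B y0 w) v y0 = (\<Sum>b\<in>Basis. (B y0 w \<bullet> b) *\<^sub>R A' b v y0)" for v
    proof -
      have "((\<lambda>y. \<Sum>b\<in>Basis. (B y0 w \<bullet> b) *\<^sub>R A y b) has_derivative
          (\<lambda>v. \<Sum>b\<in>Basis. (B y0 w \<bullet> b) *\<^sub>R A' b v y0)) (at y0)"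
        by (intro has_derivative_sum has_derivative_scaleR_right dA y0)
      then have "((\<lambda>y. A y (B y0 w)) has_derivative (\<lambda>v. \<Sum>b\<in>Basis. (B y0 w \<bullet> b) *\<^sub>R A' b v y0)) (at y0)"
        by (rule has_derivative_transform_within_open[OF _ assms(1) y0])
          (use linear_eq_sum_Basis lin in metis)
      from has_derivative_unique[OF this dA[OF y0]] show ?thesis by metis
    qed
    have "((\<lambda>y. p c y *\<^sub>R B y c) has_derivative (\<lambda>v. - (A' (B y0 w) v y0 \<bullet> c) *\<^sub>R B y0 c)) (at y0)" for c
      using y0 contB[of c] assms(1) inv(2)[OF y0]
      by (intro has_derivative_scaleR_at_zero dp)
        (auto simp: p_def continuous_on_eq_continuous_at)
    then have "((\<lambda>y. B y0 w + (\<Sum>c\<in>Basis. p c y *\<^sub>R B y c)) has_derivative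
        (\<lambda>v. 0 + (\<Sum>c\<in>Basis. - (A' (B y0 w) v y0 \<bullet> c) *\<^sub>R B y0 c))) (at y0)"
      by (intro has_derivative_add has_derivative_const has_derivative_sum) auto
    then have "((\<lambda>y. B y w) has_derivative
        (\<lambda>v. 0 + (\<Sum>c\<in>Basis. - (A' (B y0 w) v y0 \<bullet> c) *\<^sub>R B y0 c))) (at y0)"
    proof (rule has_derivative_transform_within_open[OF _ assms(1) y0])
      fix y assume y: "y \<in> S"
      have "B y w - B y0 w = B y (w - A y (B y0 w))"
        using inv[OF y] linear_diff[OF linB[OF y]] by metis
      also have "\<dots> = (\<Sum>c\<in>Basis. p c y *\<^sub>R B y c)"
        unfolding p_def by (rule linear_eq_sum_Basis[OF linB[OF y]])
      finally show "B y0 w + (\<Sum>c\<in>Basis. p c y *\<^sub>R B y c) = B y w" by (simp add: algebra_simps)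
    qed
    then show "((\<lambda>y. B y w) has_derivative
        (\<lambda>v. \<Sum>c\<in>Basis. - ((\<Sum>b\<in>Basis. (B y0 w \<bullet> b) *\<^sub>R A' b v y0) \<bullet> c) *\<^sub>R B y0 c)) (at y0)"
      unfolding A'lin by simp
  next
    fix v
    show "Ck_on k S (\<lambda>y. \<Sum>c\<in>Basis. - ((\<Sum>b\<in>Basis. (B y w \<bullet> b) *\<^sub>R A' b v y) \<bullet> c) *\<^sub>R B y c)"
      by (intro Ck_on_sum Ck_on_scaleR Ck_on_minus Ck_on_inner Ck_on_const CB CA' assms(1))
  qed
qed

text \<open>Bootstrapping from the C1 inverse function theorem: the derivative of \<open>g\<close>
  at \<open>y\<close> inverts that of \<open>f\<close> at \<open>g y\<close>, so it is of class
  \<open>k\<close> whenever \<open>g\<close> is, and then \<open>g\<close> is of class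
  \<open>Suc k\<close>.\<close>

theorem smooth_inverse_function:
  fixes f :: "'a::euclidean_space \<Rightarrow> 'a"
  assumes "open U" "smooth_on U f" "x0 \<in> U" and inj0: "\<And>v. dirder v f x0 = 0 \<Longrightarrow> v = 0"
  obtains U' V g where "open U'" "U' \<subseteq> U" "x0 \<in> U'" "open V" "f x0 \<in> V" "homeomorphism U' V f g"
    "smooth_on V g"
proof -
  define f' where "f' x = Blinfun (\<lambda>v. dirder v f x)" for x
  have df: "(f has_derivative (\<lambda>v. dirder v f x)) (at x)" if "x \<in> U" for x
    using smooth_on_has_derivative[OF assms(1,2) that] .
  have f'_apply: "blinfun_apply (f' x) = (\<lambda>v. dirder v f x)" if "x \<in> U" for x
    unfolding f'_def using has_derivative_bounded_linear[OF df[OF that]]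
    by (rule bounded_linear_Blinfun_apply)
  have cont: "continuous_on U f'"
  proof (rule continuous_on_blinfun_componentwise)
    fix i
    have "continuous_on U (dirder i f)"
      by (intro smooth_on_continuous_on smooth_on_dirder assms)
    then show "continuous_on U (\<lambda>x. blinfun_apply (f' x) i)"
      by (rule continuous_on_eq) (simp add: f'_apply)
  qed
  have lin0: "linear (\<lambda>v. dirder v f x0)" using has_derivative_linear[OF df[OF assms(3)]] .
  then have "inj (\<lambda>v. dirder v f x0)" using inj0 linear_injective_0 by blast
  then obtain h where h: "linear h" "\<And>v. h (dirder v f x0) = v"
    using linear_injective_left_inverse[OF lin0] unfolding o_def id_def by metis
  have invf: "Blinfun h o\<^sub>L f' x0 = id_blinfun"
    using h assms(3)
    by (intro blinfun_eqI) (simp add: f'_apply bounded_linear_Blinfun_apply linear_conv_bounded_linear)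
  obtain U' V g g' where *: "open U'" "U' \<subseteq> U" "x0 \<in> U'" "open V" "f x0 \<in> V" "homeomorphism U' V f g"
    and g: "\<And>y. y \<in> V \<Longrightarrow> (g has_derivative (g' y)) (at y)"
    and g': "\<And>y. y \<in> V \<Longrightarrow> g' y = inv (blinfun_apply (f'(g y)))"
    and bij: "\<And>y. y \<in> V \<Longrightarrow> bij (blinfun_apply (f'(g y)))"
  proof (rule inverse_function_theorem[OF assms(1) _ cont assms(3) invf])
    show "(f has_derivative blinfun_apply (f' x)) (at x)" if "x \<in> U" for x
      using df[OF that] by (simp add: f'_apply[OF that])
  qed (rule that)
  have gV: "g y \<in> U" if "y \<in> V" for y
    using * that by (metis homeomorphism_image2 image_eqI subsetD)
  have "Ck_on k V g" for k
  proof (induction k)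
    case 0
    then show ?case using * by (simp add: homeomorphism_def)
  next
    case (Suc k)
    show ?case
    proof (rule Ck_on_SucI[OF *(4) g])
      fix w
      show "Ck_on k V (\<lambda>y. g' y w)"
      proof (rule Ck_on_linear_inverse[OF *(4), where A = "\<lambda>y v. dirder v f (g y)"])
        show "linear (\<lambda>v. dirder v f (g y))" if "y \<in> V" for y
          using has_derivative_linear[OF df[OF gV[OF that]]] .
        show "g' y (dirder v f (g y)) = v" "dirder (g' y v) f (g y) = v" if "y \<in> V" for y v
          using bij[OF that] unfolding g'[OF that] f'_apply[OF gV[OF that]]
          by (simp_all add: bij_is_inj bij_is_surj inv_f_f surj_f_inv_f[of "\<lambda>v. dirder v f (g y)"]
                inv_f_f[of "\<lambda>v. dirder v f (g y)"])
        show "Ck_on k V (\<lambda>y. dirder v f (g y))" for v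
          using smooth_on_dirder[OF assms(1,2), of v] gV
          by (intro Ck_on_compose[OF *(4) assms(1) Suc.IH]) (auto simp: smooth_on_def)
      qed
    qed
  qed
  then have "smooth_on V g" by (simp add: smooth_on_def)
  with * show ?thesis using that by blast
qed

section \<open>Second-order jets of functions of one variable\<close>

text \<open>A relational form of the second-order Taylor data at 0. Differentiability is part of the
  data, so the calculus rules below have no side conditions, and values can be compared by
  uniqueness.\<close>

definition jet2 :: "(real \<Rightarrow> real) \<Rightarrow> real \<Rightarrow> real \<Rightarrow> real \<Rightarrow> bool" where
  "jet2 f a b c \<longleftrightarrow> f 0 = a \<and>
    (\<exists>f'. (\<forall>\<^sub>F s in nhds 0. (f has_real_derivative f' s) (at s)) \<and> f' 0 = b \<and>
      (f' has_real_derivative c) (at 0))"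

lemma jet2I:
  assumes "f 0 = a" "\<forall>\<^sub>F s in nhds 0. (f has_real_derivative f' s) (at s)" "f' 0 = b"
    "(f' has_real_derivative c) (at 0)"
  shows "jet2 f a b c"
  using assms unfolding jet2_def by blast

lemma jet2_DERIV: "jet2 f a b c \<Longrightarrow> (f has_real_derivative b) (at 0)"
  unfolding jet2_def using eventually_nhds_x_imp_x by blast

lemma jet2_cong:
  assumes "jet2 f a b c" "\<forall>\<^sub>F s in nhds 0. f s = g s"
  shows "jet2 g a b c"
proof -
  obtain f' where f': "\<forall>\<^sub>F s in nhds 0. (f has_real_derivative f' s) (at s)" "f' 0 = b"
      "(f' has_real_derivative c) (at 0)" "f 0 = a"
    using assms(1) unfolding jet2_def by blast
  have "\<forall>\<^sub>F s in nhds 0. \<forall>\<^sub>F r in nhds s. f r = g r"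
    using assms(2) by (simp add: eventually_eventually)
  then have "\<forall>\<^sub>F s in nhds 0. (g has_real_derivative f' s) (at s)"
    using f'(1) by eventually_elim (metis DERIV_cong_ev)
  moreover have "g 0 = a" using eventually_nhds_x_imp_x[OF assms(2)] f'(4) by simp
  ultimately show ?thesis using f' by (intro jet2I[where f'=f']) auto
qed

lemma jet2_unique:
  assumes "jet2 f a b c" "jet2 f a' b' c'"
  shows "b = b'" "c = c'"
proof -
  obtain f' where f': "\<forall>\<^sub>F s in nhds 0. (f has_real_derivative f' s) (at s)" "f' 0 = b"
      "(f' has_real_derivative c) (at 0)"
    using assms(1) unfolding jet2_def by blast
  obtain g' where g': "\<forall>\<^sub>F s in nhds 0. (f has_real_derivative g' s) (at s)" "g' 0 = b'"
      "(g' has_real_derivative c') (at 0)"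
    using assms(2) unfolding jet2_def by blast
  have "\<forall>\<^sub>F s in nhds 0. f' s = g' s"
    using f'(1) g'(1) by eventually_elim (metis DERIV_unique)
  moreover from eventually_nhds_x_imp_x[OF this] show "b = b'" using f' g' by simp
  ultimately show "c = c'"
    using f'(3) g'(3) by (metis DERIV_cong_ev DERIV_unique)
qed

lemma jet2_const: "jet2 (\<lambda>s. k) k 0 0"
  by (rule jet2I[where f'="\<lambda>s. 0"]) auto

lemma jet2_ident: "jet2 (\<lambda>s. s) 0 1 0"
  by (rule jet2I[where f'="\<lambda>s. 1"]) auto

lemma jet2_add:
  assumes "jet2 f a b c" "jet2 g a' b' c'"
  shows "jet2 (\<lambda>s. f s + g s) (a + a') (b + b') (c + c')"
proof -
  obtain f' where f': "f 0 = a" "\<forall>\<^sub>F s in nhds 0. (f has_real_derivative f' s) (at s)" "f' 0 = b"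
      "(f' has_real_derivative c) (at 0)"
    using assms(1) unfolding jet2_def by blast
  obtain g' where g': "g 0 = a'" "\<forall>\<^sub>F s in nhds 0. (g has_real_derivative g' s) (at s)" "g' 0 = b'"
      "(g' has_real_derivative c') (at 0)"
    using assms(2) unfolding jet2_def by blast
  show ?thesis
  proof (rule jet2I[where f'="\<lambda>s. f' s + g' s"])
    show "\<forall>\<^sub>F s in nhds 0. ((\<lambda>s. f s + g s) has_real_derivative f' s + g' s) (at s)"
      using f'(2) g'(2) by eventually_elim (rule DERIV_add)
  qed (use f' g' in \<open>auto intro!: DERIV_add\<close>)
qed

lemma jet2_mult:
  assumes "jet2 f a b c" "jet2 g a' b' c'"
  shows "jet2 (\<lambda>s. f s * g s) (a * a') (a * b' + b * a') (a * c' + 2 * b * b' + c * a')"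
proof -
  obtain f' where f': "f 0 = a" "\<forall>\<^sub>F s in nhds 0. (f has_real_derivative f' s) (at s)" "f' 0 = b"
      "(f' has_real_derivative c) (at 0)"
    using assms(1) unfolding jet2_def by blast
  obtain g' where g': "g 0 = a'" "\<forall>\<^sub>F s in nhds 0. (g has_real_derivative g' s) (at s)" "g' 0 = b'"
      "(g' has_real_derivative c') (at 0)"
    using assms(2) unfolding jet2_def by blast
  have f0: "(f has_real_derivative b) (at 0)" and g0: "(g has_real_derivative b') (at 0)"
    using assms jet2_DERIV by auto
  show ?thesis
  proof (rule jet2I[where f'="\<lambda>s. f s * g' s + f' s * g s"])
    show "\<forall>\<^sub>F s in nhds 0. ((\<lambda>s. f s * g s) has_real_derivative f s * g' s + f' s * g s) (at s)"
      using f'(2) g'(2) by eventually_elim (auto intro!: derivative_eq_intros)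
    show "((\<lambda>s. f s * g' s + f' s * g s) has_real_derivative a * c' + 2 * b * b' + c * a') (at 0)"
      using f0 g0 f'(4) g'(4) f'(1,3) g'(1,3) by (auto intro!: derivative_eq_intros)
  qed (use f' g' in auto)
qed

lemma jet2_cmult: "jet2 f a b c \<Longrightarrow> jet2 (\<lambda>s. k * f s) (k * a) (k * b) (k * c)"
  using jet2_mult[OF jet2_const[of k]] by fastforce

lemma jet2_diff:
  assumes "jet2 f a b c" "jet2 g a' b' c'"
  shows "jet2 (\<lambda>s. f s - g s) (a - a') (b - b') (c - c')"
  using jet2_add[OF assms(1) jet2_cmult[OF assms(2), of "-1"]] by simp

lemma jet2_sum:
  assumes "\<And>i. i \<in> I \<Longrightarrow> jet2 (f i) (a i) (b i) (c i)"
  shows "jet2 (\<lambda>s. \<Sum>i\<in>I. f i s) (\<Sum>i\<in>I. a i) (\<Sum>i\<in>I. b i) (\<Sum>i\<in>I. c i)"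
  using assms by (induction I rule: infinite_finite_induct) (auto intro: jet2_const jet2_add)

text \<open>The two derivatives stay existential because the inverse will be multiplied by a
  function whose value and first derivative vanish at 0; to second order only
  \<open>inverse a\<close> survives.\<close>

lemma jet2_inverse:
  assumes "jet2 f a b c" "a \<noteq> 0"
  shows "\<exists>b' c'. jet2 (\<lambda>s. inverse (f s)) (inverse a) b' c'"
proof -
  obtain f' where f': "f 0 = a" "\<forall>\<^sub>F s in nhds 0. (f has_real_derivative f' s) (at s)" "f' 0 = b"
      "(f' has_real_derivative c) (at 0)"
    using assms(1) unfolding jet2_def by blast
  have f0: "(f has_real_derivative b) (at 0)" using assms jet2_DERIV by auto
  then have "(f \<longlongrightarrow> f 0) (nhds 0)"
    using DERIV_isCont isCont_def tendsto_at_iff_tendsto_nhds by blast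
  then have "\<forall>\<^sub>F s in nhds 0. f s \<noteq> 0"
    using f'(1) assms(2) by (intro tendsto_imp_eventually_ne) auto
  then have ev: "\<forall>\<^sub>F s in nhds 0. ((\<lambda>s. inverse (f s)) has_real_derivative
      - (inverse (f s) * f' s * inverse (f s))) (at s)"
    using f'(2) by eventually_elim (auto intro!: derivative_eq_intros)
  have "f 0 \<noteq> 0" using f'(1) assms(2) by simp
  then have "((\<lambda>s. - (inverse (f s) * f' s * inverse (f s))) has_real_derivative
      2 * inverse a ^ 3 * b ^ 2 - inverse a ^ 2 * c) (at 0)"
    by (auto intro!: derivative_eq_intros f0 f'(4) simp: f'(1,3) power2_eq_square power3_eq_cube algebra_simps)
  then show ?thesis
    using jet2I[OF _ ev refl] f'(1) by fastforce
qed

text \<open>A negative second derivative would make \<open>f'\<close> negative just to the right of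
  0, and the mean value theorem would carry \<open>f\<close> below its minimum.\<close>

lemma jet2_min:
  assumes "jet2 f a b c" "\<forall>\<^sub>F s in nhds 0. f s \<ge> a"
  shows "b = 0" "c \<ge> 0"
proof -
  obtain f' where f': "f 0 = a" "\<forall>\<^sub>F s in nhds 0. (f has_real_derivative f' s) (at s)" "f' 0 = b"
      "(f' has_real_derivative c) (at 0)"
    using assms(1) unfolding jet2_def by blast
  have f0: "(f has_real_derivative b) (at 0)" using assms jet2_DERIV by auto
  obtain d where d: "d > 0" "\<And>s. \<bar>s\<bar> < d \<Longrightarrow> f s \<ge> a \<and> (f has_real_derivative f' s) (at s)"
    using eventually_conj[OF assms(2) f'(2)] unfolding eventually_nhds_metric dist_real_def by auto
  show b: "b = 0"
    using DERIV_local_min[OF f0 d(1)] d(2) f'(1) by auto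
  show "c \<ge> 0"
  proof (rule ccontr)
    assume "\<not> c \<ge> 0"
    then obtain e where e: "e > 0" "\<And>h. 0 < h \<Longrightarrow> h < e \<Longrightarrow> f' (0 + h) < f' 0"
      using DERIV_neg_dec_right[OF f'(4)] by (meson not_le)
    define r where "r = min d e / 2"
    have r: "0 < r" "r < d" "r < e" using d(1) e(1) by (auto simp: r_def)
    obtain s where s: "0 < s" "s < r" "f r - f 0 = (r - 0) * f' s"
      using MVT2[OF r(1), of f f'] d(2) r by auto
    have "f' s < 0" using e(2)[of s] s r b f'(3) by simp
    then have "f r < a" using s r f'(1) by (smt (verit) mult_pos_neg)
    then show False using d(2)[of r] r by simp
  qed
qed

lemma eventually_line_in_open:
  fixes x v :: "'a::real_normed_vector"
  assumes "open S" "x \<in> S"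
  shows "\<forall>\<^sub>F s in nhds 0. x + s *\<^sub>R v \<in> S"
proof -
  have "((\<lambda>s. x + s *\<^sub>R v) \<longlongrightarrow> x + 0 *\<^sub>R v) (nhds 0)"
    by (intro tendsto_intros filterlim_ident)
  then show ?thesis
    using assms by (auto dest: topological_tendstoD)
qed

lemma jet2_line:
  fixes f :: "'a::real_normed_vector \<Rightarrow> real"
  assumes "open S" "smooth_on S f" "x \<in> S"
  shows "jet2 (\<lambda>s. f (x + s *\<^sub>R v)) (f x) (dirder v f x) (dirder v (dirder v f) x)"
proof (rule jet2I[where f'="\<lambda>s. dirder v f (x + s *\<^sub>R v)"])
  show "\<forall>\<^sub>F s in nhds 0. ((\<lambda>s. f (x + s *\<^sub>R v)) has_real_derivative dirder v f (x + s *\<^sub>R v)) (at s)"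
    using eventually_line_in_open[OF assms(1,3), of v]
  proof eventually_elim
    case (elim s)
    then show ?case
      unfolding has_real_derivative_iff_has_vector_derivative
      by (intro has_vector_derivative_line smooth_on_has_derivative[OF assms(1,2)])
  qed
  have "((\<lambda>s. dirder v f (x + s *\<^sub>R v)) has_vector_derivative dirder v (dirder v f) (x + 0 *\<^sub>R v)) (at 0)"
    using assms(3)
    by (intro has_vector_derivative_line
        smooth_on_has_derivative[OF assms(1) smooth_on_dirder[OF assms(1,2)]]) simp
  then show "((\<lambda>s. dirder v f (x + s *\<^sub>R v)) has_real_derivative dirder v (dirder v f) x) (at 0)"
    by (simp add: has_real_derivative_iff_has_vector_derivative)
qed simp_all

lemma dirder_cong:
  assumes "open S" "x \<in> S" "\<And>y. y \<in> S \<Longrightarrow> f y = g y"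
  shows "dirder v f x = dirder v g x"
  using frechet_derivative_cong[OF assms(3,2)] assms(1,2)
  by (simp add: dirder_def at_within_open_NO_MATCH)

lemma smooth_dirder_commute:
  fixes f :: "'a::real_normed_vector \<Rightarrow> real"
  assumes "open S" "smooth_on S f" "x \<in> S"
  shows "dirder v (dirder w f) x = dirder w (dirder v f) x"
  using dirder_commute assms unfolding smooth_on_def by blast

lemma smooth_dirder_commute_21:
  fixes f :: "'a::real_normed_vector \<Rightarrow> real"
  assumes "open S" "smooth_on S f" "x \<in> S"
  shows "dirder v (dirder v (dirder w f)) x = dirder w (dirder v (dirder v f)) x"
proof -
  have "dirder v (dirder v (dirder w f)) x = dirder v (dirder w (dirder v f)) x"
    using smooth_dirder_commute[OF assms(1,2)] by (intro dirder_cong[OF assms(1,3)])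
  also have "\<dots> = dirder w (dirder v (dirder v f)) x"
    by (rule smooth_dirder_commute[OF assms(1) smooth_on_dirder[OF assms(1,2)] assms(3)])
  finally show ?thesis .
qed

lemma smooth_dirder_commute_22:
  fixes f :: "'a::real_normed_vector \<Rightarrow> real"
  assumes "open S" "smooth_on S f" "x \<in> S"
  shows "dirder v (dirder v (dirder w (dirder w f))) x = dirder w (dirder w (dirder v (dirder v f))) x"
proof -
  have "dirder v (dirder v (dirder w (dirder w f))) x = dirder w (dirder v (dirder v (dirder w f))) x"
    by (rule smooth_dirder_commute_21[OF assms(1) smooth_on_dirder[OF assms(1,2)] assms(3)])
  also have "\<dots> = dirder w (dirder w (dirder v (dirder v f))) x"
    using smooth_dirder_commute_21[OF assms(1,2)] by (intro dirder_cong[OF assms(1,3)])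
  finally show ?thesis .
qed

section \<open>The maximum principle for graphs\<close>

lemma dirder_eq_sum_axis:
  fixes f :: "(real ^ 'n::finite) \<times> real \<Rightarrow> real"
  assumes "open S" "smooth_on S f" "x \<in> S"
  shows "dirder (v, 0) f x = (\<Sum>i\<in>UNIV. v $ i * dirder (axis i 1, 0) f x)"
proof -
  have lin: "linear (\<lambda>w. dirder w f x)"
    using has_derivative_linear[OF smooth_on_has_derivative[OF assms]] .
  have "(v, 0::real) = (\<Sum>i\<in>UNIV. (v $ i) *\<^sub>R (axis i 1, 0))"
    using basis_expansion[of v] by (simp add: prod_eq_iff fst_sum snd_sum scalar_mult_eq_scaleR)
  then have "dirder (v, 0) f x = (\<Sum>i\<in>UNIV. (v $ i) *\<^sub>R dirder (axis i 1, 0) f x)"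
    by (simp only: linear_sum[OF lin] linear_scale[OF lin])
  then show ?thesis by simp
qed

text \<open>
  The test function is \<open>W (h + \<epsilon> exp(K t) g)(v, v)\<close> with the square root \<open>W\<close> replaced by its upper
  bound \<open>1 + |D u|\<^sup>2 / 2\<close>. This keeps the function nonnegative, and it does not change the value and
  the first derivatives at the null vector, where \<open>D u = 0\<close>.
\<close>

lemma local_maximum_principle:
  fixes u :: "(real ^ 'n::finite) \<times> real \<Rightarrow> real" and v :: "real ^ 'n"
  defines "D \<equiv> \<lambda>i. dirder (axis i 1, 0)" and "Dv \<equiv> dirder (v, 0)" and "Dt \<equiv> dirder (0, 1)"
  assumes V: "open V" "smooth_on V u" "(z0, t0) \<in> V" and K: "\<epsilon> > 0"
    and pde: "\<And>p. p \<in> V \<Longrightarrow> Dt u p = (\<Sum>i\<in>UNIV. D i (D i u) p)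
        - (\<Sum>i\<in>UNIV. \<Sum>j\<in>UNIV. D i u p * D j u p * D i (D j u) p) * inverse (1 + (\<Sum>i\<in>UNIV. D i u p * D i u p))
        - (\<Sum>i\<in>UNIV. (a i + b i \<bullet> fst p + \<gamma> i * u p) * D i u p) + (a0 + b0 \<bullet> fst p + \<gamma>0 * u p)"
    and crit: "\<And>i. D i u (z0, t0) = 0" and unit: "(\<Sum>i\<in>UNIV. v $ i * v $ i) = 1"
    and test: "\<And>z t. (z, t) \<in> V \<Longrightarrow> t \<le> t0 \<Longrightarrow> Dv (Dv u) (z, t) + \<epsilon> * exp (K * t) *
        ((1 + (1/2) * (\<Sum>i\<in>UNIV. D i u (z, t) * D i u (z, t))) * (1 + Dv u (z, t) * Dv u (z, t))) \<ge> 0"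
    and zero: "Dv (Dv u) (z0, t0) = - (\<epsilon> * exp (K * t0))"
    and eig: "\<And>i. D i (Dv u) (z0, t0) = - (\<epsilon> * exp (K * t0)) * v $ i"
  shows "K \<le> (\<Sum>k\<in>UNIV. \<Sum>i\<in>UNIV. (D k (D i u) (z0, t0))\<^sup>2) + \<gamma>0 - 2 * (\<Sum>i\<in>UNIV. (b i \<bullet> v) * v $ i)"
proof -
  define P where "P = (z0, t0)"
  define \<eta> where "\<eta> = \<epsilon> * exp (K * t0)"
  have "\<eta> > 0" using K by (simp add: \<eta>_def)
  have P: "P \<in> V" using V(3) by (simp add: P_def)
  have sm: "smooth_on V (D i f)" "smooth_on V (Dv f)" "smooth_on V (Dt f)"
    if "smooth_on V f" for f :: "(real ^ 'n::finite) \<times> real \<Rightarrow> real" and i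
    unfolding D_def Dv_def Dt_def using smooth_on_dirder[OF V(1) that] by auto
  note smu = sm(1)[OF V(2)] sm(1)[OF sm(1)[OF V(2)]] sm(2)[OF V(2)] sm(2)[OF sm(2)[OF V(2)]] sm(3)[OF V(2)]
  have jv: "jet2 (\<lambda>s. f (P + s *\<^sub>R (v, 0))) (f P) (Dv f P) (Dv (Dv f) P)" if "smooth_on V f" for f
    unfolding Dv_def by (rule jet2_line[OF V(1) that P])
  have jk: "jet2 (\<lambda>s. f (P + s *\<^sub>R (axis k 1, 0))) (f P) (D k f P) (D k (D k f) P)" if "smooth_on V f" for f k
    unfolding D_def by (rule jet2_line[OF V(1) that P])
  have Dvu: "Dv u P = 0"
    using dirder_eq_sum_axis[OF V(1,2) P, of v] crit by (simp add: Dv_def D_def P_def)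
  have crit: "D i u P = 0" for i using crit by (simp add: P_def)
  have zero: "Dv (Dv u) P = - \<eta>" using zero by (simp add: P_def \<eta>_def)
  have eig: "D i (Dv u) P = - \<eta> * v $ i" for i using eig by (simp add: P_def \<eta>_def)
  have eig': "Dv (D i u) P = - \<eta> * v $ i" for i
    using smooth_dirder_commute[OF V(1,2) P] eig unfolding D_def Dv_def by metis
  define q where "q p = Dv (Dv u) p + \<epsilon> * exp (K * snd p) *
    ((1 + (1/2) * (\<Sum>i\<in>UNIV. D i u p * D i u p)) * (1 + Dv u p * Dv u p))" for p
  have q0: "q p \<ge> 0" if "p \<in> V" "snd p \<le> t0" for p
    using test[of "fst p" "snd p"] that by (simp add: q_def)
  have qP: "q P = 0" by (simp add: q_def zero crit Dvu) (simp add: \<eta>_def P_def)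

  \<comment> \<open>At time \<open>t0\<close> the function \<open>q\<close> is nonnegative and
    vanishes at \<open>P\<close>, so its jet along each coordinate line obeys the conditions for a
    minimum. Because \<open>D u\<close> vanishes at \<open>P\<close>, both factors of the
    perturbation have zero first derivative there and only squares of second derivatives of
    \<open>u\<close> remain.\<close>
  have space: "D k (Dv (Dv u)) P = 0"
    "D k (D k (Dv (Dv u))) P + \<eta> * ((\<Sum>i\<in>UNIV. (D k (D i u) P)\<^sup>2) + 2 * \<eta>\<^sup>2 * (v $ k * v $ k)) \<ge> 0" for k
  proof -
    define L where "L s = P + s *\<^sub>R (axis k 1, 0)" for s
    note j = jk[of _ k, folded L_def]
    have 1: "jet2 (\<lambda>s. \<Sum>i\<in>UNIV. D i u (L s) * D i u (L s)) 0 0 (\<Sum>i\<in>UNIV. 2 * (D k (D i u) P)\<^sup>2)"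
      using jet2_sum[of UNIV, OF jet2_mult[OF j j], OF smu(1) smu(1)]
      by (simp add: crit power2_eq_square mult.assoc)
    have 2: "jet2 (\<lambda>s. 1 + (1/2) * (\<Sum>i\<in>UNIV. D i u (L s) * D i u (L s))) 1 0 (\<Sum>i\<in>UNIV. (D k (D i u) P)\<^sup>2)"
      using jet2_add[OF jet2_const[of 1] jet2_cmult[OF 1, of "1/2"]] by (simp add: sum_distrib_left)
    have 3: "jet2 (\<lambda>s. 1 + Dv u (L s) * Dv u (L s)) 1 0 (2 * \<eta>\<^sup>2 * (v $ k * v $ k))"
      using jet2_add[OF jet2_const[of 1] jet2_mult[OF j j, OF smu(3) smu(3)]]
      by (simp add: Dvu eig power2_eq_square mult_ac)
    have "jet2 (\<lambda>s. Dv (Dv u) (L s) + \<eta> * ((1 + (1/2) * (\<Sum>i\<in>UNIV. D i u (L s) * D i u (L s)))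
         * (1 + Dv u (L s) * Dv u (L s)))) 0 (D k (Dv (Dv u)) P)
        (D k (D k (Dv (Dv u))) P + \<eta> * ((\<Sum>i\<in>UNIV. (D k (D i u) P)\<^sup>2) + 2 * \<eta>\<^sup>2 * (v $ k * v $ k)))"
      using jet2_add[OF j[OF smu(4)] jet2_cmult[OF jet2_mult[OF 2 3], of \<eta>]]
      by (simp add: zero add.commute)
    moreover have "\<forall>\<^sub>F s in nhds 0. 0 \<le> Dv (Dv u) (L s) + \<eta> * ((1 + (1/2) * (\<Sum>i\<in>UNIV. D i u (L s) * D i u (L s)))
         * (1 + Dv u (L s) * Dv u (L s)))"
      using eventually_line_in_open[OF V(1) P, of "(axis k 1, 0)"]
    proof eventually_elim
      case (elim s)
      have "snd (L s) = t0" by (simp add: L_def P_def)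
      then show ?case using q0[of "L s"] elim unfolding q_def \<eta>_def L_def[symmetric] by simp
    qed
    ultimately show "D k (Dv (Dv u)) P = 0"
      "D k (D k (Dv (Dv u))) P + \<eta> * ((\<Sum>i\<in>UNIV. (D k (D i u) P)\<^sup>2) + 2 * \<eta>\<^sup>2 * (v $ k * v $ k)) \<ge> 0"
      using jet2_min by blast+
  qed

  \<comment> \<open>Nonnegativity holds only up to \<open>t0\<close>, so the time derivative has a
    sign instead of vanishing: if \<open>q\<close> were increasing at its zero, it would be negative
    just before.\<close>
  have time: "Dt (Dv (Dv u)) P + K * \<eta> \<le> 0"
  proof -
    define L where "L s = P + s *\<^sub>R (0::real^'n, 1::real)" for s
    have dL: "((\<lambda>s. f (L s)) has_real_derivative Dt f P) (at 0)" if "smooth_on V f" for f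
      unfolding L_def Dt_def by (rule jet2_DERIV[OF jet2_line[OF V(1) that P]])
    have L0: "L 0 = P" and sndL: "snd (L s) = t0 + s" for s by (auto simp: L_def P_def)
    have dq: "((\<lambda>s. q (L s)) has_real_derivative Dt (Dv (Dv u)) P + K * \<eta>) (at 0)"
      unfolding q_def sndL
      by (rule derivative_eq_intros dL smu refl
          | simp add: L0 crit Dvu)+ (simp add: \<eta>_def)
    obtain d where d: "d > 0" "\<And>s. \<bar>s\<bar> < d \<Longrightarrow> L s \<in> V"
      using eventually_line_in_open[OF V(1) P, of "(0, 1)"]
      unfolding eventually_nhds_metric dist_real_def L_def by auto
    show ?thesis
    proof (rule ccontr)
      assume "\<not> ?thesis"
      then obtain e where e: "e > 0" "\<And>h. 0 < h \<Longrightarrow> h < e \<Longrightarrow> q (L (0 - h)) < q (L 0)"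
        using DERIV_pos_inc_left[OF dq] by (meson not_le)
      define h where "h = min d e / 2"
      have h: "0 < h" "h < d" "h < e" using d(1) e(1) by (auto simp: h_def)
      have "q (L (0 - h)) \<ge> 0" using d(2)[of "- h"] h by (intro q0) (simp_all add: sndL)
      then show False using e(2)[OF h(1,3)] by (simp add: L0 qP)
    qed
  qed

  define L where "L s = P + s *\<^sub>R (v, 0::real)" for s
  note j = jv[folded L_def]
  have L0: "L 0 = P" by (simp add: L_def zero_prod_def)
  \<comment> \<open>This is the first-order spatial condition after commuting derivatives. The
    undifferentiated drift coefficients multiply exactly these quantities, so they drop out of the
    estimate.\<close>
  have DDv: "Dv (Dv (D i u)) P = 0" for i
    using smooth_dirder_commute_21[OF V(1,2) P] space(1)[of i] unfolding D_def Dv_def by metis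
  have jz: "jet2 (\<lambda>s. c \<bullet> fst (L s)) (c \<bullet> z0) (c \<bullet> v) 0" for c
    using jet2_add[OF jet2_const[of "c \<bullet> z0"] jet2_cmult[OF jet2_ident, of "c \<bullet> v"]]
    by (simp add: L_def P_def inner_add_right mult.commute)
  have u_vv: "(\<Sum>i\<in>UNIV. \<Sum>j\<in>UNIV. v $ i * v $ j * D i (D j u) P) = - \<eta>"
  proof -
    have "D i (Dv u) P = (\<Sum>j\<in>UNIV. v $ j * D i (D j u) P)" for i
    proof -
      have "D i (Dv u) P = Dv (D i u) P"
        using smooth_dirder_commute[OF V(1,2) P] unfolding D_def Dv_def by metis
      also have "\<dots> = (\<Sum>j\<in>UNIV. v $ j * D j (D i u) P)"
        unfolding Dv_def D_def[of] by (rule dirder_eq_sum_axis[OF V(1) smooth_on_dirder[OF V(1,2)] P])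
      also have "\<dots> = (\<Sum>j\<in>UNIV. v $ j * D i (D j u) P)"
        using smooth_dirder_commute[OF V(1,2) P] unfolding D_def by metis
      finally show ?thesis .
    qed
    then have "(\<Sum>i\<in>UNIV. \<Sum>j\<in>UNIV. v $ i * v $ j * D i (D j u) P) = (\<Sum>i\<in>UNIV. v $ i * D i (Dv u) P)"
      by (simp add: sum_distrib_left mult.assoc)
    also have "\<dots> = - \<eta> * (\<Sum>i\<in>UNIV. v $ i * v $ i)"
      by (simp add: eig sum_distrib_left mult_ac sum_negf)
    finally show ?thesis using unit by simp
  qed
  \<comment> \<open>Both gradient factors vanish at \<open>P\<close>, so two derivatives must fall
    on one factor each; by \<open>eig'\<close> each differentiated factor contributes
    \<open>- \<eta> * v $ i\<close>, and \<open>u_vv\<close> the third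
    \<open>- \<eta>\<close>.\<close>
  have m: "jet2 (\<lambda>s. \<Sum>i\<in>UNIV. \<Sum>j\<in>UNIV. D i u (L s) * D j u (L s) * D i (D j u) (L s)) 0 0 (- 2 * \<eta> ^ 3)"
  proof -
    have "jet2 (\<lambda>s. D i u (L s) * D j u (L s) * D i (D j u) (L s)) 0 0
        (2 * \<eta>\<^sup>2 * (v $ i * v $ j * D i (D j u) P))" for i k j :: 'n
      using jet2_mult[OF jet2_mult[OF j j, OF smu(1)[of i] smu(1)[of j]] j[OF smu(2)[of i j]]]
      by (simp add: crit eig' power2_eq_square mult_ac)
    then have "jet2 (\<lambda>s. \<Sum>i\<in>UNIV. \<Sum>j\<in>UNIV. D i u (L s) * D j u (L s) * D i (D j u) (L s))
        (\<Sum>i\<in>(UNIV::'n set). \<Sum>j\<in>(UNIV::'n set). 0) (\<Sum>i\<in>(UNIV::'n set). \<Sum>j\<in>(UNIV::'n set). 0)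
        (\<Sum>i\<in>UNIV. \<Sum>j\<in>UNIV. 2 * \<eta>\<^sup>2 * (v $ i * v $ j * D i (D j u) P))"
      by (intro jet2_sum)
    then show ?thesis
      unfolding sum_distrib_left[symmetric] u_vv by (simp add: power2_eq_square power3_eq_cube mult_ac)
  qed
  have "\<exists>r1 r2. jet2 (\<lambda>s. inverse (1 + (\<Sum>i\<in>UNIV. D i u (L s) * D i u (L s)))) 1 r1 r2"
    using jet2_inverse[OF jet2_add[OF jet2_const[of 1] jet2_sum[of UNIV, OF jet2_mult[OF j j], OF smu(1) smu(1)]]]
    by (simp add: crit)
  then obtain r1 r2 where r: "jet2 (\<lambda>s. inverse (1 + (\<Sum>i\<in>UNIV. D i u (L s) * D i u (L s)))) 1 r1 r2"
    by blast
  have lower: "jet2 (\<lambda>s. \<Sum>i\<in>UNIV. (a i + b i \<bullet> fst (L s) + \<gamma> i * u (L s)) * D i u (L s)) 0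
     (\<Sum>i\<in>UNIV. (a i + b i \<bullet> z0 + \<gamma> i * u P) * (- \<eta> * v $ i)) (- 2 * \<eta> * (\<Sum>i\<in>UNIV. (b i \<bullet> v) * v $ i))"
    using jet2_sum[of UNIV, OF jet2_mult[OF jet2_add[OF jet2_add[OF jet2_const jz] jet2_cmult[OF j[OF V(2)]]]
          j[OF smu(1)]], of a b \<gamma> "\<lambda>i. i"]
    by (simp add: crit eig' DDv Dvu sum_distrib_left sum_negf mult_ac)
  have top: "jet2 (\<lambda>s. a0 + b0 \<bullet> fst (L s) + \<gamma>0 * u (L s)) (a0 + b0 \<bullet> z0 + \<gamma>0 * u P) (b0 \<bullet> v) (- \<gamma>0 * \<eta>)"
    using jet2_add[OF jet2_add[OF jet2_const[of a0] jz[of b0]] jet2_cmult[OF j[OF V(2)], of \<gamma>0]]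
    by (simp add: Dvu zero)
  have lap: "jet2 (\<lambda>s. \<Sum>i\<in>UNIV. D i (D i u) (L s)) (\<Sum>i\<in>UNIV. D i (D i u) P) (\<Sum>i\<in>UNIV. Dv (D i (D i u)) P)
      (\<Sum>i\<in>UNIV. Dv (Dv (D i (D i u))) P)"
    by (intro jet2_sum j smu)
  note rhs = jet2_add[OF jet2_diff[OF jet2_diff[OF lap jet2_mult[OF m r]] lower] top]
  have "\<forall>\<^sub>F s in nhds 0. L s \<in> V"
    unfolding L_def by (rule eventually_line_in_open[OF V(1) P])
  then have "\<forall>\<^sub>F s in nhds 0. (\<Sum>i\<in>UNIV. D i (D i u) (L s))
        - (\<Sum>i\<in>UNIV. \<Sum>j\<in>UNIV. D i u (L s) * D j u (L s) * D i (D j u) (L s))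
           * inverse (1 + (\<Sum>i\<in>UNIV. D i u (L s) * D i u (L s)))
        - (\<Sum>i\<in>UNIV. (a i + b i \<bullet> fst (L s) + \<gamma> i * u (L s)) * D i u (L s))
        + (a0 + b0 \<bullet> fst (L s) + \<gamma>0 * u (L s)) = Dt u (L s)"
    by eventually_elim (simp add: pde)
  \<comment> \<open>The second derivatives along \<open>v\<close> of the two sides of the equation
    agree.\<close>
  from jet2_unique(2)[OF jet2_cong[OF rhs this] j[OF smu(5)]]
  have "Dv (Dv (Dt u)) P = (\<Sum>i\<in>UNIV. Dv (Dv (D i (D i u))) P) + 2 * \<eta> ^ 3
      + 2 * \<eta> * (\<Sum>i\<in>UNIV. (b i \<bullet> v) * v $ i) - \<gamma>0 * \<eta>"
    by simp
  moreover have "Dv (Dv (Dt u)) P = Dt (Dv (Dv u)) P"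
    unfolding Dv_def Dt_def by (rule smooth_dirder_commute_21[OF V(1,2) P])
  moreover have "Dv (Dv (D i (D i u))) P = D i (D i (Dv (Dv u))) P" for i
    unfolding Dv_def D_def by (rule smooth_dirder_commute_22[OF V(1,2) P])
  moreover have "(\<Sum>k\<in>UNIV. D k (D k (Dv (Dv u))) P)
      + \<eta> * ((\<Sum>k\<in>UNIV. \<Sum>i\<in>UNIV. (D k (D i u) P)\<^sup>2) + 2 * \<eta>\<^sup>2) \<ge> 0"
    using sum_nonneg[of UNIV "\<lambda>k. D k (D k (Dv (Dv u))) P + \<eta> * ((\<Sum>i\<in>UNIV. (D k (D i u) P)\<^sup>2)
        + 2 * \<eta>\<^sup>2 * (v $ k * v $ k))"] space(2) unit
    by (simp add: sum.distrib flip: sum_distrib_left)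
  \<comment> \<open>The cubic term of the quasilinear part cancels the one produced by the factor
    \<open>1 + Dv u p * Dv u p\<close> of the test function. After that every term is linear in
    \<open>\<eta>\<close>, and the bound for \<open>K\<close> does not depend on
    \<open>\<epsilon>\<close>.\<close>
  ultimately have "\<eta> * K \<le> \<eta> * ((\<Sum>k\<in>UNIV. \<Sum>i\<in>UNIV. (D k (D i u) P)\<^sup>2) + \<gamma>0
      - 2 * (\<Sum>i\<in>UNIV. (b i \<bullet> v) * v $ i))"
    using time by (simp add: algebra_simps power2_eq_square power3_eq_cube)
  then show ?thesis
    using \<open>\<eta> > 0\<close> by (simp add: P_def)
qed

section \<open>Linear algebra of the fundamental forms\<close>

lemma partial_eq_dirder: "partial i f = dirder (axis i 1) f"
  by (simp add: partial_def dirder_def fun_eq_iff)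

lemma dirder_eq_sum_partial:
  assumes "(f has_derivative (\<lambda>v. dirder v f x)) (at x)"
  shows "dirder w f x = (\<Sum>a\<in>UNIV. (w $ a) *\<^sub>R partial a f x)"
proof -
  note lin = has_derivative_linear[OF assms]
  have "dirder w f x = dirder (\<Sum>a\<in>UNIV. (w $ a) *\<^sub>R axis a 1) f x"
    using basis_expansion[of w] by (simp add: scalar_mult_eq_scaleR)
  also have "\<dots> = (\<Sum>a\<in>UNIV. (w $ a) *\<^sub>R dirder (axis a 1) f x)"
    by (simp only: linear_sum[OF lin] linear_scale[OF lin])
  finally show ?thesis by (simp add: partial_eq_dirder)
qed

lemma matrix_inv:
  fixes A :: "real ^ 'n::finite ^ 'n"
  assumes "invertible A"
  shows "A ** matrix_inv A = mat 1" "matrix_inv A ** A = mat 1"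
  using someI_ex[OF assms[unfolded invertible_def]] unfolding matrix_inv_def by auto

lemma matrix_inv_eqI:
  fixes A :: "real ^ 'n::finite ^ 'n"
  assumes "B ** A = mat 1"
  shows "matrix_inv A = B"
proof -
  have "invertible A" using assms invertible_left_inverse by blast
  then have "B ** (A ** matrix_inv A) = B" by (simp add: matrix_inv)
  then show ?thesis using assms by (simp add: matrix_mul_assoc)
qed

lemma inner_matrix_sum: "v \<bullet> (A *v v) = (\<Sum>i\<in>UNIV. \<Sum>j\<in>UNIV. v $ i * v $ j * A $ i $ j)"
  for A :: "real ^ 'n::finite ^ 'n"
  by (simp add: inner_vec_def matrix_vector_mult_def sum_distrib_left mult_ac)

lemma quadratic_form_congruence:
  fixes A J :: "real ^ 'n::finite ^ 'n"
  shows "v \<bullet> ((transpose J ** A ** J) *v v) = (J *v v) \<bullet> (A *v (J *v v))"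
proof -
  have "v \<bullet> (transpose J *v w) = (J *v v) \<bullet> w" for w
    by (simp add: dot_lmul_matrix inner_commute[of v] inner_commute[of "J *v v"])
  then show ?thesis by (simp only: matrix_vector_mul_assoc[symmetric])
qed

lemma metric_quadratic_form:
  "v \<bullet> (metric f x *v v) = (norm (\<Sum>i\<in>UNIV. (v $ i) *\<^sub>R partial i f x))\<^sup>2"
  unfolding power2_norm_eq_inner inner_matrix_sum
  by (simp add: metric_def inner_sum_left inner_sum_right sum_distrib_left mult_ac inner_commute)

lemma invertible_metric:
  assumes f: "(f has_derivative (\<lambda>v. dirder v f x)) (at x)" and inj: "inj (\<lambda>v. dirder v f x)"
  shows "invertible (metric f x)"
proof -
  have "v = 0" if "metric f x *v v = 0" for v
  proof -
    have "(norm (\<Sum>i\<in>UNIV. (v $ i) *\<^sub>R partial i f x))\<^sup>2 = 0"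
      using that metric_quadratic_form[of v f x] by simp
    then have "dirder v f x = 0" by (simp add: dirder_eq_sum_partial[OF f, of v])
    then show "v = 0"
      using inj linear_injective_0[OF has_derivative_linear[OF f]] by blast
  qed
  then have "inj ((*v) (metric f x))"
    using linear_injective_0[OF matrix_vector_mul_linear] by blast
  then show ?thesis
    using matrix_left_invertible_injective invertible_left_inverse by blast
qed

text \<open>The Christoffel correction is a combination of tangent vectors and is annihilated by a
  normal vector.\<close>

lemma second_ff_normal:
  assumes "\<And>k. \<nu> \<bullet> partial k f x = 0"
  shows "second_ff f \<nu> x $ i $ j = - (\<nu> \<bullet> partial i (partial j f) x)"
  by (simp add: second_ff_def cov_hessian_def inner_diff_right inner_sum_right assms)

text \<open>The transpose makes the index order of the matrix product agree with the double sum, so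
  that the cyclic invariance of the trace becomes applicable.\<close>

lemma mean_curvature_trace:
  "mean_curvature f \<nu> x = trace (matrix_inv (metric f x) ** transpose (second_ff f \<nu> x))"
  by (simp add: mean_curvature_def trace_def matrix_matrix_mult_def transpose_def)

section \<open>Change of coordinates\<close>

text \<open>Serves two purposes: \<open>\<tau>\<close> is a transition between charts of the atlas,
  or the map from graph coordinates to a chart at a fixed time. \<open>J\<close> is its Jacobian
  matrix at \<open>x\<close>.\<close>

context
  fixes \<tau> :: "real ^ 'n::finite \<Rightarrow> real ^ 'n" and y f :: "real ^ 'n \<Rightarrow> real ^ ('n option)"
    and U V x J
  assumes U: "open U" "smooth_on U \<tau>" and V: "open V" "smooth_on V y" "\<tau> ` U \<subseteq> V"
    and f: "\<And>z. z \<in> U \<Longrightarrow> f z = y (\<tau> z)" and x: "x \<in> U"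
  defines "J \<equiv> (\<chi> a i. partial i \<tau> x $ a)"
begin

lemma reparam_partial_at:
  assumes z: "z \<in> U"
  shows "partial i f z = (\<Sum>a\<in>UNIV. (partial i \<tau> z $ a) *\<^sub>R partial a y (\<tau> z))"
proof -
  have \<tau>z: "\<tau> z \<in> V" using z V(3) by auto
  note dy = smooth_on_has_derivative[OF V(1,2) \<tau>z]
  have "((\<lambda>z. y (\<tau> z)) has_derivative (\<lambda>v. dirder (dirder v \<tau> z) y (\<tau> z))) (at z)"
    using diff_chain_at[OF smooth_on_has_derivative[OF U z] dy] by (simp add: o_def)
  then have "(f has_derivative (\<lambda>v. dirder (dirder v \<tau> z) y (\<tau> z))) (at z)"
    by (rule has_derivative_transform_within_open[OF _ U(1) z]) (simp add: f)
  then have "dirder v f z = dirder (dirder v \<tau> z) y (\<tau> z)" for v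
    by (rule dirder_eqI)
  then show ?thesis
    unfolding partial_eq_dirder[of i] by (simp only: dirder_eq_sum_partial[OF dy])
qed

lemma reparam_partial: "partial i f x = (\<Sum>a\<in>UNIV. (J $ a $ i) *\<^sub>R partial a y (\<tau> x))"
  by (simp add: reparam_partial_at[OF x] J_def)

lemma reparam_metric: "metric f x = transpose J ** metric y (\<tau> x) ** J"
  by (simp add: vec_eq_iff metric_def reparam_partial matrix_matrix_mult_def transpose_def
      inner_sum_left inner_sum_right sum_distrib_left sum_distrib_right mult_ac)

text \<open>Second derivatives of \<open>\<tau>\<close> appear only as coefficients of tangent
  vectors, which \<open>\<nu>\<close> annihilates. What remains is a congruence by \<open>J\<close>,
  just as for the metric.\<close>

lemma reparam_second_ff:
  assumes \<nu>: "\<And>a. \<nu> \<bullet> partial a y (\<tau> x) = 0"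
  shows "second_ff f \<nu> x = transpose J ** second_ff y \<nu> (\<tau> x) ** J"
proof -
  have \<tau>x: "\<tau> x \<in> V" using x V(3) by auto
  have "\<nu> \<bullet> partial i (partial j f) x =
      (\<Sum>a\<in>UNIV. \<Sum>b\<in>UNIV. J $ b $ i * J $ a $ j * (\<nu> \<bullet> partial b (partial a y) (\<tau> x)))" for i j
  proof -
    have dc: "((\<lambda>z. partial j \<tau> z $ a) has_derivative (\<lambda>v. dirder v (partial j \<tau>) x $ a)) (at x)" for a
      unfolding partial_eq_dirder
      by (rule bounded_linear.has_derivative[OF bounded_linear_vec_nth
            smooth_on_has_derivative[OF U(1) smooth_on_dirder[OF U] x]])
    have dy: "(partial a y has_derivative (\<lambda>w. dirder w (partial a y) (\<tau> x))) (at (\<tau> x))" for a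
      unfolding partial_eq_dirder
      by (rule smooth_on_has_derivative[OF V(1) smooth_on_dirder[OF V(1,2)] \<tau>x])
    have dya: "((\<lambda>z. partial a y (\<tau> z)) has_derivative
        (\<lambda>v. dirder (dirder v \<tau> x) (partial a y) (\<tau> x))) (at x)" for a
      using diff_chain_at[OF smooth_on_has_derivative[OF U x] dy] by (simp add: o_def)
    have "((\<lambda>z. \<Sum>a\<in>UNIV. (partial j \<tau> z $ a) *\<^sub>R partial a y (\<tau> z)) has_derivative
       (\<lambda>v. \<Sum>a\<in>UNIV. (partial j \<tau> x $ a) *\<^sub>R dirder (dirder v \<tau> x) (partial a y) (\<tau> x)
          + (dirder v (partial j \<tau>) x $ a) *\<^sub>R partial a y (\<tau> x))) (at x)"
      by (intro has_derivative_sum has_derivative_scaleR dc dya)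
    then have "(partial j f has_derivative
       (\<lambda>v. \<Sum>a\<in>UNIV. (partial j \<tau> x $ a) *\<^sub>R dirder (dirder v \<tau> x) (partial a y) (\<tau> x)
          + (dirder v (partial j \<tau>) x $ a) *\<^sub>R partial a y (\<tau> x))) (at x)"
      by (rule has_derivative_transform_within_open[OF _ U(1) x]) (simp add: reparam_partial_at)
    then have "partial i (partial j f) x =
       (\<Sum>a\<in>UNIV. (partial j \<tau> x $ a) *\<^sub>R dirder (partial i \<tau> x) (partial a y) (\<tau> x)
          + (dirder (axis i 1) (partial j \<tau>) x $ a) *\<^sub>R partial a y (\<tau> x))"
      unfolding partial_eq_dirder[of i "partial j f"] partial_eq_dirder[of i \<tau>] by (rule dirder_eqI)
    then have "\<nu> \<bullet> partial i (partial j f) x =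
        (\<Sum>a\<in>UNIV. (partial j \<tau> x $ a) * (\<nu> \<bullet> dirder (partial i \<tau> x) (partial a y) (\<tau> x)))"
      by (simp add: inner_sum_right inner_add_right \<nu>)
    also have "\<dots> = (\<Sum>a\<in>UNIV. \<Sum>b\<in>UNIV. J $ b $ i * J $ a $ j * (\<nu> \<bullet> partial b (partial a y) (\<tau> x)))"
      by (subst dirder_eq_sum_partial[OF dy])
        (simp add: inner_sum_right sum_distrib_left J_def mult_ac)
    finally show ?thesis .
  qed
  moreover have "\<nu> \<bullet> partial k f x = 0" for k
    by (simp add: reparam_partial inner_sum_right \<nu>)
  ultimately show ?thesis
    by (simp add: vec_eq_iff second_ff_normal \<nu> matrix_matrix_mult_def transpose_def
      sum_distrib_left sum_distrib_right sum_negf mult_ac)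
qed

text \<open>The inverse metric changes by the inverse congruence, so the matrix under the trace is
  merely conjugated by \<open>J\<close>.\<close>

lemma reparam_mean_curvature:
  assumes \<nu>: "\<And>a. \<nu> \<bullet> partial a y (\<tau> x) = 0" and J: "invertible J"
    and G: "invertible (metric y (\<tau> x))"
  shows "mean_curvature f \<nu> x = mean_curvature y \<nu> (\<tau> x)"
proof -
  define G S where "G = metric y (\<tau> x)" and "S = transpose (second_ff y \<nu> (\<tau> x))"
  have Jt: "matrix_inv (transpose J) ** transpose J = mat 1"
    using J by (simp add: matrix_inv transpose_invertible)
  have inv: "matrix_inv (metric f x) = matrix_inv J ** matrix_inv G ** matrix_inv (transpose J)"
  proof (rule matrix_inv_eqI)
    have "matrix_inv J ** matrix_inv G ** matrix_inv (transpose J) ** (transpose J ** G ** J) =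
      matrix_inv J ** (matrix_inv G ** ((matrix_inv (transpose J) ** transpose J) ** G)) ** J"
      by (simp add: matrix_mul_assoc)
    also have "\<dots> = mat 1"
      using matrix_inv(2)[OF G] matrix_inv(2)[OF J] by (simp add: Jt G_def)
    finally show "matrix_inv J ** matrix_inv G ** matrix_inv (transpose J) ** metric f x = mat 1"
      by (simp add: reparam_metric G_def)
  qed
  have "transpose (second_ff f \<nu> x) = transpose J ** S ** J"
    by (simp add: reparam_second_ff[OF \<nu>] S_def matrix_transpose_mul matrix_mul_assoc)
  then have "mean_curvature f \<nu> x =
      trace (matrix_inv J ** (matrix_inv G ** ((matrix_inv (transpose J) ** transpose J) ** (S ** J))))"
    by (simp add: mean_curvature_trace inv matrix_mul_assoc)
  also have "\<dots> = trace ((matrix_inv G ** S ** J) ** matrix_inv J)"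
    unfolding Jt by (subst trace_mul_sym) (simp add: matrix_mul_assoc)
  also have "\<dots> = trace (matrix_inv G ** S ** (J ** matrix_inv J))"
    by (simp only: matrix_mul_assoc)
  also have "\<dots> = mean_curvature y \<nu> (\<tau> x)"
    by (simp add: matrix_inv(1)[OF J] mean_curvature_trace G_def S_def)
  finally show ?thesis .
qed

end

section \<open>The unit normal as a function of the tangent frame\<close>

text \<open>The generalised cross product of the frame. Being polynomial in the frame, it inherits
  the frame's continuity.\<close>

definition normal_vector :: "('n::finite \<Rightarrow> real ^ ('n option)) \<Rightarrow> real ^ ('n option)" where
  "normal_vector d = (\<chi> r. det (\<chi> c. case c of None \<Rightarrow> axis r 1 | Some i \<Rightarrow> d i))"

lemma inner_normal_vector:
  "\<xi> \<bullet> normal_vector d = det (\<chi> c. case c of None \<Rightarrow> \<xi> | Some i \<Rightarrow> d i)"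
proof -
  have if_case: "(\<chi> c. case c of None \<Rightarrow> \<zeta> | Some i \<Rightarrow> d i) = (\<chi> c. if c = None then \<zeta> else d (the c))" for \<zeta>
    by (auto simp: vec_eq_iff split: option.split)
  have "det (\<chi> c. if c = None then \<xi> else d (the c)) =
    det (\<chi> c. if c = None then (\<Sum>r\<in>UNIV. (\<xi> $ r) *s axis r 1) else d (the c))"
    by (subst basis_expansion) (rule refl)
  also have "\<dots> = (\<Sum>r\<in>UNIV. det (\<chi> c. if c = None then (\<xi> $ r) *s axis r 1 else d (the c)))"
    by (rule det_linear_row_sum) simp
  also have "\<dots> = (\<Sum>r\<in>UNIV. \<xi> $ r * det (\<chi> c. if c = None then axis r 1 else d (the c)))"
    by (simp add: det_row_mul)
  finally show ?thesis
    by (simp add: normal_vector_def inner_vec_def if_case)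
qed

text \<open>The matrix with rows \<open>\<nu>\<close> and the frame is invertible, and
  \<open>N - (\<nu> \<bullet> N) *\<^sub>R \<nu>\<close> is orthogonal to all its rows, hence zero.
  The same determinant equals \<open>\<nu> \<bullet> N\<close>, so its sign selects one of the two
  unit normals.\<close>

lemma unit_normal_eq:
  fixes d :: "'n::finite \<Rightarrow> real ^ ('n option)"
  assumes "norm \<nu> = 1" "\<And>i. \<nu> \<bullet> d i = 0"
    and det: "det (\<chi> r c. (case c of None \<Rightarrow> \<nu> | Some i \<Rightarrow> d i) $ r) > 0"
  shows "normal_vector d \<noteq> 0" "\<nu> = normal_vector d /\<^sub>R norm (normal_vector d)"
proof -
  define N where "N = normal_vector d"
  define A where "A = (\<chi> c. case c of None \<Rightarrow> \<nu> | Some i \<Rightarrow> d i)"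
  have "transpose A = (\<chi> r c. (case c of None \<Rightarrow> \<nu> | Some i \<Rightarrow> d i) $ r)"
    by (simp add: A_def transpose_def)
  then have detA: "det A > 0" using det det_transpose[of A] by simp
  then have pos: "\<nu> \<bullet> N > 0" by (simp add: N_def inner_normal_vector A_def)
  have dN: "d i \<bullet> N = 0" for i
    unfolding N_def inner_normal_vector
    by (rule det_identical_rows[of None "Some i"]) (simp_all add: row_def vec_eq_iff)
  have "A *v (N - (\<nu> \<bullet> N) *\<^sub>R \<nu>) = 0"
  proof -
    have "(A *v (N - (\<nu> \<bullet> N) *\<^sub>R \<nu>)) $ c = A $ c \<bullet> (N - (\<nu> \<bullet> N) *\<^sub>R \<nu>)" for c
      by (simp add: matrix_vector_mult_def inner_vec_def)
    moreover have "A $ c \<bullet> (N - (\<nu> \<bullet> N) *\<^sub>R \<nu>) = 0" for c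
      using assms(1,2) dN
      by (cases c) (auto simp: A_def inner_diff_right inner_commute norm_eq_1)
    ultimately show ?thesis by (simp add: vec_eq_iff)
  qed
  moreover have "inj ((*v) A)" using detA by (simp add: inj_matrix_vector_mult invertible_det_nz)
  ultimately have N: "N = (\<nu> \<bullet> N) *\<^sub>R \<nu>"
    using linear_injective_0[OF matrix_vector_mul_linear, of A] by fastforce
  show "normal_vector d \<noteq> 0" using pos by (auto simp: N_def)
  have "norm N = \<nu> \<bullet> N" by (subst N) (use pos assms(1) in simp)
  then show "\<nu> = normal_vector d /\<^sub>R norm (normal_vector d)"
    using pos by (subst (2) N_def[symmetric], subst N) (simp add: N_def)
qed

lemma continuous_on_det:
  fixes A :: "'a::topological_space \<Rightarrow> real ^ 'n::finite ^ 'n"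
  assumes "\<And>i j. continuous_on S (\<lambda>s. A s $ i $ j)"
  shows "continuous_on S (\<lambda>s. det (A s))"
  unfolding det_def by (intro continuous_intros assms)

lemma continuous_on_normal_vector:
  assumes "\<And>i. continuous_on S (d i)"
  shows "continuous_on S (\<lambda>s. normal_vector (\<lambda>i. d i s))"
  unfolding normal_vector_def
proof (intro continuous_on_vec_lambda continuous_on_det)
  fix r c k
  show "continuous_on S (\<lambda>s. (\<chi> c. case c of None \<Rightarrow> axis r 1 | Some i \<Rightarrow> d i s) $ c $ k)"
    by (cases c) (auto intro!: continuous_intros assms)
qed

section \<open>Space derivatives of time-dependent maps\<close>

lemma smooth_on_slice:
  fixes h :: "('a::euclidean_space \<times> real) \<Rightarrow> 'b::real_normed_vector"
  assumes "open V" "smooth_on V h"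
  shows "open {z. (z, t) \<in> V}" "smooth_on {z. (z, t) \<in> V} (\<lambda>z. h (z, t))"
proof -
  have "{z. (z, t) \<in> V} = (\<lambda>z. (z, t)) -` V" by auto
  then show o: "open {z. (z, t) \<in> V}"
    using assms(1) by (auto intro!: open_vimage continuous_intros)
  have "Ck_on k {z. (z, t) \<in> V} (\<lambda>z. (z, t))" for k
    using o by (intro Ck_on_Pair Ck_on_const Ck_on_bounded_linear bounded_linear_ident)
  then have "smooth_on {z. (z, t) \<in> V} (\<lambda>z. (z, t))" by (simp add: smooth_on_def)
  then show "smooth_on {z. (z, t) \<in> V} (\<lambda>z. h (z, t))"
    by (rule smooth_on_compose[OF o assms(1) _ assms(2)]) auto
qed

lemma dirder_slice:
  fixes h :: "('a::euclidean_space \<times> real) \<Rightarrow> 'b::real_normed_vector"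
  assumes "open V" "smooth_on V h" "(z, t) \<in> V"
  shows "dirder v (\<lambda>z. h (z, t)) z = dirder (v, 0) h (z, t)"
proof -
  have "((\<lambda>z. (z, t)) has_derivative (\<lambda>v. (v, 0))) (at z)"
    by (auto intro!: derivative_eq_intros)
  from diff_chain_at[OF this smooth_on_has_derivative[OF assms]]
  show ?thesis by (intro dirder_eqI) (simp add: o_def)
qed

text \<open>At the end times the joint derivative is one-sided in \<open>t\<close>. Restricted to a
  time slice it becomes an ordinary derivative, because \<open>U\<close> is open.\<close>

lemma slice_derivative:
  fixes f :: "'a::euclidean_space \<times> real \<Rightarrow> 'b::real_normed_vector"
  assumes "open U" "Ck_on (Suc k) (U \<times> {0..T}) f" "x \<in> U" "t \<in> {0..T}"
  shows "((\<lambda>x. f (x, t)) has_derivative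
      (\<lambda>v. frechet_derivative f (at (x, t) within U \<times> {0..T}) (v, 0))) (at x)"
proof -
  have "f differentiable (at (x, t) within U \<times> {0..T})"
    using assms unfolding Ck_on.simps differentiable_on_def by auto
  then have "(f has_derivative frechet_derivative f (at (x, t) within U \<times> {0..T}))
      (at (x, t) within U \<times> {0..T})"
    by (rule iffD1[OF frechet_derivative_works])
  then have D: "(f has_derivative frechet_derivative f (at (x, t) within U \<times> {0..T}))
      (at (x, t) within (\<lambda>x. (x, t)) ` U)"
    by (rule has_derivative_subset) (use assms in auto)
  have "((\<lambda>x. (x, t)) has_derivative (\<lambda>v. (v, 0))) (at x within U)"
    by (auto intro!: derivative_eq_intros)
  from has_derivative_in_compose[OF this D]
  show ?thesis using assms(1,3) by (simp add: at_within_open_NO_MATCH)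
qed

lemma slice_dirder:
  fixes f :: "'a::euclidean_space \<times> real \<Rightarrow> 'b::real_normed_vector"
  assumes "open U" "Ck_on (Suc k) (U \<times> {0..T}) f" "x \<in> U" "t \<in> {0..T}"
  shows "dirder v (\<lambda>x. f (x, t)) x = frechet_derivative f (at (x, t) within U \<times> {0..T}) (v, 0)"
  by (rule dirder_eqI[OF slice_derivative[OF assms]])

text \<open>This keeps space derivatives regular up to the end times, so that the fundamental forms
  are continuous on the closed time interval, where compactness is used.\<close>

lemma smooth_on_slice_dirder:
  fixes f :: "'a::euclidean_space \<times> real \<Rightarrow> 'b::real_normed_vector"
  assumes "open U" "smooth_on (U \<times> {0..T}) f"
  shows "smooth_on (U \<times> {0..T}) (\<lambda>(x, t). dirder v (\<lambda>x. f (x, t)) x)"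
  unfolding smooth_on_def
proof
  fix k
  have C: "Ck_on (Suc k) (U \<times> {0..T}) f" using assms(2) by (simp add: smooth_on_def del: Ck_on.simps)
  then have "Ck_on k (U \<times> {0..T}) (\<lambda>p. frechet_derivative f (at p within U \<times> {0..T}) (v, 0))"
    unfolding Ck_on.simps by blast
  then show "Ck_on k (U \<times> {0..T}) (\<lambda>(x, t). dirder v (\<lambda>x. f (x, t)) x)"
    by (rule iffD1[OF Ck_on_cong, rotated]) (auto simp: slice_dirder[OF assms(1) C])
qed

section \<open>Orthonormal frames and null vectors\<close>

lemma UNIV_option_sum: "(\<Sum>k\<in>UNIV. F k) = F None + (\<Sum>i\<in>UNIV. F (Some i))"
  for F :: "'n::finite option \<Rightarrow> 'a::comm_monoid_add"
  by (simp add: UNIV_option_conv sum.reindex)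

text \<open>An orthogonal transformation taking the axis \<open>None\<close> to \<open>N\<close>
  takes the remaining axes to an orthonormal basis of the hyperplane orthogonal to
  \<open>N\<close>.\<close>

lemma orthonormal_frame:
  fixes N :: "real ^ ('n::finite option)"
  assumes "norm N = 1"
  obtains e :: "'n \<Rightarrow> real ^ ('n option)"
  where "\<And>i j. e i \<bullet> e j = (if i = j then 1 else 0)" "\<And>i. e i \<bullet> N = 0"
    "\<And>\<xi>. \<xi> = (\<Sum>i\<in>UNIV. (\<xi> \<bullet> e i) *\<^sub>R e i) + (\<xi> \<bullet> N) *\<^sub>R N"
proof -
  have "norm (axis None 1 :: real ^ ('n option)) = norm N" using assms by simp
  then obtain R :: "real ^ ('n option) \<Rightarrow> real ^ ('n option)"
    where R: "orthogonal_transformation R" "R (axis None 1) = N"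
    by (rule orthogonal_transformation_exists) blast
  have inner: "R v \<bullet> R w = v \<bullet> w" for v w using R(1) by (simp add: orthogonal_transformation_def)
  have lin: "linear R" using R(1) by (simp add: orthogonal_transformation_def)
  define e where "e i = R (axis (Some i) 1)" for i
  show ?thesis
  proof
    show "e i \<bullet> e j = (if i = j then 1 else 0)" for i j
      by (simp add: e_def inner inner_axis_axis)
    show "e i \<bullet> N = 0" for i
      by (simp add: e_def inner inner_axis_axis flip: R(2))
    fix \<xi>
    obtain \<zeta> where \<zeta>: "\<xi> = R \<zeta>" using orthogonal_transformation_surj[OF R(1)] by (metis surjD)
    have "\<xi> = R (\<Sum>k\<in>UNIV. (\<zeta> $ k) *\<^sub>R axis k 1)"
      using basis_expansion[of \<zeta>] \<zeta> by (simp add: scalar_mult_eq_scaleR)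
    also have "\<dots> = (\<Sum>k\<in>UNIV. (\<zeta> $ k) *\<^sub>R R (axis k 1))"
      by (simp add: linear_sum[OF lin] linear_scale[OF lin])
    also have "\<dots> = (\<zeta> $ None) *\<^sub>R N + (\<Sum>i\<in>UNIV. (\<zeta> $ Some i) *\<^sub>R e i)"
      by (simp add: UNIV_option_sum R(2) e_def)
    finally have "\<xi> = (\<zeta> $ None) *\<^sub>R N + (\<Sum>i\<in>UNIV. (\<zeta> $ Some i) *\<^sub>R e i)" .
    moreover have "\<zeta> $ None = \<xi> \<bullet> N" "\<zeta> $ Some i = \<xi> \<bullet> e i" for i
      by (simp_all add: \<zeta> e_def inner inner_axis flip: R(2))
    ultimately show "\<xi> = (\<Sum>i\<in>UNIV. (\<xi> \<bullet> e i) *\<^sub>R e i) + (\<xi> \<bullet> N) *\<^sub>R N"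
      by (simp add: add.commute)
  qed
qed

text \<open>A null vector minimises the form, so the first variation in the direction
  \<open>A *v v\<close> vanishes; that variation is twice the squared length of
  \<open>A *v v\<close>.\<close>

lemma positive_semidefinite_null_vector:
  fixes A :: "real ^ 'n::finite ^ 'n"
  assumes sym: "transpose A = A" and psd: "\<And>w. w \<bullet> (A *v w) \<ge> 0" and "v \<bullet> (A *v v) = 0"
  shows "A *v v = 0"
proof -
  define w where "w = A *v v"
  define a b where "a = w \<bullet> w" and "b = w \<bullet> (A *v w)"
  have "b \<ge> 0" by (simp add: b_def psd)
  have vw: "v \<bullet> (A *v w) = a"
    using dot_lmul_matrix[of v A w] sym transpose_matrix_vector[of A v] by (simp add: a_def w_def)
  have "0 \<le> (v + s *\<^sub>R w) \<bullet> (A *v (v + s *\<^sub>R w))" for s by (rule psd)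
  then have q: "0 \<le> 2 * s * a + s * s * b" for s
    using assms(3) vw
    by (simp add: matrix_vector_right_distrib inner_add_left inner_add_right a_def b_def
        matrix_vector_mult_scaleR algebra_simps flip: w_def)
  have "a = 0"
  proof (rule ccontr)
    assume "a \<noteq> 0"
    \<comment> \<open>The quadratic polynomial in \<open>s\<close> is smallest at
      \<open>- a / b\<close>; adding 1 to the denominator covers \<open>b = 0\<close> and still
      gives a negative value.\<close>
    have "2 * (- a / (b + 1)) * a + (- a / (b + 1)) * (- a / (b + 1)) * b = - (a * a) * (b + 2) / (b + 1)\<^sup>2"
      using \<open>b \<ge> 0\<close> by (simp add: divide_simps power2_eq_square) (simp add: algebra_simps)
    also have "\<dots> < 0"
      using \<open>b \<ge> 0\<close> \<open>a \<noteq> 0\<close> by (intro divide_neg_pos mult_neg_pos) (auto simp: zero_less_mult_iff linorder_neq_iff)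
    finally show False using q[of "- a / (b + 1)"] by simp
  qed
  then show ?thesis by (simp add: a_def w_def)
qed

section \<open>The flow in a chart\<close>

text \<open>The flow read in a single chart, with the gradient of the potential already replaced by
  the affine field with constant part \<open>c\<close> and linear part \<open>B\<close>.\<close>

locale flow_chart =
  fixes Om :: "(real ^ 'n::finite) set" and T :: real
    and f \<nu> :: "(real ^ 'n) \<times> real \<Rightarrow> real ^ ('n option)"
    and c :: "real ^ ('n option)" and B :: "real ^ ('n option) ^ ('n option)"
  assumes open_Om: "open Om" and smooth_f: "smooth_on (Om \<times> {0..T}) f" and T_pos: "T > 0"
    and immersed: "\<And>x t. x \<in> Om \<Longrightarrow> t \<in> {0..T} \<Longrightarrow> inj (\<lambda>v. dirder v (\<lambda>x. f (x, t)) x)"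
    and normal_unit: "\<And>x t. x \<in> Om \<Longrightarrow> t \<in> {0..T} \<Longrightarrow> norm (\<nu> (x, t)) = 1"
    and normal_orth: "\<And>x t i. x \<in> Om \<Longrightarrow> t \<in> {0..T} \<Longrightarrow> \<nu> (x, t) \<bullet> partial i (\<lambda>x. f (x, t)) x = 0"
    and normal_pos: "\<And>x t. x \<in> Om \<Longrightarrow> t \<in> {0..T} \<Longrightarrow>
      det (\<chi> r c. (case c of None \<Rightarrow> \<nu> (x, t) | Some i \<Rightarrow> partial i (\<lambda>x. f (x, t)) x) $ r) > 0"
    and flow: "\<And>x t. x \<in> Om \<Longrightarrow> t \<in> {0..T} \<Longrightarrow> ((\<lambda>s. f (x, s)) has_vector_derivative
      - (mean_curvature (\<lambda>x. f (x, t)) (\<nu> (x, t)) x - (c + B *v f (x, t)) \<bullet> \<nu> (x, t)) *\<^sub>R \<nu> (x, t))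
        (at t within {0..T})"
begin

definition chart_metric :: "(real ^ 'n) \<times> real \<Rightarrow> real ^ 'n ^ 'n" where
  "chart_metric = (\<lambda>(x, t). metric (\<lambda>x. f (x, t)) x)"

definition chart_second_ff :: "(real ^ 'n) \<times> real \<Rightarrow> real ^ 'n ^ 'n" where
  "chart_second_ff = (\<lambda>(x, t). second_ff (\<lambda>x. f (x, t)) (\<nu> (x, t)) x)"

lemma continuous_partial: "continuous_on (Om \<times> {0..T}) (\<lambda>(x, t). partial i (\<lambda>x. f (x, t)) x)"
  unfolding partial_eq_dirder
  by (rule smooth_on_continuous_on[OF smooth_on_slice_dirder[OF open_Om smooth_f]])

lemma continuous_partial2:
  "continuous_on (Om \<times> {0..T}) (\<lambda>(x, t). partial i (partial j (\<lambda>x. f (x, t))) x)"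
proof -
  have "continuous_on (Om \<times> {0..T})
      (\<lambda>(x, t). dirder (axis i 1) (\<lambda>x. (\<lambda>(x, t). dirder (axis j 1) (\<lambda>x. f (x, t)) x) (x, t)) x)"
    by (intro smooth_on_continuous_on smooth_on_slice_dirder open_Om smooth_f)
  then show ?thesis by (simp add: partial_eq_dirder[abs_def])
qed

text \<open>Nothing is assumed about the regularity of \<open>\<nu>\<close> in space and time; it is pinned down by its orientation.\<close>

lemma continuous_normal: "continuous_on (Om \<times> {0..T}) \<nu>"
proof -
  define d where "d i = (\<lambda>(x, t). partial i (\<lambda>x. f (x, t)) x)" for i
  define N where "N p = normal_vector (\<lambda>i. d i p)" for p
  have eq: "\<nu> p = N p /\<^sub>R norm (N p)" "N p \<noteq> 0" if "p \<in> Om \<times> {0..T}" for p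
  proof -
    obtain x t where p: "p = (x, t)" "x \<in> Om" "t \<in> {0..T}" using \<open>p \<in> Om \<times> {0..T}\<close> by (cases p) auto
    show "\<nu> p = N p /\<^sub>R norm (N p)" "N p \<noteq> 0"
      using unit_normal_eq[OF normal_unit[OF p(2,3)] normal_orth[OF p(2,3)] normal_pos[OF p(2,3)]]
      by (simp_all add: N_def d_def p(1))
  qed
  have "continuous_on (Om \<times> {0..T}) N"
    unfolding N_def d_def by (rule continuous_on_normal_vector[OF continuous_partial])
  then have "continuous_on (Om \<times> {0..T}) (\<lambda>p. N p /\<^sub>R norm (N p))"
    by (intro continuous_intros) (use eq(2) in auto)
  then show ?thesis by (rule continuous_on_eq) (simp add: eq(1))
qed

lemma continuous_chart_metric: "continuous_on (Om \<times> {0..T}) chart_metric"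
proof -
  have "continuous_on (Om \<times> {0..T}) (\<lambda>p. \<chi> i j. (\<lambda>(x, t). partial i (\<lambda>x. f (x, t)) x) p
      \<bullet> (\<lambda>(x, t). partial j (\<lambda>x. f (x, t)) x) p)"
    by (intro continuous_on_vec_lambda continuous_on_inner continuous_partial)
  then show ?thesis by (simp add: chart_metric_def metric_def split_def)
qed

lemma chart_second_ff_nth:
  "x \<in> Om \<Longrightarrow> t \<in> {0..T} \<Longrightarrow> chart_second_ff (x, t) $ i $ j = - (\<nu> (x, t) \<bullet> partial i (partial j (\<lambda>x. f (x, t))) x)"
  unfolding chart_second_ff_def by (simp add: second_ff_normal normal_orth)

lemma continuous_chart_second_ff: "continuous_on (Om \<times> {0..T}) chart_second_ff"
proof -
  have "continuous_on (Om \<times> {0..T}) (\<lambda>p. \<chi> i j. - (\<nu> p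
      \<bullet> (\<lambda>(x, t). partial i (partial j (\<lambda>x. f (x, t))) x) p))"
    by (intro continuous_on_vec_lambda continuous_on_inner continuous_on_minus continuous_partial2 continuous_normal)
  then show ?thesis
    by (rule continuous_on_eq) (auto simp: vec_eq_iff chart_second_ff_nth)
qed

end

section \<open>Two-sided derivatives at interior times\<close>

context flow_chart
begin

lemma smooth_interior: "open (Om \<times> {0<..<T})" "smooth_on (Om \<times> {0<..<T}) f"
proof -
  show o: "open (Om \<times> {0<..<T})" by (intro open_Times open_Om) simp
  show "smooth_on (Om \<times> {0<..<T}) f"
    by (rule smooth_on_open_subset[OF smooth_f _ o]) auto
qed

lemma dirder_space:
  assumes "x \<in> Om" "t \<in> {0<..<T}"
  shows "dirder (v, 0) f (x, t) = dirder v (\<lambda>x. f (x, t)) x"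
  using dirder_slice[OF smooth_interior, of x t v] assms by simp

lemma has_derivative_slice:
  assumes "x \<in> Om" "t \<in> {0<..<T}"
  shows "((\<lambda>x. f (x, t)) has_derivative (\<lambda>v. dirder v (\<lambda>x. f (x, t)) x)) (at x)"
  using smooth_on_slice[OF smooth_interior, of t] assms
  by (intro smooth_on_has_derivative[where S="{x. (x, t) \<in> Om \<times> {0<..<T}}"]) auto

lemma normal_dirder:
  assumes "x \<in> Om" "t \<in> {0<..<T}"
  shows "\<nu> (x, t) \<bullet> dirder v (\<lambda>x. f (x, t)) x = 0"
  using assms by (subst dirder_eq_sum_partial[OF has_derivative_slice[OF assms]])
    (simp add: inner_sum_right normal_orth)

lemma dirder_time:
  assumes "x \<in> Om" "t \<in> {0<..<T}"
  shows "dirder (0, 1) f (x, t) =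
    - (mean_curvature (\<lambda>x. f (x, t)) (\<nu> (x, t)) x - (c + B *v f (x, t)) \<bullet> \<nu> (x, t)) *\<^sub>R \<nu> (x, t)"
proof -
  have "((\<lambda>s. f ((x, t) + s *\<^sub>R (0, 1))) has_vector_derivative dirder (0, 1) f ((x, t) + 0 *\<^sub>R (0, 1))) (at 0)"
    using assms by (intro has_vector_derivative_line smooth_on_has_derivative[OF smooth_interior]) simp
  then have 1: "((\<lambda>s. f (x, t + s)) has_vector_derivative dirder (0, 1) f (x, t)) (at 0)"
    by simp
  have "t \<in> interior {0..T}" using assms by (simp add: interior_atLeastAtMost_real)
  then have "((\<lambda>s. f (x, s)) has_vector_derivative
      - (mean_curvature (\<lambda>x. f (x, t)) (\<nu> (x, t)) x - (c + B *v f (x, t)) \<bullet> \<nu> (x, t)) *\<^sub>R \<nu> (x, t)) (at (t + 0))"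
    using flow[of x t] assms at_within_interior[OF \<open>t \<in> interior {0..T}\<close>] by simp
  moreover have "((\<lambda>s. t + s) has_vector_derivative 1) (at 0)"
    by (auto intro!: derivative_eq_intros)
  ultimately have "((\<lambda>s. f (x, s)) \<circ> (\<lambda>s. t + s) has_vector_derivative 1 *\<^sub>R
      (- (mean_curvature (\<lambda>x. f (x, t)) (\<nu> (x, t)) x - (c + B *v f (x, t)) \<bullet> \<nu> (x, t)) *\<^sub>R \<nu> (x, t))) (at 0)"
    by (intro vector_diff_chain_at)
  then have "((\<lambda>s. f (x, t + s)) has_vector_derivative
      - (mean_curvature (\<lambda>x. f (x, t)) (\<nu> (x, t)) x - (c + B *v f (x, t)) \<bullet> \<nu> (x, t)) *\<^sub>R \<nu> (x, t)) (at 0)"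
    by (simp only: o_def scaleR_one)
  with 1 show ?thesis by (rule vector_derivative_unique_at)
qed

end

section \<open>Graph coordinates\<close>

text \<open>\<open>X (z, t)\<close> is the chart point lying over \<open>z\<close> at time
  \<open>t\<close>. It varies with time because points of the flow move along \<open>\<nu>\<close>,
  whereas points of the graph move along the fixed vector \<open>N\<close>. The assumption
  \<open>side\<close> decides between the two unit normals of the graph.\<close>

locale graph_chart = flow_chart Om T f \<nu> c B
  for Om :: "(real ^ 'n::finite) set" and T f \<nu> c B +
  fixes e :: "'n \<Rightarrow> real ^ ('n option)" and N :: "real ^ ('n option)"
    and V :: "((real ^ 'n) \<times> real) set" and u :: "(real ^ 'n) \<times> real \<Rightarrow> real"
    and X :: "(real ^ 'n) \<times> real \<Rightarrow> real ^ 'n"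
  assumes ee: "\<And>i j. e i \<bullet> e j = (if i = j then 1 else 0)" and eN: "\<And>i. e i \<bullet> N = 0"
    and NN: "N \<bullet> N = 1"
    and frame: "\<And>\<xi>. \<xi> = (\<Sum>i\<in>UNIV. (\<xi> \<bullet> e i) *\<^sub>R e i) + (\<xi> \<bullet> N) *\<^sub>R N"
    and V: "open V" "smooth_on V u" "smooth_on V X"
    and X: "\<And>z t. (z, t) \<in> V \<Longrightarrow> X (z, t) \<in> Om" "\<And>z t. (z, t) \<in> V \<Longrightarrow> t \<in> {0<..<T}"
    and graph: "\<And>z t. (z, t) \<in> V \<Longrightarrow> f (X (z, t), t) = (\<Sum>i\<in>UNIV. (z $ i) *\<^sub>R e i) + u (z, t) *\<^sub>R N"
    and side: "\<And>z t. (z, t) \<in> V \<Longrightarrow> \<nu> (X (z, t), t) \<bullet> N < 0"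

text \<open>The inverse function theorem is applied to the space-time map \<open>\<Phi>\<close> that
  sends a point to its components along \<open>e\<close> together with the time. Its differential at
  the base point is injective since tangent vectors there have no component along \<open>N\<close>
  and are determined by those along \<open>e\<close>.\<close>

lemma (in flow_chart) graph_chart_exists:
  assumes x0: "x0 \<in> Om" and t0: "t0 \<in> {0<..<T}"
  obtains e V u X z0 where "graph_chart Om T f \<nu> c B e (- \<nu> (x0, t0)) V u X"
    "(z0, t0) \<in> V" "X (z0, t0) = x0"
proof -
  define N where "N = - \<nu> (x0, t0)"
  define \<Omega> where "\<Omega> = Om \<times> {0<..<T}"
  have \<Omega>: "open \<Omega>" "smooth_on \<Omega> f" using smooth_interior by (simp_all add: \<Omega>_def)
  have P: "(x0, t0) \<in> \<Omega>" using assms by (simp add: \<Omega>_def)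
  have "norm N = 1" using assms by (simp add: N_def normal_unit)
  then have NN: "N \<bullet> N = 1" by (simp add: norm_eq_1)
  obtain e :: "'n \<Rightarrow> real ^ ('n option)"
    where e: "\<And>i j. e i \<bullet> e j = (if i = j then 1 else 0)" "\<And>i. e i \<bullet> N = 0"
    and frame: "\<And>\<xi>. \<xi> = (\<Sum>i\<in>UNIV. (\<xi> \<bullet> e i) *\<^sub>R e i) + (\<xi> \<bullet> N) *\<^sub>R N"
    by (rule orthonormal_frame[OF \<open>norm N = 1\<close>]) (rule that)
  define p where "p \<xi> = (\<chi> i. \<xi> \<bullet> e i)" for \<xi>
  have p: "bounded_linear p"
    unfolding p_def by (intro linear_conv_bounded_linear[THEN iffD1] linearI)
      (simp_all add: vec_eq_iff inner_add_left)
  define \<Phi> where "\<Phi> q = (p (f q), snd q)" for q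
  have \<Phi>: "smooth_on \<Omega> \<Phi>"
    unfolding \<Phi>_def
    by (rule smooth_on_Pair[OF \<Omega>(1) smooth_on_linear_compose[OF \<Omega>(1) p \<Omega>(2)]
          smooth_on_bounded_linear[OF \<Omega>(1) bounded_linear_snd]])
  have inj: "v = 0" if "dirder v \<Phi> (x0, t0) = 0" for v
  proof -
    have "(\<Phi> has_derivative (\<lambda>v. (p (dirder v f (x0, t0)), snd v))) (at (x0, t0))"
      unfolding \<Phi>_def
      by (intro has_derivative_Pair bounded_linear.has_derivative[OF p] smooth_on_has_derivative[OF \<Omega> P]
          bounded_linear_imp_has_derivative bounded_linear_snd)
    from dirder_eqI[OF this, of v] have 0: "snd v = 0" "p (dirder v f (x0, t0)) = 0"
      using that by (auto simp: zero_prod_def)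
    then have v: "v = (fst v, 0)" by (simp add: prod_eq_iff)
    define \<xi> where "\<xi> = dirder v f (x0, t0)"
    have \<xi>: "\<xi> = dirder (fst v) (\<lambda>x. f (x, t0)) x0"
      unfolding \<xi>_def by (subst v) (rule dirder_space[OF assms])
    have "\<xi> \<bullet> N = 0" unfolding \<xi> using normal_dirder[OF assms] by (simp add: N_def inner_commute)
    moreover have "\<xi> \<bullet> e i = 0" for i using 0(2) by (simp add: p_def vec_eq_iff \<xi>_def)
    ultimately have "\<xi> = 0" using frame[of \<xi>] by simp
    moreover have "inj (\<lambda>v. dirder v (\<lambda>x. f (x, t0)) x0)" using assms by (intro immersed) auto
    ultimately have "fst v = 0"
      using linear_injective_0[OF has_derivative_linear[OF has_derivative_slice[OF assms]]] \<xi> by simp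
    then show ?thesis using v by (simp add: zero_prod_def)
  qed
  obtain U' V' g where *: "open U'" "U' \<subseteq> \<Omega>" "(x0, t0) \<in> U'" "open V'" "\<Phi> (x0, t0) \<in> V'"
      "homeomorphism U' V' \<Phi> g" "smooth_on V' g"
    by (rule smooth_inverse_function[OF \<Omega>(1) \<Phi> P inj])
  have gV: "g q \<in> U'" "\<Phi> (g q) = q" if "q \<in> V'" for q
    using that *(6) by (auto simp: homeomorphism_def)
  have gP: "g (\<Phi> (x0, t0)) = (x0, t0)" using *(3,6) by (auto simp: homeomorphism_def)
  \<comment> \<open>At the base point this inner product is -1, so by continuity of the normal the
    condition cuts out an open neighbourhood of it.\<close>
  define V where "V = {q \<in> V'. \<nu> (g q) \<bullet> N < 0}"
  define X where "X q = fst (g q)" for q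
  define u where "u q = f (g q) \<bullet> N" for q
  have sub: "V \<subseteq> V'" by (auto simp: V_def)
  have "continuous_on V' (\<lambda>q. \<nu> (g q))"
  proof (rule continuous_on_compose2[OF continuous_normal smooth_on_continuous_on[OF *(7)]])
    have "\<Omega> \<subseteq> Om \<times> {0..T}" by (auto simp: \<Omega>_def)
    then show "g ` V' \<subseteq> Om \<times> {0..T}" using gV(1) *(2) by blast
  qed
  then have "continuous_on V' (\<lambda>q. \<nu> (g q) \<bullet> N)" by (intro continuous_intros)
  from continuous_open_preimage[OF this *(4), of "{..<0}"]
  have "open (V' \<inter> (\<lambda>q. \<nu> (g q) \<bullet> N) -` {..<0})" by simp
  moreover have "V = V' \<inter> (\<lambda>q. \<nu> (g q) \<bullet> N) -` {..<0}" by (auto simp: V_def)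
  ultimately have openV: "open V" by metis
  have smg: "smooth_on V g" by (rule smooth_on_open_subset[OF *(7) sub openV])
  have gX: "g (z, t) = (X (z, t), t)" if "(z, t) \<in> V" for z t
    using gV(2)[of "(z, t)"] that sub by (auto simp: X_def \<Phi>_def prod_eq_iff)
  have "graph_chart Om T f \<nu> c B e N V u X"
  proof
    show "smooth_on V u"
      unfolding u_def
    proof (rule smooth_on_linear_compose[OF openV bounded_linear_inner_left])
      show "smooth_on V (\<lambda>q. f (g q))"
        by (rule smooth_on_compose[OF openV \<Omega>(1) smg \<Omega>(2)]) (use gV(1) *(2) sub in blast)
    qed
    show "smooth_on V X"
      unfolding X_def by (rule smooth_on_linear_compose[OF openV bounded_linear_fst smg])
    fix z t assume zt: "(z, t) \<in> V"
    have "(X (z, t), t) \<in> \<Omega>" using gV(1)[of "(z, t)"] zt sub *(2) gX[OF zt] by auto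
    then show "X (z, t) \<in> Om" "t \<in> {0<..<T}" by (auto simp: \<Omega>_def)
    have "p (f (g (z, t))) = z" using gV(2)[of "(z, t)"] zt sub by (auto simp: \<Phi>_def)
    then have "f (g (z, t)) \<bullet> e i = z $ i" for i by (simp add: p_def vec_eq_iff)
    then show "f (X (z, t), t) = (\<Sum>i\<in>UNIV. (z $ i) *\<^sub>R e i) + u (z, t) *\<^sub>R N"
      using frame[of "f (g (z, t))"] by (simp add: u_def gX[OF zt])
    show "\<nu> (X (z, t), t) \<bullet> N < 0" using zt gX[OF zt] by (simp add: V_def)
  qed (fact e frame NN openV)+
  moreover have "\<Phi> (x0, t0) \<in> V"
    using *(5) gP NN by (simp add: V_def) (simp add: N_def)
  then have "(p (f (x0, t0)), t0) \<in> V" by (simp add: \<Phi>_def)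
  moreover have "X (p (f (x0, t0)), t0) = x0"
    using gP by (simp add: X_def \<Phi>_def)
  ultimately show ?thesis using that unfolding N_def by blast
qed

context graph_chart
begin

abbreviation "D i \<equiv> dirder (axis i 1 :: real ^ 'n, 0 :: real)"

definition \<Gamma> :: "real \<Rightarrow> real ^ 'n \<Rightarrow> real ^ ('n option)" where
  "\<Gamma> t z = (\<Sum>i\<in>UNIV. (z $ i) *\<^sub>R e i) + u (z, t) *\<^sub>R N"

lemma slice_V:
  "open {z. (z, t) \<in> V}" "smooth_on {z. (z, t) \<in> V} (\<lambda>z. u (z, t))"
  "smooth_on {z. (z, t) \<in> V} (\<lambda>z. X (z, t))"
  using smooth_on_slice[OF V(1,2)] smooth_on_slice[OF V(1,3)] by auto

lemma partial_slice:
  fixes h :: "(real ^ 'n) \<times> real \<Rightarrow> real"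
  assumes "smooth_on V h" "(z, t) \<in> V"
  shows "((\<lambda>z. h (z, t)) has_derivative (\<lambda>v. dirder (v, 0) h (z, t))) (at z)"
proof -
  have "((\<lambda>z. h (z, t)) has_derivative (\<lambda>v. dirder v (\<lambda>z. h (z, t)) z)) (at z)"
    using smooth_on_slice[OF V(1) assms(1), of t] assms(2)
    by (intro smooth_on_has_derivative[where S="{z. (z, t) \<in> V}"]) auto
  then show ?thesis by (simp add: dirder_slice[OF V(1) assms])
qed

lemma partial_\<Gamma>:
  assumes "(z, t) \<in> V"
  shows "partial i (\<Gamma> t) z = e i + D i u (z, t) *\<^sub>R N"
proof -
  have "(\<Gamma> t has_derivative (\<lambda>v. (\<Sum>i\<in>UNIV. (v $ i) *\<^sub>R e i) + dirder (v, 0) u (z, t) *\<^sub>R N)) (at z)"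
    unfolding \<Gamma>_def
    by (intro has_derivative_add has_derivative_sum has_derivative_scaleR_left partial_slice[OF V(2) assms]
        bounded_linear_imp_has_derivative[OF bounded_linear_vec_nth])
  then show ?thesis
    unfolding partial_eq_dirder by (simp add: dirder_eqI axis_def if_distrib[where f="\<lambda>x. x *\<^sub>R _"] cong: if_cong)
qed

lemma partial2_\<Gamma>:
  assumes "(z, t) \<in> V"
  shows "partial i (partial j (\<Gamma> t)) z = D i (D j u) (z, t) *\<^sub>R N"
proof -
  have "((\<lambda>z. e j + D j u (z, t) *\<^sub>R N) has_derivative (\<lambda>v. 0 + dirder (v, 0) (D j u) (z, t) *\<^sub>R N)) (at z)"
    by (intro has_derivative_add has_derivative_const has_derivative_scaleR_left
        partial_slice[OF smooth_on_dirder[OF V(1,2)] assms])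
  then have "dirder (axis i 1) (\<lambda>z. e j + D j u (z, t) *\<^sub>R N) z = D i (D j u) (z, t) *\<^sub>R N"
    by (subst dirder_eqI) auto
  moreover have "dirder (axis i 1) (partial j (\<Gamma> t)) z = dirder (axis i 1) (\<lambda>z. e j + D j u (z, t) *\<^sub>R N) z"
    using assms by (intro dirder_cong[OF slice_V(1)[of t]]) (simp_all add: partial_\<Gamma>)
  ultimately show ?thesis by (simp add: partial_eq_dirder[of i])
qed

definition jac :: "(real ^ 'n) \<times> real \<Rightarrow> real ^ 'n ^ 'n" where
  "jac = (\<lambda>(z, t). \<chi> a i. partial i (\<lambda>z. X (z, t)) z $ a)"

lemma reparam:
  assumes zt: "(z, t) \<in> V"
  defines "n \<equiv> \<nu> (X (z, t), t)"
  shows "partial i (\<Gamma> t) z = (\<Sum>a\<in>UNIV. (jac (z, t) $ a $ i) *\<^sub>R partial a (\<lambda>x. f (x, t)) (X (z, t)))"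
    and "n \<bullet> partial i (\<Gamma> t) z = 0"
    and "metric (\<Gamma> t) z = transpose (jac (z, t)) ** chart_metric (X (z, t), t) ** jac (z, t)"
    and "second_ff (\<Gamma> t) n z = transpose (jac (z, t)) ** chart_second_ff (X (z, t), t) ** jac (z, t)"
    and "invertible (jac (z, t))"
    and "mean_curvature (\<Gamma> t) n z = mean_curvature (\<lambda>x. f (x, t)) n (X (z, t))"
proof -
  have t: "t \<in> {0<..<T}" using X(2)[OF zt] .
  then have t': "t \<in> {0..T}" by simp
  have sl: "open {x. (x, t) \<in> Om \<times> {0<..<T}}" "smooth_on {x. (x, t) \<in> Om \<times> {0<..<T}} (\<lambda>x. f (x, t))"
    using smooth_on_slice[OF smooth_interior] by auto
  have Om: "{x. (x, t) \<in> Om \<times> {0<..<T}} = Om" using t by auto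
  note chart = slice_V(1)[of t] slice_V(3)[of t] sl[unfolded Om]
  have sub: "(\<lambda>z. X (z, t)) ` {z. (z, t) \<in> V} \<subseteq> Om" using X(1) by auto
  have f: "\<Gamma> t z = f (X (z, t), t)" if "z \<in> {z. (z, t) \<in> V}" for z
    using graph[of z t] that by (simp add: \<Gamma>_def)
  have z: "z \<in> {z. (z, t) \<in> V}" using zt by simp
  have n: "n \<bullet> partial a (\<lambda>x. f (x, t)) (X (z, t)) = 0" for a
    unfolding n_def using X[OF zt] by (intro normal_orth) auto
  show 1: "partial i (\<Gamma> t) z = (\<Sum>a\<in>UNIV. (jac (z, t) $ a $ i) *\<^sub>R partial a (\<lambda>x. f (x, t)) (X (z, t)))" for i
    using reparam_partial[OF chart(1-4) sub f z] by (simp add: jac_def)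
  show "n \<bullet> partial i (\<Gamma> t) z = 0" by (simp add: 1 inner_sum_right n)
  show "metric (\<Gamma> t) z = transpose (jac (z, t)) ** chart_metric (X (z, t), t) ** jac (z, t)"
    using reparam_metric[OF chart(1-4) sub f z] by (simp add: jac_def chart_metric_def)
  show "second_ff (\<Gamma> t) n z = transpose (jac (z, t)) ** chart_second_ff (X (z, t), t) ** jac (z, t)"
    using reparam_second_ff[OF chart(1-4) sub f z n] by (simp add: jac_def chart_second_ff_def n_def)
  \<comment> \<open>The Jacobian carries \<open>v\<close> to the chart coordinates of the tangent
    vector with graph coordinates \<open>v\<close>. If these vanish, so does the tangent vector, and
    its component along \<open>e j\<close> is \<open>v $ j\<close>.\<close>
  have "v = 0" if v: "jac (z, t) *v v = 0" for v
  proof -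
    have "(\<Sum>i\<in>UNIV. (v $ i) *\<^sub>R partial i (\<Gamma> t) z) =
        (\<Sum>a\<in>UNIV. ((jac (z, t) *v v) $ a) *\<^sub>R partial a (\<lambda>x. f (x, t)) (X (z, t)))"
      by (simp add: 1 matrix_vector_mult_def scaleR_sum_right scaleR_sum_left mult.commute)
        (rule sum.swap)
    then have "(\<Sum>i\<in>UNIV. (v $ i) *\<^sub>R partial i (\<Gamma> t) z) \<bullet> e j = 0" for j by (simp add: v)
    then have "v $ j = 0" for j
      by (simp add: partial_\<Gamma>[OF zt] inner_sum_left inner_add_left ee eN inner_commute[of N]
          if_distrib[where f="\<lambda>x. _ * x"] cong: if_cong)
    then show "v = 0" by (simp add: vec_eq_iff)
  qed
  then have "inj ((*v) (jac (z, t)))"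
    using linear_injective_0[OF matrix_vector_mul_linear] by blast
  then show J: "invertible (jac (z, t))"
    using matrix_left_invertible_injective invertible_left_inverse by blast
  have "invertible (metric (\<lambda>x. f (x, t)) (X (z, t)))"
    by (rule invertible_metric[OF has_derivative_slice[OF X[OF zt]] immersed[OF X(1)[OF zt] t']])
  then show "mean_curvature (\<Gamma> t) n z = mean_curvature (\<lambda>x. f (x, t)) n (X (z, t))"
    using reparam_mean_curvature[OF chart(1-4) sub f z n] J by (simp add: jac_def)
qed

end

section \<open>Normal, curvature and evolution equation of a graph\<close>

context graph_chart
begin

text \<open>This is the reciprocal of the area factor \<open>W\<close>. Defining it through the
  given normal makes its sign available directly from \<open>side\<close>.\<close>

definition \<sigma> :: "(real ^ 'n) \<times> real \<Rightarrow> real" where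
  "\<sigma> = (\<lambda>(z, t). - (\<nu> (X (z, t), t) \<bullet> N))"

text \<open>Orthogonality to \<open>e i + D i u (z, t) *\<^sub>R N\<close> determines the tangential
  components of the normal from its component along \<open>N\<close>; unit length then determines
  the latter up to sign.\<close>

lemma normal_graph:
  assumes zt: "(z, t) \<in> V"
  shows "\<sigma> (z, t) > 0"
    and "\<nu> (X (z, t), t) = \<sigma> (z, t) *\<^sub>R ((\<Sum>i\<in>UNIV. D i u (z, t) *\<^sub>R e i) - N)"
    and "(\<sigma> (z, t))\<^sup>2 * (1 + (\<Sum>i\<in>UNIV. D i u (z, t) * D i u (z, t))) = 1"
proof -
  define n where "n = \<nu> (X (z, t), t)"
  show "\<sigma> (z, t) > 0" using side[OF zt] by (simp add: \<sigma>_def)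
  have nN: "n \<bullet> N = - \<sigma> (z, t)" by (simp add: \<sigma>_def n_def)
  have ne: "n \<bullet> e i = \<sigma> (z, t) * D i u (z, t)" for i
    using reparam(2)[OF zt, of i] nN by (simp add: partial_\<Gamma>[OF zt] inner_add_right n_def)
  show n: "\<nu> (X (z, t), t) = \<sigma> (z, t) *\<^sub>R ((\<Sum>i\<in>UNIV. D i u (z, t) *\<^sub>R e i) - N)"
    using frame[of n] unfolding ne nN by (simp add: n_def scaleR_diff_right scaleR_sum_right)
  have "n \<bullet> n = 1" using normal_unit[of "X (z, t)" t] X[OF zt] by (simp add: n_def norm_eq_1)
  moreover have "n \<bullet> n = \<sigma> (z, t) *\<^sub>R ((\<Sum>i\<in>UNIV. D i u (z, t) *\<^sub>R e i) - N) \<bullet> n"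
    by (subst (1) n_def, subst n) (rule refl)
  ultimately have "\<sigma> (z, t) * ((\<Sum>i\<in>UNIV. D i u (z, t) * (\<sigma> (z, t) * D i u (z, t))) + \<sigma> (z, t)) = 1"
    using ne nN by (simp add: inner_diff_left inner_sum_left inner_commute[of "e _" n] inner_commute[of N n])
  then show "(\<sigma> (z, t))\<^sup>2 * (1 + (\<Sum>i\<in>UNIV. D i u (z, t) * D i u (z, t))) = 1"
    by (simp add: power2_eq_square algebra_simps sum_distrib_left)
qed

lemma metric_\<Gamma>:
  assumes "(z, t) \<in> V"
  shows "metric (\<Gamma> t) z $ i $ j = (if i = j then 1 else 0) + D i u (z, t) * D j u (z, t)"
proof -
  have "N \<bullet> e i = 0" for i by (simp add: inner_commute[of N "e i"] eN)
  then show ?thesis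
    by (simp add: metric_def partial_\<Gamma>[OF assms] inner_add_left inner_add_right ee eN NN)
qed

lemma second_ff_\<Gamma>:
  assumes "(z, t) \<in> V"
  shows "second_ff (\<Gamma> t) (\<nu> (X (z, t), t)) z $ i $ j = \<sigma> (z, t) * D i (D j u) (z, t)"
  by (simp add: second_ff_normal[OF reparam(2)[OF assms]] partial2_\<Gamma>[OF assms] \<sigma>_def)

lemma mean_curvature_\<Gamma>:
  assumes zt: "(z, t) \<in> V"
  shows "mean_curvature (\<Gamma> t) (\<nu> (X (z, t), t)) z = \<sigma> (z, t) * ((\<Sum>i\<in>UNIV. D i (D i u) (z, t))
    - (\<sigma> (z, t))\<^sup>2 * (\<Sum>i\<in>UNIV. \<Sum>j\<in>UNIV. D i u (z, t) * D j u (z, t) * D i (D j u) (z, t)))"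
proof -
  define p where "p i = D i u (z, t)" for i
  define s where "s = \<sigma> (z, t)"
  have s: "s\<^sup>2 * (1 + (\<Sum>i\<in>UNIV. p i * p i)) = 1" using normal_graph(3)[OF zt] by (simp add: s_def p_def)
  \<comment> \<open>The Sherman-Morrison inverse of the identity plus the rank-one matrix with
    entries \<open>p i * p j\<close>; \<open>s\<close> makes the correction factor
    \<open>s\<^sup>2\<close> equal to the reciprocal of one plus the squared length of
    \<open>p\<close>.\<close>
  define G where "G = (\<chi> i j. (if i = j then 1 else 0) - s\<^sup>2 * p i * p j)"
  have "(\<Sum>k\<in>UNIV. ((if i = k then 1 else 0) - s\<^sup>2 * p i * p k) * ((if k = j then 1 else 0) + p k * p j))
      = (if i = j then 1 else 0)" for i j
  proof -
    have "((if i = k then 1 else 0) - s\<^sup>2 * p i * p k) * ((if k = j then 1 else 0) + p k * p j) =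
      (if i = k then (if i = j then 1 else 0) + p i * p j else 0)
       - (if k = j then s\<^sup>2 * p i * p j else 0) - s\<^sup>2 * p i * p j * (p k * p k)" for k
      by (auto simp: algebra_simps)
    then have "(\<Sum>k\<in>UNIV. ((if i = k then 1 else 0) - s\<^sup>2 * p i * p k) * ((if k = j then 1 else 0) + p k * p j))
      = (if i = j then 1 else 0) + p i * p j - s\<^sup>2 * p i * p j - s\<^sup>2 * p i * p j * (\<Sum>k\<in>UNIV. p k * p k)"
      by (simp add: sum_subtractf sum_distrib_left del: if_split)
    also have "\<dots> = (if i = j then 1 else 0) + p i * p j * (1 - s\<^sup>2 * (1 + (\<Sum>k\<in>UNIV. p k * p k)))"
      by (simp add: algebra_simps)
    finally show ?thesis by (simp add: s)
  qed
  then have "G ** metric (\<Gamma> t) z = mat 1"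
    by (simp add: vec_eq_iff matrix_matrix_mult_def G_def metric_\<Gamma>[OF zt] mat_def p_def)
  then have "matrix_inv (metric (\<Gamma> t) z) = G" by (rule matrix_inv_eqI)
  then have "mean_curvature (\<Gamma> t) (\<nu> (X (z, t), t)) z =
      (\<Sum>i\<in>UNIV. \<Sum>j\<in>UNIV. ((if i = j then 1 else 0) - s\<^sup>2 * p i * p j) * (s * D i (D j u) (z, t)))"
    by (simp add: mean_curvature_def second_ff_\<Gamma>[OF zt] G_def s_def)
  also have "\<dots> = (\<Sum>i\<in>UNIV. \<Sum>j\<in>UNIV. (if i = j then s * D i (D j u) (z, t) else 0)
      - s * (s\<^sup>2 * (p i * p j * D i (D j u) (z, t))))"
    by (intro sum.cong refl) (auto simp: algebra_simps)
  also have "\<dots> = s * ((\<Sum>i\<in>UNIV. D i (D i u) (z, t))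
      - s\<^sup>2 * (\<Sum>i\<in>UNIV. \<Sum>j\<in>UNIV. p i * p j * D i (D j u) (z, t)))"
    by (simp add: sum_subtractf right_diff_distrib flip: sum_distrib_left)
  finally show ?thesis by (simp add: s_def p_def)
qed

text \<open>Differentiating the graph identity in time at fixed \<open>z\<close> produces the flow
  velocity plus the tangential drift of \<open>X\<close>. The inner product with the normal removes
  the drift.\<close>

lemma time_derivative_\<Gamma>:
  assumes zt: "(z, t) \<in> V"
  shows "\<sigma> (z, t) * dirder (0, 1) u (z, t) =
    mean_curvature (\<Gamma> t) (\<nu> (X (z, t), t)) z - (c + B *v \<Gamma> t z) \<bullet> \<nu> (X (z, t), t)"
proof -
  define n where "n = \<nu> (X (z, t), t)"
  define x where "x = X (z, t)"
  note xt = X[OF zt]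
  have f: "f (x, t) = \<Gamma> t z" using graph[OF zt] by (simp add: \<Gamma>_def x_def)
  have P: "(x, t) \<in> Om \<times> {0<..<T}" using xt by (simp add: x_def)
  define \<xi> where "\<xi> = dirder (0, 1) X (z, t)"
  have "((\<lambda>q. (X q, snd q)) has_derivative (\<lambda>v. (dirder v X (z, t), snd v))) (at (z, t))"
    by (intro has_derivative_Pair smooth_on_has_derivative[OF V(1,3) zt]
        bounded_linear_imp_has_derivative bounded_linear_snd)
  from diff_chain_at[OF this, of f "\<lambda>v. dirder v f (x, t)"]
  have "((\<lambda>q. f (X q, snd q)) has_derivative (\<lambda>v. dirder (dirder v X (z, t), snd v) f (x, t))) (at (z, t))"
    using smooth_on_has_derivative[OF smooth_interior P] by (simp add: o_def x_def)
  from dirder_eqI[OF this]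
  have 1: "dirder (0, 1) (\<lambda>q. f (X q, snd q)) (z, t) = dirder (\<xi>, 1) f (x, t)"
    by (simp add: \<xi>_def)
  have "((\<lambda>q. (\<Sum>i\<in>UNIV. (fst q $ i) *\<^sub>R e i) + u q *\<^sub>R N) has_derivative
      (\<lambda>v. (\<Sum>i\<in>UNIV. (fst v $ i) *\<^sub>R e i) + dirder v u (z, t) *\<^sub>R N)) (at (z, t))"
    by (intro has_derivative_add has_derivative_sum has_derivative_scaleR_left
        smooth_on_has_derivative[OF V(1,2) zt] bounded_linear_imp_has_derivative
        bounded_linear_compose[OF bounded_linear_vec_nth bounded_linear_fst, unfolded o_def])
  from dirder_eqI[OF this]
  have 2: "dirder (0, 1) (\<lambda>q. (\<Sum>i\<in>UNIV. (fst q $ i) *\<^sub>R e i) + u q *\<^sub>R N) (z, t)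
      = dirder (0, 1) u (z, t) *\<^sub>R N"
    by simp
  have "dirder (0, 1) (\<lambda>q. f (X q, snd q)) (z, t)
      = dirder (0, 1) (\<lambda>q. (\<Sum>i\<in>UNIV. (fst q $ i) *\<^sub>R e i) + u q *\<^sub>R N) (z, t)"
    by (intro dirder_cong[OF V(1) zt]) (auto simp: graph)
  then have "dirder (\<xi>, 1) f (x, t) = dirder (0, 1) u (z, t) *\<^sub>R N" using 1 2 by simp
  moreover have "dirder (\<xi>, 1) f (x, t) = dirder (\<xi>, 0) f (x, t) + dirder (0, 1) f (x, t)"
    using linear_add[OF has_derivative_linear[OF smooth_on_has_derivative[OF smooth_interior P]],
        of "(\<xi>, 0)" "(0, 1)"] by simp
  moreover have "n \<bullet> dirder (\<xi>, 0) f (x, t) = 0"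
    using normal_dirder[OF xt] dirder_space[OF xt] by (simp add: n_def x_def)
  moreover have "n \<bullet> dirder (0, 1) f (x, t) = - (mean_curvature (\<Gamma> t) n z - (c + B *v \<Gamma> t z) \<bullet> n)"
    using dirder_time[OF xt] normal_unit[OF xt(1), of t] xt(2) reparam(6)[OF zt] f
    by (simp add: n_def x_def norm_eq_1)
  ultimately have "n \<bullet> (dirder (0, 1) u (z, t) *\<^sub>R N) = - (mean_curvature (\<Gamma> t) n z - (c + B *v \<Gamma> t z) \<bullet> n)"
    by (metis add_0 inner_add_right)
  then show ?thesis by (simp add: \<sigma>_def n_def algebra_simps)
qed

text \<open>Separates the constant part, the part linear in \<open>z\<close> and the part linear in
  \<open>u\<close>, which is the shape of the drift coefficients in
  \<open>local_maximum_principle\<close>.\<close>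

lemma affine_\<Gamma>:
  "(c + B *v \<Gamma> t z) \<bullet> \<xi> = c \<bullet> \<xi> + (\<chi> k. (B *v e k) \<bullet> \<xi>) \<bullet> z + ((B *v N) \<bullet> \<xi>) * u (z, t)"
  by (simp add: \<Gamma>_def matrix_vector_right_distrib linear_sum[OF matrix_vector_mul_linear]
      matrix_vector_mult_scaleR inner_add_left inner_sum_left inner_vec_def[of _ z] mult.commute)

lemma graph_equation:
  assumes p: "p \<in> V"
  shows "dirder (0, 1) u p = (\<Sum>i\<in>UNIV. D i (D i u) p)
      - (\<Sum>i\<in>UNIV. \<Sum>j\<in>UNIV. D i u p * D j u p * D i (D j u) p) * inverse (1 + (\<Sum>i\<in>UNIV. D i u p * D i u p))
      - (\<Sum>i\<in>UNIV. (c \<bullet> e i + (\<chi> k. (B *v e k) \<bullet> e i) \<bullet> fst p + ((B *v N) \<bullet> e i) * u p) * D i u p)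
      + (c \<bullet> N + (\<chi> k. (B *v e k) \<bullet> N) \<bullet> fst p + ((B *v N) \<bullet> N) * u p)"
proof -
  obtain z t where zt: "p = (z, t)" "(z, t) \<in> V" using p by (cases p) auto
  define s where "s = \<sigma> (z, t)"
  have s: "s > 0" "s\<^sup>2 * (1 + (\<Sum>i\<in>UNIV. D i u p * D i u p)) = 1"
    using normal_graph[OF zt(2)] by (simp_all add: s_def zt(1))
  then have "(1 + (\<Sum>i\<in>UNIV. D i u p * D i u p)) * s\<^sup>2 = 1" by (simp only: mult.commute)
  from inverse_unique[OF this]
  have s2: "s\<^sup>2 = inverse (1 + (\<Sum>i\<in>UNIV. D i u p * D i u p))" by (rule sym)
  have "s * dirder (0, 1) u p = s * ((\<Sum>i\<in>UNIV. D i (D i u) p)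
      - s\<^sup>2 * (\<Sum>i\<in>UNIV. \<Sum>j\<in>UNIV. D i u p * D j u p * D i (D j u) p)
      - ((\<Sum>i\<in>UNIV. D i u p * ((c + B *v \<Gamma> t z) \<bullet> e i)) - (c + B *v \<Gamma> t z) \<bullet> N))"
    using time_derivative_\<Gamma>[OF zt(2)] unfolding mean_curvature_\<Gamma>[OF zt(2)]
    by (subst (asm) normal_graph(2)[OF zt(2)])
      (simp add: s_def zt(1) inner_diff_right inner_sum_right algebra_simps)
  then have "dirder (0, 1) u p = (\<Sum>i\<in>UNIV. D i (D i u) p)
      - s\<^sup>2 * (\<Sum>i\<in>UNIV. \<Sum>j\<in>UNIV. D i u p * D j u p * D i (D j u) p)
      - ((\<Sum>i\<in>UNIV. D i u p * ((c + B *v \<Gamma> t z) \<bullet> e i)) - (c + B *v \<Gamma> t z) \<bullet> N)"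
    using s(1) by simp
  then show ?thesis unfolding affine_\<Gamma> s2 by (simp add: zt(1) mult.commute)
qed

end

section \<open>Null vectors of the perturbed form in graph coordinates\<close>

context graph_chart
begin

lemma dirder_sum:
  assumes p: "p \<in> V"
  shows "dirder (v, 0) u p = (\<Sum>i\<in>UNIV. v $ i * D i u p)"
    and "D i (dirder (v, 0) u) p = (\<Sum>j\<in>UNIV. v $ j * D i (D j u) p)"
    and "dirder (v, 0) (dirder (v, 0) u) p = (\<Sum>i\<in>UNIV. \<Sum>j\<in>UNIV. v $ i * v $ j * D i (D j u) p)"
proof -
  show "dirder (v, 0) u p = (\<Sum>i\<in>UNIV. v $ i * D i u p)"
    by (rule dirder_eq_sum_axis[OF V(1,2) p])
  show 1: "D i (dirder (v, 0) u) p = (\<Sum>j\<in>UNIV. v $ j * D i (D j u) p)" for i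
  proof -
    have "D i (dirder (v, 0) u) p = dirder (v, 0) (D i u) p"
      by (rule smooth_dirder_commute[OF V(1,2) p])
    also have "\<dots> = (\<Sum>j\<in>UNIV. v $ j * D j (D i u) p)"
      by (rule dirder_eq_sum_axis[OF V(1) smooth_on_dirder[OF V(1,2)] p])
    also have "\<dots> = (\<Sum>j\<in>UNIV. v $ j * D i (D j u) p)"
      by (intro sum.cong refl arg_cong2[where f="(*)"] smooth_dirder_commute[OF V(1,2) p])
    finally show ?thesis .
  qed
  have "dirder (v, 0) (dirder (v, 0) u) p = (\<Sum>i\<in>UNIV. v $ i * D i (dirder (v, 0) u) p)"
    by (rule dirder_eq_sum_axis[OF V(1) smooth_on_dirder[OF V(1,2)] p])
  then show "dirder (v, 0) (dirder (v, 0) u) p = (\<Sum>i\<in>UNIV. \<Sum>j\<in>UNIV. v $ i * v $ j * D i (D j u) p)"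
    by (simp only: 1) (simp add: sum_distrib_left mult.assoc)
qed

lemma quadratic_forms_\<Gamma>:
  assumes zt: "(z, t) \<in> V"
  defines "w \<equiv> \<lambda>v. jac (z, t) *v v"
  shows "w v \<bullet> (chart_second_ff (X (z, t), t) *v w v) = \<sigma> (z, t) * dirder (v, 0) (dirder (v, 0) u) (z, t)"
    and "w v \<bullet> (chart_metric (X (z, t), t) *v w v) = v \<bullet> v + dirder (v, 0) u (z, t) * dirder (v, 0) u (z, t)"
proof -
  have "w v \<bullet> (chart_second_ff (X (z, t), t) *v w v) = v \<bullet> (second_ff (\<Gamma> t) (\<nu> (X (z, t), t)) z *v v)"
    by (simp only: w_def reparam(4)[OF zt] quadratic_form_congruence)
  then show "w v \<bullet> (chart_second_ff (X (z, t), t) *v w v) = \<sigma> (z, t) * dirder (v, 0) (dirder (v, 0) u) (z, t)"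
    by (simp only: dirder_sum(3)[OF zt, where v=v] inner_matrix_sum second_ff_\<Gamma>[OF zt])
      (simp add: sum_distrib_left mult_ac)
  have "w v \<bullet> (chart_metric (X (z, t), t) *v w v) = v \<bullet> (metric (\<Gamma> t) z *v v)"
    by (simp only: w_def reparam(3)[OF zt] quadratic_form_congruence)
  also have "\<dots> = (\<Sum>i\<in>UNIV. \<Sum>j\<in>UNIV. (if i = j then v $ i * v $ j else 0)
      + (v $ i * D i u (z, t)) * (v $ j * D j u (z, t)))"
    unfolding inner_matrix_sum metric_\<Gamma>[OF zt] by (intro sum.cong refl) (simp add: algebra_simps)
  also have "\<dots> = v \<bullet> v + dirder (v, 0) u (z, t) * dirder (v, 0) u (z, t)"
    by (simp only: dirder_sum(1)[OF zt, where v=v] sum.distrib sum_product inner_vec_def) simp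
  finally show "w v \<bullet> (chart_metric (X (z, t), t) *v w v) = v \<bullet> v + dirder (v, 0) u (z, t) * dirder (v, 0) u (z, t)" .
qed

text \<open>Brings the geometric situation into the form required by
  \<open>local_maximum_principle\<close>. In the constant, the first summand bounds the sum of the
  squares of all second derivatives of \<open>u\<close>, each at most \<open>3 * C\<close> in
  absolute value. Of the \<open>3 * \<beta>\<close>, one \<open>\<beta>\<close> comes from
  \<open>N\<close> and two from the tangential direction of the null vector.\<close>

lemma null_vector_estimate_graph:
  assumes P: "(z0, t0) \<in> V" "N = - \<nu> (X (z0, t0), t0)" and \<epsilon>: "\<epsilon> > 0"
    and nonneg: "\<And>x t w. x \<in> Om \<Longrightarrow> t \<in> {0..t0} \<Longrightarrow>
      w \<bullet> (chart_second_ff (x, t) *v w) + \<epsilon> * exp (K * t) * (w \<bullet> (chart_metric (x, t) *v w)) \<ge> 0"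
    and w0: "w0 \<noteq> 0" "w0 \<bullet> (chart_second_ff (X (z0, t0), t0) *v w0)
      + \<epsilon> * exp (K * t0) * (w0 \<bullet> (chart_metric (X (z0, t0), t0) *v w0)) = 0"
    and C: "\<And>w. \<bar>w \<bullet> (chart_second_ff (X (z0, t0), t0) *v w)\<bar> \<le> C * (w \<bullet> (chart_metric (X (z0, t0), t0) *v w))"
    and \<beta>: "\<And>\<xi>. \<bar>\<xi> \<bullet> (B *v \<xi>)\<bar> \<le> \<beta> * (\<xi> \<bullet> \<xi>)"
  shows "K \<le> 9 * C\<^sup>2 * (real CARD('n))\<^sup>2 + 3 * \<beta>"
proof -
  define \<eta> where "\<eta> = \<epsilon> * exp (K * t0)"
  define J where "J = jac (z0, t0)"
  \<comment> \<open>Since \<open>N\<close> is minus the normal at the base point, the graph is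
    horizontal there: \<open>\<sigma>\<close> is 1, and the unit length identity forces all
    \<open>D i u\<close> to vanish.\<close>
  have "\<nu> (X (z0, t0), t0) = - N" using P(2) by simp
  then have \<sigma>1: "\<sigma> (z0, t0) = 1" by (simp add: \<sigma>_def NN)
  have "(\<Sum>i\<in>UNIV. D i u (z0, t0) * D i u (z0, t0)) = 0"
    using normal_graph(3)[OF P(1)] by (simp add: \<sigma>1)
  then have crit: "D i u (z0, t0) = 0" for i
    by (subst (asm) sum_nonneg_eq_0_iff) auto
  define u2 where "u2 v = dirder (v, 0) (dirder (v, 0) u) (z0, t0)" for v
  have q: "(J *v v) \<bullet> (chart_second_ff (X (z0, t0), t0) *v (J *v v)) = u2 v"
    "(J *v v) \<bullet> (chart_metric (X (z0, t0), t0) *v (J *v v)) = v \<bullet> v" for v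
    using quadratic_forms_\<Gamma>[OF P(1), of v]
    by (simp_all add: J_def \<sigma>1 u2_def) (simp add: dirder_sum(1)[OF P(1), where v=v] crit)
  \<comment> \<open>The perturbed form at the base point in graph coordinates, where the metric is
    Euclidean and the second fundamental form is the Hessian of \<open>u\<close>.\<close>
  define A where "A = (\<chi> i j. D i (D j u) (z0, t0) + (if i = j then \<eta> else 0))"
  have A: "v \<bullet> (A *v v) = u2 v + \<eta> * (v \<bullet> v)" for v
  proof -
    have "v \<bullet> (A *v v) = (\<Sum>i\<in>UNIV. \<Sum>j\<in>UNIV. v $ i * v $ j * D i (D j u) (z0, t0)
        + (if i = j then \<eta> * (v $ i * v $ j) else 0))"
      unfolding inner_matrix_sum A_def by (intro sum.cong refl) (simp add: algebra_simps)
    then show ?thesis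
      by (simp add: sum.distrib u2_def dirder_sum(3)[OF P(1), where v=v] inner_vec_def sum_distrib_left)
  qed
  have t0: "t0 \<in> {0..t0}" using X(2)[OF P(1)] by simp
  have psd: "v \<bullet> (A *v v) \<ge> 0" for v
    using nonneg[OF X(1)[OF P(1)] t0, of "J *v v"] unfolding q A by (simp add: \<eta>_def)
  have symA: "transpose A = A"
    using smooth_dirder_commute[OF V(1,2) P(1)] by (simp add: A_def transpose_def vec_eq_iff)
  define v1 where "v1 = matrix_inv J *v w0"
  have Jv1: "J *v v1 = w0"
    using matrix_inv(1)[OF reparam(5)[OF P(1)]] by (simp add: v1_def J_def matrix_vector_mul_assoc)
  then have "v1 \<noteq> 0" using w0(1) by auto
  have "v1 \<bullet> (A *v v1) = 0"
    using w0(2) q[of v1] unfolding Jv1 A by (simp add: \<eta>_def)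
  then have Av1: "A *v v1 = 0" by (rule positive_semidefinite_null_vector[OF symA psd])
  \<comment> \<open>The chart vector \<open>w0\<close> has been pulled back to graph coordinates as
    \<open>v1\<close>; the maximum principle asks for a unit vector there.\<close>
  define v where "v = v1 /\<^sub>R norm v1"
  have Av: "A *v v = 0" by (simp add: v_def matrix_vector_mult_scaleR Av1)
  have "norm v = 1" using \<open>v1 \<noteq> 0\<close> by (simp add: v_def)
  then have vv: "v \<bullet> v = 1" by (simp add: norm_eq_1)
  have eig: "D i (dirder (v, 0) u) (z0, t0) = - \<eta> * v $ i" for i
  proof -
    have "(A *v v) $ i = (\<Sum>j\<in>UNIV. v $ j * D i (D j u) (z0, t0) + (if i = j then \<eta> * v $ j else 0))"
      unfolding matrix_vector_mult_def A_def by (simp add: algebra_simps) (intro sum.cong refl, simp add: algebra_simps)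
    then show ?thesis
      using Av by (simp add: sum.distrib dirder_sum(2)[OF P(1), where v=v])
  qed
  have zero: "u2 v = - \<eta>" using A[of v] Av vv by simp
  define S where "S = (\<Sum>k\<in>UNIV. \<Sum>i\<in>UNIV. (D k (D i u) (z0, t0))\<^sup>2)"
  define b where "b i = (\<chi> k. (B *v e k) \<bullet> e i)" for i
  have K: "K \<le> S + (B *v N) \<bullet> N - 2 * (\<Sum>i\<in>UNIV. (b i \<bullet> v) * v $ i)"
    unfolding S_def
  proof (rule local_maximum_principle[OF V(1,2) P(1) \<epsilon> graph_equation, folded b_def])
    show "(\<Sum>i\<in>UNIV. v $ i * v $ i) = 1" using vv by (simp add: inner_vec_def)
    show "dirder (v, 0) (dirder (v, 0) u) (z0, t0) = - (\<epsilon> * exp (K * t0))"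
      using zero by (simp add: u2_def \<eta>_def)
    show "D i (dirder (v, 0) u) (z0, t0) = - (\<epsilon> * exp (K * t0)) * v $ i" for i
      using eig by (simp add: \<eta>_def)
    fix z t assume zt: "(z, t) \<in> V" "t \<le> t0"
    define s p d k where "s = \<sigma> (z, t)" and "p = (\<Sum>i\<in>UNIV. D i u (z, t) * D i u (z, t))"
      and "d = dirder (v, 0) u (z, t)" and "k = \<epsilon> * exp (K * t)"
    have s: "s > 0" "s\<^sup>2 * (1 + p) = 1" using normal_graph[OF zt(1)] by (simp_all add: s_def p_def)
    have "p \<ge> 0" unfolding p_def by (intro sum_nonneg) simp
    have "k > 0" using \<epsilon> by (simp add: k_def)
    \<comment> \<open>Here \<open>inverse s\<close> is \<open>W\<close>, the square root of
      \<open>1 + p\<close>. Replacing it by its tangent line at \<open>p = 0\<close> only enlarges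
      the test function and makes it polynomial in the gradient.\<close>
    have r: "inverse s \<le> 1 + 1 / 2 * p"
    proof (rule power2_le_imp_le)
      have "(inverse s)\<^sup>2 = 1 + p"
        using s inverse_unique[OF s(2)] by (simp add: power_inverse)
      also have "\<dots> \<le> (1 + 1 / 2 * p)\<^sup>2" by (simp add: power2_eq_square algebra_simps)
      finally show "(inverse s)\<^sup>2 \<le> (1 + 1 / 2 * p)\<^sup>2" .
    qed (use \<open>p \<ge> 0\<close> in simp)
    have "0 \<le> s * dirder (v, 0) (dirder (v, 0) u) (z, t) + k * (1 + d * d)"
      using nonneg[OF X(1)[OF zt(1)], of t "jac (z, t) *v v"] X(2)[OF zt(1)] zt(2)
      unfolding quadratic_forms_\<Gamma>[OF zt(1)] vv s_def[symmetric] d_def[symmetric] k_def[symmetric] by simp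
    then have "0 \<le> inverse s * (s * dirder (v, 0) (dirder (v, 0) u) (z, t) + k * (1 + d * d))"
      using s(1) by simp
    also have "\<dots> = dirder (v, 0) (dirder (v, 0) u) (z, t) + k * (inverse s * (1 + d * d))"
      using s(1) by (simp add: field_simps)
    also have "\<dots> \<le> dirder (v, 0) (dirder (v, 0) u) (z, t) + k * ((1 + 1 / 2 * p) * (1 + d * d))"
      using r \<open>k > 0\<close> by (intro add_left_mono mult_left_mono mult_right_mono) auto
    finally show "0 \<le> dirder (v, 0) (dirder (v, 0) u) (z, t) + \<epsilon> * exp (K * t) *
        ((1 + 1 / 2 * (\<Sum>i\<in>UNIV. D i u (z, t) * D i u (z, t))) *
         (1 + dirder (v, 0) u (z, t) * dirder (v, 0) u (z, t)))"
      by (simp add: k_def p_def d_def)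
  qed (assumption | rule crit)+
  have u2_bound: "\<bar>u2 w\<bar> \<le> C * (w \<bullet> w)" for w using C[of "J *v w"] unfolding q .
  have "C \<ge> 0" using u2_bound[of v] vv by simp
  \<comment> \<open>Polarization: twice the entry is the form at \<open>axis i 1 + axis j 1\<close>,
    whose squared length is at most 4, minus its values at the two unit vectors. The bounds add up
    to \<open>4 * C + C + C\<close>.\<close>
  have "\<bar>D i (D j u) (z0, t0)\<bar> \<le> 3 * C" for i j
  proof -
    have u2_eq: "u2 w = w \<bullet> ((\<chi> i j. D i (D j u) (z0, t0)) *v w)" for w
      by (simp add: u2_def dirder_sum(3)[OF P(1), where v=w] inner_matrix_sum)
    have entry: "axis i 1 \<bullet> ((\<chi> i j. D i (D j u) (z0, t0)) *v axis j 1) = D i (D j u) (z0, t0)" for i j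
      by (simp add: matrix_vector_mult_basis column_def inner_axis' )
    have "D j (D i u) (z0, t0) = D i (D j u) (z0, t0)" by (rule smooth_dirder_commute[OF V(1,2) P(1)])
    then have "u2 (axis i 1 + axis j 1) = u2 (axis i 1) + 2 * D i (D j u) (z0, t0) + u2 (axis j 1)"
      unfolding u2_eq by (simp add: matrix_vector_right_distrib inner_add_left inner_add_right entry)
    moreover have "\<bar>u2 (axis i 1)\<bar> \<le> C" for i using u2_bound[of "axis i 1"] by (simp add: inner_axis_axis)
    moreover have "\<bar>u2 (axis i 1 + axis j 1)\<bar> \<le> C * 4"
    proof (rule order_trans[OF u2_bound])
      have "(axis i 1 + axis j 1) \<bullet> (axis i 1 + axis j 1 :: real ^ 'n) \<le> 4"
        by (simp add: inner_add_left inner_add_right inner_axis_axis)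
      then show "C * ((axis i 1 + axis j 1) \<bullet> (axis i 1 + axis j 1 :: real ^ 'n)) \<le> C * 4"
        using \<open>C \<ge> 0\<close> by (rule mult_left_mono)
    qed
    ultimately show ?thesis by (smt (verit))
  qed
  then have "(D k (D i u) (z0, t0))\<^sup>2 \<le> (3 * C)\<^sup>2" for k i
    using abs_le_square_iff[of "D k (D i u) (z0, t0)" "3 * C"] \<open>C \<ge> 0\<close> by (simp add: abs_mult)
  then have "S \<le> (\<Sum>k\<in>(UNIV :: 'n set). \<Sum>i\<in>(UNIV :: 'n set). (3 * C)\<^sup>2)"
    unfolding S_def by (intro sum_mono)
  then have S: "S \<le> 9 * C\<^sup>2 * (real CARD('n))\<^sup>2" by (simp add: power2_eq_square algebra_simps)
  have "(B *v N) \<bullet> N \<le> \<beta>" using \<beta>[of N] NN by (simp add: inner_commute)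
  moreover have "\<bar>\<Sum>i\<in>UNIV. (b i \<bullet> v) * v $ i\<bar> \<le> \<beta>"
  proof -
    \<comment> \<open>The ambient unit vector with tangential coordinates \<open>v\<close>; the sum
      to be bounded is the quadratic form of \<open>B\<close> at \<open>E\<close>.\<close>
    define E where "E = (\<Sum>i\<in>UNIV. (v $ i) *\<^sub>R e i)"
    have "B *v E = (\<Sum>k\<in>UNIV. (v $ k) *\<^sub>R (B *v e k))"
      by (simp add: E_def linear_sum[OF matrix_vector_mul_linear] matrix_vector_mult_scaleR)
    then have "E \<bullet> (B *v E) = (\<Sum>i\<in>UNIV. (b i \<bullet> v) * v $ i)"
      unfolding E_def[of] inner_sum_left
      by (simp add: inner_sum_right b_def inner_vec_def[of _ v] sum_distrib_left sum_distrib_right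
          inner_commute[of "e _"] mult_ac)
    moreover have "E \<bullet> E = 1"
      using vv by (simp add: E_def inner_sum_left inner_sum_right ee inner_vec_def[of v v]
          if_distrib[where f="\<lambda>x. _ * x"] cong: if_cong)
    ultimately show ?thesis using \<beta>[of E] by simp
  qed
  ultimately show ?thesis using K S by linarith
qed

end

lemma (in flow_chart) null_vector_estimate:
  assumes P: "x0 \<in> Om" "t0 \<in> {0<..<T}" and \<epsilon>: "\<epsilon> > 0"
    and nonneg: "\<And>x t w. x \<in> Om \<Longrightarrow> t \<in> {0..t0} \<Longrightarrow>
      w \<bullet> (chart_second_ff (x, t) *v w) + \<epsilon> * exp (K * t) * (w \<bullet> (chart_metric (x, t) *v w)) \<ge> 0"
    and w0: "w0 \<noteq> 0" "w0 \<bullet> (chart_second_ff (x0, t0) *v w0) + \<epsilon> * exp (K * t0) * (w0 \<bullet> (chart_metric (x0, t0) *v w0)) = 0"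
    and C: "\<And>w. \<bar>w \<bullet> (chart_second_ff (x0, t0) *v w)\<bar> \<le> C * (w \<bullet> (chart_metric (x0, t0) *v w))"
    and \<beta>: "\<And>\<xi>. \<bar>\<xi> \<bullet> (B *v \<xi>)\<bar> \<le> \<beta> * (\<xi> \<bullet> \<xi>)"
  shows "K \<le> 9 * C\<^sup>2 * (real CARD('n))\<^sup>2 + 3 * \<beta>"
proof -
  obtain e V u X z0 where G: "graph_chart Om T f \<nu> c B e (- \<nu> (x0, t0)) V u X"
    and z0: "(z0, t0) \<in> V" "X (z0, t0) = x0"
    by (rule graph_chart_exists[OF P])
  show ?thesis
    using graph_chart.null_vector_estimate_graph[OF G z0(1) _ \<epsilon> nonneg w0(1) _ _ \<beta>] w0(2) C z0(2) by simp
qed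

section \<open>Potentials with vanishing third derivatives\<close>

lemma constant_if_partials_zero:
  fixes g :: "real ^ 'n::finite \<Rightarrow> real"
  assumes "smooth_on UNIV g" "\<And>i x. partial i g x = 0"
  shows "\<exists>k. \<forall>x. g x = k"
proof -
  have "(g has_derivative (\<lambda>h. 0)) (at x)" for x
  proof -
    have d: "(g has_derivative (\<lambda>v. dirder v g x)) (at x)"
      using assms(1) by (intro smooth_on_has_derivative[where S=UNIV]) auto
    have "dirder v g x = 0" for v
      using dirder_eq_sum_partial[OF d, of v] assms(2) by simp
    then show ?thesis using d by simp
  qed
  then show ?thesis using has_derivative_zero_constant[of UNIV g] by auto
qed

text \<open>The first partials are constants; after subtracting the linear function with these
  coefficients all partials vanish.\<close>

lemma affine_if_second_partials_zero:
  fixes g :: "real ^ 'n::finite \<Rightarrow> real"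
  assumes g: "smooth_on UNIV g" and "\<And>i j x. partial i (partial j g) x = 0"
  shows "\<exists>k b. \<forall>x. g x = k + b \<bullet> x"
proof -
  have "\<exists>k. \<forall>x. partial j g x = k" for j
    using assms(2) smooth_on_dirder[OF _ g]
    by (intro constant_if_partials_zero) (auto simp: partial_eq_dirder)
  then obtain b where b: "\<And>j x. partial j g x = b j" by metis
  define l where "l x = (\<chi> j. b j) \<bullet> x" for x
  have "bounded_linear l" unfolding l_def by (rule bounded_linear_inner_right)
  then have l: "bounded_linear (\<lambda>x. - l x)" by (rule bounded_linear_minus)
  have "\<exists>k. \<forall>x. g x + - l x = k"
  proof (rule constant_if_partials_zero)
    show "smooth_on UNIV (\<lambda>x. g x + - l x)"
      using g Ck_on_add[OF open_UNIV _ Ck_on_bounded_linear[OF l]] by (simp add: smooth_on_def)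
    fix i x
    have "(g has_derivative (\<lambda>v. dirder v g x)) (at x)"
      using g by (intro smooth_on_has_derivative[where S=UNIV]) auto
    from dirder_eqI[OF has_derivative_add[OF this bounded_linear_imp_has_derivative[OF l]], of "axis i 1"]
    show "partial i (\<lambda>x. g x + - l x) x = 0"
      using b[of i x] by (simp add: partial_eq_dirder l_def inner_axis)
  qed
  then obtain k where "g x + - l x = k" for x by blast
  then show ?thesis by (intro exI[of _ k] exI[of _ "\<chi> j. b j"]) (simp add: l_def algebra_simps)
qed

lemma affine_grad:
  fixes \<omega> :: "real ^ 'n::finite \<Rightarrow> real"
  assumes "smooth_on UNIV \<omega>" "\<And>i j k x. partial i (partial j (partial k \<omega>)) x = 0"
  shows "\<exists>c B. \<forall>x. grad \<omega> x = c + B *v x"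
proof -
  have "\<exists>k b. \<forall>x. partial i \<omega> x = k + b \<bullet> x" for i
    using assms(2) smooth_on_dirder[OF _ assms(1)]
    by (intro affine_if_second_partials_zero) (auto simp: partial_eq_dirder)
  then obtain k b where "\<And>i x. partial i \<omega> x = k i + b i \<bullet> x" by metis
  then have "grad \<omega> x = (\<chi> i. k i) + (\<chi> i. b i) *v x" for x
    by (simp add: grad_def vec_eq_iff matrix_vector_mult_def inner_vec_def)
  then show ?thesis by blast
qed

section \<open>Positive definiteness on the compact manifold\<close>

text \<open>Failure of definiteness is witnessed by a unit vector. The witnesses form a closed set,
  and projecting along the compact unit sphere preserves closedness.\<close>

lemma openin_positive_definite:
  fixes A :: "'a::euclidean_space \<Rightarrow> real ^ 'n::finite ^ 'n"
  assumes "continuous_on S A"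
  shows "openin (top_of_set S) {s \<in> S. \<forall>v. v \<noteq> 0 \<longrightarrow> v \<bullet> (A s *v v) > 0}"
proof -
  define Q where "Q = {p \<in> sphere (0 :: real ^ 'n) 1 \<times> S. fst p \<bullet> (A (snd p) *v fst p) \<in> {..0}}"
  have "continuous_on (sphere (0 :: real ^ 'n) 1 \<times> S) (\<lambda>p. fst p \<bullet> (A (snd p) *v fst p))"
  proof -
    have "continuous_on (sphere (0 :: real ^ 'n) 1 \<times> S) (\<lambda>p. A (snd p))"
      by (rule continuous_on_compose2[OF assms continuous_on_snd[OF continuous_on_id]]) auto
    then show ?thesis
      unfolding inner_matrix_sum by (intro continuous_intros) auto
  qed
  then have "closedin (top_of_set (sphere (0 :: real ^ 'n) 1 \<times> S)) Q"
    unfolding Q_def by (rule continuous_closedin_preimage[unfolded vimage_def Int_def, simplified]) auto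
  then have "closedin (top_of_set S) (snd ` Q)"
    by (rule Starlike.closed_map_snd[OF compact_sphere])
  then have "openin (top_of_set S) (S - snd ` Q)" by (simp add: openin_diff)
  moreover have "S - snd ` Q = {s \<in> S. \<forall>v. v \<noteq> 0 \<longrightarrow> v \<bullet> (A s *v v) > 0}"
  proof (intro set_eqI iffI)
    fix s assume s: "s \<in> S - snd ` Q"
    have "v \<bullet> (A s *v v) > 0" if "v \<noteq> 0" for v
    proof (rule ccontr)
      assume neg: "\<not> v \<bullet> (A s *v v) > 0"
      define w where "w = v /\<^sub>R norm v"
      have "w \<bullet> (A s *v w) = (inverse (norm v) * inverse (norm v)) * (v \<bullet> (A s *v v))"
        by (simp add: w_def matrix_vector_mult_scaleR)
      also have "\<dots> \<le> 0" using neg by (intro mult_nonneg_nonpos) auto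
      finally have "(w, s) \<in> Q" using s that by (simp add: Q_def w_def)
      then show False using s by force
    qed
    then show "s \<in> {s \<in> S. \<forall>v. v \<noteq> 0 \<longrightarrow> v \<bullet> (A s *v v) > 0}" using s by simp
  next
    fix s assume s: "s \<in> {s \<in> S. \<forall>v. v \<noteq> 0 \<longrightarrow> v \<bullet> (A s *v v) > 0}"
    have "v \<notin> sphere 0 1 \<or> v \<bullet> (A s *v v) > 0" for v
      using s by (cases "v = 0") auto
    then have "s \<notin> snd ` Q" unfolding Q_def by fastforce
    then show "s \<in> S - snd ` Q" using s by simp
  qed
  ultimately show ?thesis by simp
qed

locale affine_flow =
  fixes M :: "'p topology" and A :: "('p, 'n::finite) chart set" and T :: real
    and F \<nu> :: "real \<Rightarrow> 'p \<Rightarrow> real ^ ('n option)" and \<omega>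
    and c :: "real ^ ('n option)" and B
  assumes manifold: "compact_oriented_manifold M A" and T_pos: "T > 0"
    and flow: "smooth_flow_solution A \<omega> T F \<nu>"
    and grad: "\<And>\<xi>. grad \<omega> \<xi> = c + B *v \<xi>"
begin

lemma chart:
  assumes "(U, \<phi>) \<in> A"
  shows "openin M U" "U \<subseteq> topspace M" "open (\<phi> ` U)" "inj_on \<phi> U"
    "homeomorphic_map (subtopology M U) (top_of_set (\<phi> ` U)) \<phi>"
    "topspace (subtopology M U) = U"
proof -
  have ch: "is_chart M (U, \<phi>)"
    using manifold assms by (auto simp: compact_oriented_manifold_def oriented_atlas_def)
  then show o: "openin M U" "open (\<phi> ` U)"
    and h: "homeomorphic_map (subtopology M U) (top_of_set (\<phi> ` U)) \<phi>"
    by (auto simp: is_chart_def)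
  show U: "U \<subseteq> topspace M" using o(1) by (rule openin_subset)
  then show t: "topspace (subtopology M U) = U" by auto
  show "inj_on \<phi> U" using homeomorphic_imp_injective_map[OF h] by (simp only: t)
qed

lemma chart_image_open:
  assumes "(U, \<phi>) \<in> A" "openin M W"
  shows "open (\<phi> ` (U \<inter> W))"
proof -
  have "openin (subtopology M U) (U \<inter> W)"
    using assms(2) by (metis inf_commute openin_subtopology_Int)
  then have "openin (top_of_set (\<phi> ` U)) (\<phi> ` (U \<inter> W))"
    using homeomorphic_imp_open_map[OF chart(5)[OF assms(1)]] by (simp add: open_map_def)
  then show ?thesis using chart(3)[OF assms(1)] openin_open_trans by blast
qed

lemma covered: "p \<in> topspace M \<Longrightarrow> \<exists>U \<phi>. (U, \<phi>) \<in> A \<and> p \<in> U"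
  using manifold by (auto simp: compact_oriented_manifold_def oriented_atlas_def)

definition second_form :: "('p, 'n) chart \<Rightarrow> real \<Rightarrow> 'p \<Rightarrow> real ^ 'n ^ 'n" where
  "second_form ch t p = second_ff (in_chart ch (F t)) (\<nu> t p) (snd ch p)"

definition first_form :: "('p, 'n) chart \<Rightarrow> real \<Rightarrow> 'p \<Rightarrow> real ^ 'n ^ 'n" where
  "first_form ch t p = metric (in_chart ch (F t)) (snd ch p)"

lemma flow_chart_in_chart:
  assumes ch: "(U, \<phi>) \<in> A"
  shows "flow_chart (\<phi> ` U) T (\<lambda>(x, t). in_chart (U, \<phi>) (F t) x) (\<lambda>(x, t). \<nu> t (inv_into U \<phi> x)) c B"
proof
  have fl: "smooth_family A T F" "\<And>t. t \<in> {0..T} \<Longrightarrow> smooth_immersion A (F t)"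
    "\<And>t. t \<in> {0..T} \<Longrightarrow> outer_unit_normal A (F t) (\<nu> t)"
    using flow by (auto simp: smooth_flow_solution_def)
  show "open (\<phi> ` U)" by (rule chart(3)[OF ch])
  show "smooth_on (\<phi> ` U \<times> {0..T}) (\<lambda>(x, t). in_chart (U, \<phi>) (F t) x)"
    using fl(1) ch by (auto simp: smooth_family_def)
  show "T > 0" by (rule T_pos)
  fix x t assume x: "x \<in> \<phi> ` U" and t: "t \<in> {0..T}"
  define p where "p = inv_into U \<phi> x"
  have p: "p \<in> U" "\<phi> p = x" using x by (simp_all add: p_def inv_into_into f_inv_into_f)
  show "inj (\<lambda>v. dirder v (\<lambda>x. case (x, t) of (x, t) \<Rightarrow> in_chart (U, \<phi>) (F t) x) x)"
    using fl(2)[OF t] ch x by (auto simp: smooth_immersion_def dirder_def)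
  have n: "norm (\<nu> t p) = 1" "\<And>i. \<nu> t p \<bullet> partial i (in_chart (U, \<phi>) (F t)) (\<phi> p) = 0"
    "det (\<chi> r c. (case c of None \<Rightarrow> \<nu> t p | Some i \<Rightarrow> partial i (in_chart (U, \<phi>) (F t)) (\<phi> p)) $ r) > 0"
    using fl(3)[OF t] ch p(1) unfolding outer_unit_normal_def by fast+
  show "norm (case (x, t) of (x, t) \<Rightarrow> \<nu> t (inv_into U \<phi> x)) = 1"
    using n(1) by (simp add: p_def)
  show "(case (x, t) of (x, t) \<Rightarrow> \<nu> t (inv_into U \<phi> x)) \<bullet>
      partial i (\<lambda>x. case (x, t) of (x, t) \<Rightarrow> in_chart (U, \<phi>) (F t) x) x = 0" for i
    using n(2)[of i] by (simp add: p(2)) (simp add: p_def)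
  show "0 < det (\<chi> r c. (case c of None \<Rightarrow> case (x, t) of (x, t) \<Rightarrow> \<nu> t (inv_into U \<phi> x)
      | Some i \<Rightarrow> partial i (\<lambda>x. case (x, t) of (x, t) \<Rightarrow> in_chart (U, \<phi>) (F t) x) x) $ r)"
    using n(3) unfolding prod.case p_def[symmetric] p(2) .
  have "((\<lambda>s. F s p) has_vector_derivative
           - (mean_curvature (in_chart (U, \<phi>) (F t)) (\<nu> t p) (\<phi> p)
              - grad \<omega> (F t p) \<bullet> \<nu> t p) *\<^sub>R \<nu> t p) (at t within {0..T})"
    using flow ch p(1) t unfolding smooth_flow_solution_def by fast
  moreover have "in_chart (U, \<phi>) (F s) x = F s p" for s by (simp add: in_chart_def p_def)
  ultimately show "((\<lambda>s. case (x, s) of (x, t) \<Rightarrow> in_chart (U, \<phi>) (F t) x) has_vector_derivative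
       - (mean_curvature (\<lambda>x. case (x, t) of (x, t) \<Rightarrow> in_chart (U, \<phi>) (F t) x)
            (case (x, t) of (x, t) \<Rightarrow> \<nu> t (inv_into U \<phi> x)) x -
          (c + B *v (case (x, t) of (x, t) \<Rightarrow> in_chart (U, \<phi>) (F t) x)) \<bullet>
            (case (x, t) of (x, t) \<Rightarrow> \<nu> t (inv_into U \<phi> x))) *\<^sub>R
          (case (x, t) of (x, t) \<Rightarrow> \<nu> t (inv_into U \<phi> x))) (at t within {0..T})"
    by (simp add: p(2) grad flip: p_def)
qed

end

text \<open>On the unit sphere \<open>G\<close> has a positive minimum and \<open>S\<close> is
  bounded by its operator norm. The inequality is strict because it has to establish the open
  condition used in the covering argument for \<open>second_form_bounded\<close>.\<close>

lemma quadratic_form_dominated: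
  fixes G S :: "real ^ 'n::finite ^ 'n"
  assumes pos: "\<And>v. v \<noteq> 0 \<Longrightarrow> v \<bullet> (G *v v) > 0"
  obtains m :: nat where "\<And>v. v \<noteq> 0 \<Longrightarrow> \<bar>v \<bullet> (S *v v)\<bar> < real m * (v \<bullet> (G *v v))"
proof -
  have "continuous_on (sphere 0 1) (\<lambda>v. v \<bullet> (G *v v))"
    by (intro continuous_intros linear_continuous_on matrix_vector_mul_bounded_linear)
  then obtain v0 where v0: "v0 \<in> sphere 0 1" "\<And>v. v \<in> sphere 0 1 \<Longrightarrow> v0 \<bullet> (G *v v0) \<le> v \<bullet> (G *v v)"
    using continuous_attains_inf[of "sphere (0 :: real ^ 'n) 1" "\<lambda>v. v \<bullet> (G *v v)"] by auto
  define g0 where "g0 = v0 \<bullet> (G *v v0)"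
  have "g0 > 0" unfolding g0_def using v0(1) by (intro pos) auto
  define s0 where "s0 = onorm ((*v) S)"
  obtain m :: nat where m: "s0 / g0 < real m" using reals_Archimedean2 by blast
  have "\<bar>v \<bullet> (S *v v)\<bar> < real m * (v \<bullet> (G *v v))" if "v \<noteq> 0" for v
  proof -
    define w where "w = v /\<^sub>R norm v"
    have v: "v = norm v *\<^sub>R w" and w: "w \<in> sphere 0 1" using that by (auto simp: w_def)
    have "\<bar>v \<bullet> (S *v v)\<bar> \<le> norm v * norm (S *v v)" by (rule Cauchy_Schwarz_ineq2)
    also have "\<dots> \<le> norm v * (s0 * norm v)"
      unfolding s0_def by (intro mult_left_mono onorm matrix_vector_mul_bounded_linear) auto
    also have "\<dots> = s0 * (norm v)\<^sup>2" by (simp add: power2_eq_square)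
    also have "\<dots> < (real m * g0) * (norm v)\<^sup>2"
      using m \<open>g0 > 0\<close> that by (intro mult_strict_right_mono) (auto simp: field_simps)
    also have "\<dots> = real m * ((norm v)\<^sup>2 * g0)" by simp
    also have "\<dots> \<le> real m * ((norm v)\<^sup>2 * (w \<bullet> (G *v w)))"
      using v0(2)[OF w] by (intro mult_left_mono) (auto simp: g0_def)
    also have "(norm v)\<^sup>2 * (w \<bullet> (G *v w)) = v \<bullet> (G *v v)"
      using arg_cong[OF v, of "\<lambda>u. u \<bullet> (G *v u)"]
      by (simp add: matrix_vector_mult_scaleR power2_eq_square)
    finally show ?thesis .
  qed
  then show ?thesis using that by blast
qed

section \<open>Chart independence, compactness and the first degenerate time\<close>

context affine_flow
begin

lemma chart_forms:
  assumes "(U, \<phi>) \<in> A" "p \<in> U"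
  shows "flow_chart.chart_second_ff (\<lambda>(x, t). in_chart (U, \<phi>) (F t) x) (\<lambda>(x, t). \<nu> t (inv_into U \<phi> x)) (\<phi> p, t)
      = second_form (U, \<phi>) t p"
    "flow_chart.chart_metric (\<lambda>(x, t). in_chart (U, \<phi>) (F t) x) (\<phi> p, t) = first_form (U, \<phi>) t p"
  using inv_into_f_f[OF chart(4)[OF assms(1)] assms(2)]
  by (simp_all add: flow_chart.chart_second_ff_def[OF flow_chart_in_chart[OF assms(1)]] flow_chart.chart_metric_def[OF flow_chart_in_chart[OF assms(1)]]
      second_form_def first_form_def)

lemma first_form_pos:
  assumes ch: "(U, \<phi>) \<in> A" "p \<in> U" and t: "t \<in> {0..T}" and v: "v \<noteq> 0"
  shows "v \<bullet> (first_form (U, \<phi>) t p *v v) > 0"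
proof -
  define f where "f = in_chart (U, \<phi>) (F t)"
  have im: "smooth_immersion A (F t)" using flow t by (auto simp: smooth_flow_solution_def)
  have x: "\<phi> p \<in> \<phi> ` U" using ch(2) by simp
  have sm: "smooth_on (\<phi> ` U) f" and inj: "inj (\<lambda>v. dirder v f (\<phi> p))"
    using im ch x by (auto simp: smooth_immersion_def f_def dirder_def)
  note df = smooth_on_has_derivative[OF chart(3)[OF ch(1)] sm x]
  have "dirder v f (\<phi> p) \<noteq> 0"
    using inj v linear_injective_0[OF has_derivative_linear[OF df]] by blast
  then show ?thesis
    using metric_quadratic_form[of v f "\<phi> p"] dirder_eq_sum_partial[OF df, of v]
    by (simp add: first_form_def f_def)
qed

lemma change_of_chart:
  assumes c: "(U, \<phi>) \<in> A" "p \<in> U" and d: "(W, \<psi>) \<in> A" "p \<in> W" and t: "t \<in> {0..T}"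
  obtains J where "invertible J" "second_form (U, \<phi>) t p = transpose J ** second_form (W, \<psi>) t p ** J"
    "first_form (U, \<phi>) t p = transpose J ** first_form (W, \<psi>) t p ** J"
proof -
  define \<tau> where "\<tau> = in_chart (U, \<phi>) \<psi>"
  define y f where "y = in_chart (W, \<psi>) (F t)" and "f = in_chart (U, \<phi>) (F t)"
  define R where "R = \<phi> ` (U \<inter> W)"
  note inv = inv_into_f_f[OF chart(4)[OF c(1)]] inv_into_f_f[OF chart(4)[OF d(1)]]
  have x: "\<phi> p \<in> R" using c d by (simp add: R_def)
  have \<tau>: "\<tau> (\<phi> q) = \<psi> q" if "q \<in> U" for q using inv(1)[OF that] by (simp add: \<tau>_def in_chart_def)
  have R: "open R" unfolding R_def by (rule chart_image_open[OF c(1) chart(1)[OF d(1)]])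
  have tr: "smooth_on R \<tau>" "det (matrix (frechet_derivative \<tau> (at (\<phi> p)))) > 0"
    using manifold c(1) d(1) x unfolding compact_oriented_manifold_def oriented_atlas_def \<tau>_def R_def by fast+
  have y: "smooth_on (\<psi> ` W) y"
    using flow t d(1) unfolding smooth_flow_solution_def smooth_immersion_def y_def by fast
  have sub: "\<tau> ` R \<subseteq> \<psi> ` W" using \<tau> by (auto simp: R_def)
  have f: "f z = y (\<tau> z)" if "z \<in> R" for z
    using that \<tau> inv by (auto simp: R_def f_def y_def in_chart_def)
  define J where "J = (\<chi> a i. partial i \<tau> (\<phi> p) $ a)"
  have J: "J = matrix (frechet_derivative \<tau> (at (\<phi> p)))"
    by (simp add: J_def matrix_def partial_def)
  have "\<nu> t p \<bullet> partial i y (\<psi> p) = 0" for i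
    using flow t d unfolding smooth_flow_solution_def outer_unit_normal_def y_def by fast
  then have n: "\<nu> t p \<bullet> partial i y (\<tau> (\<phi> p)) = 0" for i by (simp add: \<tau> c(2))
  show ?thesis
  proof
    show "invertible J" using tr(2) by (simp add: J invertible_det_nz)
    show "second_form (U, \<phi>) t p = transpose J ** second_form (W, \<psi>) t p ** J"
      using reparam_second_ff[OF R tr(1) chart(3)[OF d(1)] y sub f x n] \<tau>[OF c(2)]
      by (simp add: second_form_def f_def y_def J_def)
    show "first_form (U, \<phi>) t p = transpose J ** first_form (W, \<psi>) t p ** J"
      using reparam_metric[OF R tr(1) chart(3)[OF d(1)] y sub f x] \<tau>[OF c(2)]
      by (simp add: first_form_def f_def y_def J_def)
  qed
qed

text \<open>One notion for two purposes: \<open>a = 1\<close> with an exponential \<open>b\<close>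
  is the perturbed form of the maximum principle, while \<open>a = 1\<close> and
  \<open>a = -1\<close> with constant \<open>b\<close> give the two-sided bound on the second
  fundamental form.\<close>

definition positive :: "real \<Rightarrow> (real \<Rightarrow> real) \<Rightarrow> real \<Rightarrow> 'p \<Rightarrow> bool" where
  "positive a b t p \<longleftrightarrow> (\<forall>(U, \<phi>)\<in>A. p \<in> U \<longrightarrow> (\<forall>v. v \<noteq> 0 \<longrightarrow>
     a * (v \<bullet> (second_form (U, \<phi>) t p *v v)) + b t * (v \<bullet> (first_form (U, \<phi>) t p *v v)) > 0))"

lemma positiveD:
  "positive a b t p \<Longrightarrow> (U, \<phi>) \<in> A \<Longrightarrow> p \<in> U \<Longrightarrow> v \<noteq> 0 \<Longrightarrow>
    a * (v \<bullet> (second_form (U, \<phi>) t p *v v)) + b t * (v \<bullet> (first_form (U, \<phi>) t p *v v)) > 0"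
  by (auto simp: positive_def)

text \<open>Both forms change by congruence with the same invertible Jacobian, so a check in a
  single chart around \<open>p\<close> settles all charts.\<close>

lemma positiveI:
  assumes d: "(W, \<psi>) \<in> A" "p \<in> W" and t: "t \<in> {0..T}"
    and pos: "\<And>v. v \<noteq> 0 \<Longrightarrow>
      a * (v \<bullet> (second_form (W, \<psi>) t p *v v)) + b t * (v \<bullet> (first_form (W, \<psi>) t p *v v)) > 0"
  shows "positive a b t p"
  unfolding positive_def
proof (clarify)
  fix U \<phi> v assume c: "(U, \<phi>) \<in> A" "p \<in> U" and v: "v \<noteq> (0 :: real ^ 'n)"
  obtain J where J: "invertible J" "second_form (U, \<phi>) t p = transpose J ** second_form (W, \<psi>) t p ** J"
    "first_form (U, \<phi>) t p = transpose J ** first_form (W, \<psi>) t p ** J"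
    by (rule change_of_chart[OF c d t])
  have "J *v v \<noteq> 0"
    using inj_matrix_vector_mult[OF J(1)] v linear_injective_0[OF matrix_vector_mul_linear, of J] by blast
  from pos[OF this]
  show "0 < a * (v \<bullet> (second_form (U, \<phi>) t p *v v)) + b t * (v \<bullet> (first_form (U, \<phi>) t p *v v))"
    by (simp only: J(2,3) quadratic_form_congruence)
qed

text \<open>Near a given point one chart is enough, and there the forms are jointly continuous in
  space and time up to the end times.\<close>

lemma openin_positive:
  assumes b: "continuous_on {0..T} b"
  shows "openin (prod_topology M (top_of_set {0..T}))
    {q \<in> topspace M \<times> {0..T}. positive a b (snd q) (fst q)}"
proof (subst openin_subopen, clarify)
  fix p0 t0 assume p0: "p0 \<in> topspace M" "t0 \<in> {0..T}" "positive a b (snd (p0, t0)) (fst (p0, t0))"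
  obtain U \<phi> where ch: "(U, \<phi>) \<in> A" "p0 \<in> U" using covered[OF p0(1)] by blast
  interpret fc: flow_chart "\<phi> ` U" T "\<lambda>(x, t). in_chart (U, \<phi>) (F t) x" "\<lambda>(x, t). \<nu> t (inv_into U \<phi> x)" c B
    by (rule flow_chart_in_chart[OF ch(1)])
  define Q where "Q q = a *\<^sub>R fc.chart_second_ff q + b (snd q) *\<^sub>R fc.chart_metric q" for q
  have Q: "v \<bullet> (Q q *v v) = a * (v \<bullet> (fc.chart_second_ff q *v v)) + b (snd q) * (v \<bullet> (fc.chart_metric q *v v))" for v q
    by (simp add: Q_def matrix_vector_mult_add_rdistrib inner_add_right scaleR_matrix_vector_assoc[symmetric])
  define S where "S = {q \<in> \<phi> ` U \<times> {0..T}. \<forall>v. v \<noteq> 0 \<longrightarrow> v \<bullet> (Q q *v v) > 0}"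
  have "continuous_on (\<phi> ` U \<times> {0..T}) (\<lambda>q. b (snd q))"
    by (rule continuous_on_compose2[OF b continuous_on_snd[OF continuous_on_id]]) auto
  then have "continuous_on (\<phi> ` U \<times> {0..T}) Q"
    unfolding Q_def by (intro continuous_intros fc.continuous_chart_second_ff fc.continuous_chart_metric)
  then have "openin (top_of_set (\<phi> ` U \<times> {0..T})) S"
    unfolding S_def by (rule openin_positive_definite)
  then obtain G where G: "open G" "S = (\<phi> ` U \<times> {0..T}) \<inter> G" by (auto simp: openin_open)
  have "(\<phi> p0, t0) \<in> S"
    using positiveD[OF p0(3)[simplified] ch] p0(2) ch(2) by (simp add: S_def Q chart_forms[OF ch])
  then have "(\<phi> p0, t0) \<in> G" using G(2) by simp
  then obtain X Y where XY: "open X" "open Y" "(\<phi> p0, t0) \<in> X \<times> Y" "X \<times> Y \<subseteq> G"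
    using open_prod_elim[OF G(1)] by metis
  define O' where "O' = {p \<in> U. \<phi> p \<in> X}"
  have "continuous_map (subtopology M U) euclidean \<phi>"
    using homeomorphic_imp_continuous_map[OF chart(5)[OF ch(1)]] continuous_map_into_fulltopology by blast
  from openin_continuous_map_preimage[OF this, of X]
  have "openin (subtopology M U) O'"
    using XY(1) unfolding O'_def chart(6)[OF ch(1)] by simp
  then have O': "openin M O'" using chart(1)[OF ch(1)] openin_trans_full by blast
  show "\<exists>N. openin (prod_topology M (top_of_set {0..T})) N \<and> (p0, t0) \<in> N \<and>
      N \<subseteq> {q \<in> topspace M \<times> {0..T}. positive a b (snd q) (fst q)}"
  proof (intro exI conjI subsetI)
    have "openin (top_of_set {0..T}) ({0..T} \<inter> Y)" using XY(2) by (rule openin_open_Int)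
    then show "openin (prod_topology M (top_of_set {0..T})) (O' \<times> ({0..T} \<inter> Y))"
      using O' by (simp add: openin_prod_Times_iff)
    show "(p0, t0) \<in> O' \<times> ({0..T} \<inter> Y)" using ch(2) XY(3) p0(2) by (simp add: O'_def)
    fix q assume "q \<in> O' \<times> ({0..T} \<inter> Y)"
    then obtain p t where q: "q = (p, t)" "p \<in> U" "\<phi> p \<in> X" "t \<in> {0..T}" "t \<in> Y"
      by (auto simp: O'_def)
    have "(\<phi> p, t) \<in> S" using q XY(4) G(2) by auto
    then have "positive a b t p"
      using q(2) by (intro positiveI[OF ch(1) q(2,4)]) (simp add: S_def Q chart_forms[OF ch(1) q(2)])
    moreover have "p \<in> topspace M" using q(2) chart(2)[OF ch(1)] by auto
    ultimately show "q \<in> {q \<in> topspace M \<times> {0..T}. positive a b (snd q) (fst q)}" using q by simp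
  qed
qed

lemma compact_M: "compact_space M"
  using manifold by (simp add: compact_oriented_manifold_def)

text \<open>The bad points form a closed subset of space-time, and the projection to time is a
  closed map because the manifold is compact. This is what makes a first bad time exist.\<close>

lemma closed_nonpositive_times:
  assumes "continuous_on {0..T} b"
  shows "closed {t \<in> {0..T}. \<exists>p\<in>topspace M. \<not> positive a b t p}"
proof -
  define N where "N = topspace (prod_topology M (top_of_set {0..T}))
      - {q \<in> topspace M \<times> {0..T}. positive a b (snd q) (fst q)}"
  have "closedin (prod_topology M (top_of_set {0..T})) N"
    unfolding N_def by (rule openin_closedin_eq[THEN iffD1, THEN conjunct2, OF openin_positive[OF assms]])
  then have "closedin (top_of_set {0..T}) (snd ` N)"
    using Abstract_Topological_Spaces.closed_map_snd[OF compact_M, of "top_of_set {0..T}"]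
    unfolding closed_map_def by blast
  moreover have "snd ` N = {t \<in> {0..T}. \<exists>p\<in>topspace M. \<not> positive a b t p}"
    by (force simp: N_def)
  ultimately show ?thesis by (simp add: closedin_closed_eq)
qed

text \<open>Measuring the second form against the metric makes the bound independent of the chart.
  The open sets \<open>G m\<close> exhaust the compact space-time, so finitely many values of
  \<open>m\<close> suffice.\<close>

lemma second_form_bounded:
  obtains C where "\<And>U \<phi> p t v. (U, \<phi>) \<in> A \<Longrightarrow> p \<in> U \<Longrightarrow> t \<in> {0..T} \<Longrightarrow>
    \<bar>v \<bullet> (second_form (U, \<phi>) t p *v v)\<bar> \<le> C * (v \<bullet> (first_form (U, \<phi>) t p *v v))"
proof -
  let ?X = "prod_topology M (top_of_set {0..T})"
  define G where "G m = {q \<in> topspace M \<times> {0..T}. positive 1 (\<lambda>_. real m) (snd q) (fst q)} \<inter>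
     {q \<in> topspace M \<times> {0..T}. positive (-1) (\<lambda>_. real m) (snd q) (fst q)}" for m :: nat
  have "compact_space ?X"
    using compact_M by (simp add: compact_space_prod_topology compact_space_subtopology)
  then have comp: "compactin ?X (topspace ?X)" by (simp add: compact_space_def)
  have "\<exists>\<F>. finite \<F> \<and> \<F> \<subseteq> range G \<and> topspace ?X \<subseteq> \<Union>\<F>"
  proof (rule compactinD[OF comp])
    show "openin ?X S" if "S \<in> range G" for S
      using that unfolding G_def by (auto intro!: openin_Int openin_positive)
    show "topspace ?X \<subseteq> \<Union>(range G)"
    proof
      fix q assume "q \<in> topspace ?X"
      then obtain p t where q: "q = (p, t)" "p \<in> topspace M" "t \<in> {0..T}" by auto
      obtain U \<phi> where ch: "(U, \<phi>) \<in> A" "p \<in> U" using covered[OF q(2)] by blast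
      obtain m :: nat where m: "\<And>v. v \<noteq> 0 \<Longrightarrow> \<bar>v \<bullet> (second_form (U, \<phi>) t p *v v)\<bar>
          < real m * (v \<bullet> (first_form (U, \<phi>) t p *v v))"
        using quadratic_form_dominated[OF first_form_pos[OF ch q(3)]] by blast
      have "positive 1 (\<lambda>_. real m) t p" "positive (-1) (\<lambda>_. real m) t p"
        by (rule positiveI[OF ch q(3)], use m in fastforce)+
      then have "q \<in> G m" using q by (simp add: G_def)
      then show "q \<in> \<Union>(range G)" by blast
    qed
  qed
  then obtain \<F> where \<F>: "finite \<F>" "\<F> \<subseteq> range G" "topspace ?X \<subseteq> \<Union>\<F>" by blast
  obtain I where I: "finite I" "\<F> = G ` I" using finite_subset_image[OF \<F>(1,2)] by blast
  \<comment> \<open>Inserting 0 gives \<open>Max\<close> a nonempty set even when the finite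
    subcover is empty.\<close>
  define C where "C = real (Max (insert 0 I))"
  have "\<bar>v \<bullet> (second_form (U, \<phi>) t p *v v)\<bar> \<le> C * (v \<bullet> (first_form (U, \<phi>) t p *v v))"
    if ch: "(U, \<phi>) \<in> A" "p \<in> U" and t: "t \<in> {0..T}" for U \<phi> p t v
  proof (cases "v = 0")
    case False
    have "(p, t) \<in> topspace ?X" using ch t chart(2)[OF ch(1)] by auto
    then obtain m where m: "m \<in> I" "(p, t) \<in> G m" using \<F>(3) I(2) by blast
    then have p: "positive 1 (\<lambda>_. real m) t p" "positive (-1) (\<lambda>_. real m) t p" by (simp_all add: G_def)
    have "\<bar>v \<bullet> (second_form (U, \<phi>) t p *v v)\<bar> \<le> real m * (v \<bullet> (first_form (U, \<phi>) t p *v v))"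
      using positiveD[OF p(1) ch False] positiveD[OF p(2) ch False] by linarith
    also have "\<dots> \<le> C * (v \<bullet> (first_form (U, \<phi>) t p *v v))"
      using m(1) I(1) first_form_pos[OF ch t False] by (intro mult_right_mono) (auto simp: C_def)
    finally show ?thesis .
  qed simp
  then show ?thesis using that by blast
qed

text \<open>The choice of \<open>K\<close> contradicts the estimate at a first null vector. Taking
  \<open>s < T\<close> keeps the first bad time away from \<open>T\<close>, where no two-sided
  neighbourhood in time exists.\<close>

lemma convexity_preserved_perturbed:
  assumes init: "convex_hypersurface A (F 0) (\<nu> 0)" and \<epsilon>: "\<epsilon> > 0"
    and C: "\<And>U \<phi> p t v. (U, \<phi>) \<in> A \<Longrightarrow> p \<in> U \<Longrightarrow> t \<in> {0..T} \<Longrightarrow>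
      \<bar>v \<bullet> (second_form (U, \<phi>) t p *v v)\<bar> \<le> C * (v \<bullet> (first_form (U, \<phi>) t p *v v))"
    and \<beta>: "\<And>\<xi>. \<bar>\<xi> \<bullet> (B *v \<xi>)\<bar> \<le> \<beta> * (\<xi> \<bullet> \<xi>)"
    and K: "K > 9 * C\<^sup>2 * (real CARD('n))\<^sup>2 + 3 * \<beta>"
    and s: "s \<in> {0..<T}" and q: "q \<in> topspace M"
  shows "positive 1 (\<lambda>t. \<epsilon> * exp (K * t)) s q"
proof (rule ccontr)
  define b where "b t = \<epsilon> * exp (K * t)" for t
  have b_pos: "b t > 0" for t using \<epsilon> by (simp add: b_def)
  have b_cont: "continuous_on X b" for X unfolding b_def by (intro continuous_intros)
  assume "\<not> positive 1 (\<lambda>t. \<epsilon> * exp (K * t)) s q"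
  then have bad: "\<not> positive 1 b s q" by (simp add: b_def[abs_def])
  \<comment> \<open>The bad times up to \<open>s\<close>: a compact set containing \<open>s\<close>,
    whose least element is the first time at which positivity fails.\<close>
  define Z where "Z = {t \<in> {0..T}. \<exists>p\<in>topspace M. \<not> positive 1 b t p} \<inter> {0..s}"
  have "compact Z"
    unfolding Z_def by (intro closed_Int_compact closed_nonpositive_times b_cont) simp
  moreover have "s \<in> Z" using bad s q by (auto simp: Z_def)
  ultimately obtain t0 where t0: "t0 \<in> Z" "\<And>t. t \<in> Z \<Longrightarrow> t0 \<le> t"
    using compact_attains_inf[of Z] by blast
  have t0T: "t0 \<in> {0..T}" "t0 < T" using t0(1) s by (auto simp: Z_def)
  have good: "positive 1 b t p" if "t \<in> {0..<t0}" "p \<in> topspace M" for t p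
  proof (rule ccontr)
    assume "\<not> positive 1 b t p"
    then have "t \<in> Z" using that t0(1) by (auto simp: Z_def)
    then show False using t0(2)[of t] that(1) by simp
  qed
  obtain p0 where p0: "p0 \<in> topspace M" "\<not> positive 1 b t0 p0" using t0(1) by (auto simp: Z_def)
  obtain U \<phi> where ch: "(U, \<phi>) \<in> A" "p0 \<in> U" using covered[OF p0(1)] by blast
  have "\<exists>w. w \<noteq> 0 \<and>
      w \<bullet> (second_form (U, \<phi>) t0 p0 *v w) + b t0 * (w \<bullet> (first_form (U, \<phi>) t0 p0 *v w)) \<le> 0"
  proof (rule ccontr)
    assume "\<not> ?thesis"
    then have "positive 1 b t0 p0" by (intro positiveI[OF ch t0T(1)]) (auto simp: not_le)
    then show False using p0(2) by simp
  qed
  then obtain w0 where w0: "w0 \<noteq> 0"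
    "w0 \<bullet> (second_form (U, \<phi>) t0 p0 *v w0) + b t0 * (w0 \<bullet> (first_form (U, \<phi>) t0 p0 *v w0)) \<le> 0"
    by blast
  interpret fc: flow_chart "\<phi> ` U" T "\<lambda>(x, t). in_chart (U, \<phi>) (F t) x" "\<lambda>(x, t). \<nu> t (inv_into U \<phi> x)" c B
    by (rule flow_chart_in_chart[OF ch(1)])
  \<comment> \<open>At time 0 the second form is nonnegative by convexity, and the metric term adds
    something strictly positive.\<close>
  have "t0 \<noteq> 0"
  proof
    assume "t0 = 0"
    then have "w0 \<bullet> (second_form (U, \<phi>) t0 p0 *v w0) \<ge> 0"
      using init ch unfolding convex_hypersurface_def second_form_def by fastforce
    moreover have "b t0 * (w0 \<bullet> (first_form (U, \<phi>) t0 p0 *v w0)) > 0"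
      by (intro mult_pos_pos b_pos first_form_pos[OF ch t0T(1) w0(1)])
    ultimately show False using w0(2) by simp
  qed
  then have t0_int: "t0 \<in> {0<..<T}" using t0T by auto
  define val where "val x w t = w \<bullet> (fc.chart_second_ff (x, t) *v w) + b t * (w \<bullet> (fc.chart_metric (x, t) *v w))" for x w t
  have val_eq: "val (\<phi> p) w t = w \<bullet> (second_form (U, \<phi>) t p *v w) + b t * (w \<bullet> (first_form (U, \<phi>) t p *v w))"
    if "p \<in> U" for p w t
    by (simp add: val_def chart_forms[OF ch(1) that])
  \<comment> \<open>Before \<open>t0\<close> this is strict positivity; at \<open>t0\<close> itself
    it follows by continuity in time.\<close>
  have nonneg: "val x w t \<ge> 0" if x: "x \<in> \<phi> ` U" and t: "t \<in> {0..t0}" for x w t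
  proof -
    obtain p where p: "x = \<phi> p" "p \<in> U" using x by blast
    have pM: "p \<in> topspace M" using p(2) chart(2)[OF ch(1)] by auto
    have ge: "val x w r \<ge> 0" if "r \<in> {0..<t0}" for r
    proof (cases "w = 0")
      case False
      then show ?thesis
        using positiveD[OF good[OF that pM] ch(1) p(2) False] unfolding p(1) val_eq[OF p(2)] by simp
    qed (simp add: val_def)
    have "continuous_on {0..t0} (\<lambda>r. fc.chart_second_ff (x, r))" "continuous_on {0..t0} (\<lambda>r. fc.chart_metric (x, r))"
      using x t0T by (auto intro!: continuous_on_compose2[OF fc.continuous_chart_second_ff]
          continuous_on_compose2[OF fc.continuous_chart_metric] continuous_intros)
    then have "continuous_on {0..t0} (val x w)"
      unfolding val_def inner_matrix_sum by (intro continuous_intros b_cont)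
    moreover have "closure {0..<t0} = {0..t0}" using t0_int by (intro closure_atLeastLessThan) auto
    ultimately show ?thesis
      using continuous_ge_on_closure[of "{0..<t0}" "val x w" t 0] ge t by simp
  qed
  \<comment> \<open>The limit from earlier times gives one inequality and the failure of positivity
    the other, so \<open>w0\<close> is a genuine null vector of a semidefinite form.\<close>
  have zero: "val (\<phi> p0) w0 t0 = 0"
    using nonneg[of "\<phi> p0" t0 w0] w0(2) ch(2) t0T(1) val_eq[OF ch(2)] by simp
  have "K \<le> 9 * C\<^sup>2 * (real CARD('n))\<^sup>2 + 3 * \<beta>"
  proof (rule fc.null_vector_estimate[OF _ t0_int \<epsilon> _ w0(1) _ _ \<beta>])
    show "\<phi> p0 \<in> \<phi> ` U" using ch(2) by simp
    show "0 \<le> w \<bullet> (fc.chart_second_ff (x, t) *v w) + \<epsilon> * exp (K * t) * (w \<bullet> (fc.chart_metric (x, t) *v w))"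
      if "x \<in> \<phi> ` U" "t \<in> {0..t0}" for x t w
      using nonneg[OF that, of w] by (simp add: val_def b_def)
    show "w0 \<bullet> (fc.chart_second_ff (\<phi> p0, t0) *v w0) + \<epsilon> * exp (K * t0) * (w0 \<bullet> (fc.chart_metric (\<phi> p0, t0) *v w0)) = 0"
      using zero by (simp add: val_def b_def)
    show "\<bar>w \<bullet> (fc.chart_second_ff (\<phi> p0, t0) *v w)\<bar> \<le> C * (w \<bullet> (fc.chart_metric (\<phi> p0, t0) *v w))" for w
      unfolding chart_forms[OF ch] by (rule C[OF ch t0T(1)])
  qed
  then show False using K by simp
qed

text \<open>\<open>K\<close> is fixed before \<open>\<epsilon>\<close>, so \<open>\<epsilon>\<close>
  may tend to zero at a given point, time and vector.\<close>

lemma convexity_preserved: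
  assumes init: "convex_hypersurface A (F 0) (\<nu> 0)" and t: "t \<in> {0..T}"
  shows "convex_hypersurface A (F t) (\<nu> t)"
  unfolding convex_hypersurface_def
proof (clarify)
  fix U \<phi> p v assume ch: "(U, \<phi>) \<in> A" "p \<in> U"
  interpret fc: flow_chart "\<phi> ` U" T "\<lambda>(x, t). in_chart (U, \<phi>) (F t) x" "\<lambda>(x, t). \<nu> t (inv_into U \<phi> x)" c B
    by (rule flow_chart_in_chart[OF ch(1)])
  obtain C where C: "\<And>U \<phi> p t v. (U, \<phi>) \<in> A \<Longrightarrow> p \<in> U \<Longrightarrow> t \<in> {0..T} \<Longrightarrow>
      \<bar>v \<bullet> (second_form (U, \<phi>) t p *v v)\<bar> \<le> C * (v \<bullet> (first_form (U, \<phi>) t p *v v))"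
    by (rule second_form_bounded) (rule that)
  define \<beta> where "\<beta> = onorm ((*v) B)"
  have \<beta>: "\<bar>\<xi> \<bullet> (B *v \<xi>)\<bar> \<le> \<beta> * (\<xi> \<bullet> \<xi>)" for \<xi>
  proof -
    have "\<bar>\<xi> \<bullet> (B *v \<xi>)\<bar> \<le> norm \<xi> * norm (B *v \<xi>)" by (rule Cauchy_Schwarz_ineq2)
    also have "\<dots> \<le> norm \<xi> * (\<beta> * norm \<xi>)"
      unfolding \<beta>_def by (intro mult_left_mono onorm matrix_vector_mul_bounded_linear) auto
    finally show ?thesis by (simp add: dot_square_norm power2_eq_square mult_ac)
  qed
  define K where "K = 9 * C\<^sup>2 * (real CARD('n))\<^sup>2 + 3 * \<beta> + 1"
  have pM: "p \<in> topspace M" using ch chart(2)[OF ch(1)] by auto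
  define val where "val r = v \<bullet> (fc.chart_second_ff (\<phi> p, r) *v v)" for r
  have val_eq: "val r = v \<bullet> (second_form (U, \<phi>) r p *v v)" for r by (simp add: val_def chart_forms[OF ch])
  have ge: "val r \<ge> 0" if r: "r \<in> {0..<T}" for r
  proof (cases "v = 0")
    case False
    define k where "k = exp (K * r) * (v \<bullet> (first_form (U, \<phi>) r p *v v))"
    have "k > 0" unfolding k_def using r by (intro mult_pos_pos first_form_pos[OF ch] False) auto
    have "- val r \<le> 0 + e" if "e > 0" for e
    proof -
      \<comment> \<open>With \<open>\<epsilon> = e / k\<close> the perturbation evaluated at
        \<open>r\<close>, \<open>p\<close> and \<open>v\<close> is exactly \<open>e\<close>.\<close>
      have "positive 1 (\<lambda>t. (e / k) * exp (K * t)) r p"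
        using that \<open>k > 0\<close> by (intro convexity_preserved_perturbed[OF init _ C \<beta> _ r pM]) (auto simp: K_def)
      note perturbed = positiveD[OF this ch False]
      have "(e / k) * exp (K * r) * (v \<bullet> (first_form (U, \<phi>) r p *v v)) = (e / k) * k"
        by (subst (3) k_def) (simp only: mult.assoc)
      also have "\<dots> = e" using \<open>k > 0\<close> by simp
      finally show ?thesis using perturbed by (simp add: val_eq)
    qed
    then have "- val r \<le> 0" by (rule field_le_epsilon)
    then show ?thesis by simp
  qed (simp add: val_def)
  \<comment> \<open>The perturbed statement stops short of \<open>T\<close>; continuity of the
    second form in time includes the end point.\<close>
  have "continuous_on {0..T} (\<lambda>r. fc.chart_second_ff (\<phi> p, r))"
    using ch(2) by (auto intro!: continuous_on_compose2[OF fc.continuous_chart_second_ff] continuous_intros)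
  then have "continuous_on {0..T} val"
    unfolding val_def inner_matrix_sum by (intro continuous_intros)
  moreover have "closure {0..<T} = {0..T}" using T_pos by (intro closure_atLeastLessThan) auto
  ultimately have "val t \<ge> 0"
    using continuous_ge_on_closure[of "{0..<T}" val t 0] ge t by simp
  then show "0 \<le> v \<bullet> (second_ff (in_chart (U, \<phi>) (F t)) (\<nu> t p) (\<phi> p) *v v)"
    by (simp add: val_eq second_form_def)
qed

end

theorem theorem1p4:
  fixes M :: "'p topology"
    and A :: "('p, 'n::finite) chart set"
    and \<omega> :: "real ^ ('n option) \<Rightarrow> real"
    and T :: real
    and F \<nu> :: "real \<Rightarrow> 'p \<Rightarrow> real ^ ('n option)"
  assumes "compact_oriented_manifold M A"
    and "smooth_on UNIV \<omega>"
    and "T > 0"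
    and "smooth_flow_solution A \<omega> T F \<nu>"
    and "\<forall>i j k x. partial i (partial j (partial k \<omega>)) x = 0"
    and "convex_hypersurface A (F 0) (\<nu> 0)"
  shows "\<forall>t\<in>{0..T}. convex_hypersurface A (F t) (\<nu> t)"
proof -
  obtain c B where "\<And>x. grad \<omega> x = c + B *v x"
    using affine_grad[OF assms(2)] assms(5) by blast
  then interpret affine_flow M A T F \<nu> \<omega> c B
    using assms by unfold_locales auto
  show ?thesis using convexity_preserved[OF assms(6)] by blast
qed

end
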